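(* Let $N\ge 1$, $0<\theta\le 2$, let $\mu$ be a nonnegative locally integrable function on $\mathbb{R}^N$, and let $f\colon[0,\infty)\to[0,\infty)$ satisfy (M), (S) and (L). (a) If $f$ also satisfies (C), then there exists $\gamma=\gamma(N,\theta,f)>0$ such that if $G(\mu(x))\ge \gamma|x|^{-\theta}$ for almost all $x$ in a neighborhood of the origin, then problem (SHE) is not locally solvable. (b) Let $\mu\in\mathcal{B}$. If $f$ is supercritical, then there exists $\varepsilon=\varepsilon(N,\theta,f)>0$ such that if $G(\mu(x))\le \varepsilon|x|^{-\theta}$ for almost all $x$ in a neighborhood of the origin, then problem (SHE) is locally solvable; in particular there exists a solution $u\in L^\infty_{\rm loc}((0,T),L^\infty(\mathbb{R}^N))$ for some $T>0$.
   Context: Problem (SHE) is $\partial_t u+(-\Delta)^{\theta/2}u=f(u)$ in $\mathbb{R}^N\times(0,\infty)$, $u(\cdot,0)=\mu$. Let $\Gamma_\theta$ be the fundamental solution of $\partial_t u+(-\Delta)^{\theta/2}u=0$ on $\mathbb{R}^N\times(0,\infty)$ (the Gaussian heat kernel if $\theta=2$). For $T>0$ let $Q_T=\mathbb{R}^N\times(0,T)$. A solution of (SHE) in $Q_T$ is a nonnegative measurable function $u$ on $Q_T$, finite a.e., with $u(x,t)=\int_{\mathbb{R}^N}\Gamma_\theta(x-y,t)\mu(y)\,dy+\int_0^t\int_{\mathbb{R}^N}\Gamma_\theta(x-y,t-s)f(u(y,s))\,dy\,ds$ for a.a. $(x,t)\in Q_T$; (SHE) is locally solvable if such a solution exists for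 some $T>0$. Hypotheses: (M) $f$ is continuous, nondecreasing, and $f(u)>0$ for all $u>0$. (S) there is $\tau_0>0$ with $f\in C^1([\tau_0,\infty))$ and $\int_{\tau_0}^\infty ds/f(s)<\infty$. (C) there is $\tau_1\ge0$ such that $f$ is convex on $[\tau_1,\infty)$. For $f$ with (M),(S) define $F(u)=\int_u^\infty ds/f(s)$ for $u>0$, $F_0=\lim_{u\to0}F(u)\in(0,\infty]$, $G(u)=1/F(u)$ for $u>0$ and $G(0)=G_0:=1/F_0$ (with $G_0=0$ if $F_0=\infty$). (L) $q_f:=\lim_{u\to\infty}f'(u)F(u)$ exists and is finite. The growth exponent $p_f\in(1,\infty]$ is defined by $1/p_f+1/q_f=1$, and $f$ is called supercritical if $p_f>1+\theta/N$. $\mathcal{B}=\bigcap_{r>0}L^\infty(\mathbb{R}^N\setminus B_r)$, where $B_r$ is the open ball of radius $r$ centered at $0$. *)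

theory Defs
  imports "HOL-Analysis.Analysis"
begin

text \<open>Fundamental solution of the fractional heat equation
  \<open>\<partial>_t u + (-\<Delta>)^{\<theta>/2} u = 0\<close> on \<open>\<real>^N\<close>, \<open>N = CARD('n)\<close>, given by its
  Fourier representation \<open>(2\<pi>)^{-N} \<integral> e^{i x\<cdot>\<xi>} e^{-t|\<xi>|^\<theta>} d\<xi>\<close>
  (the imaginary part vanishes by symmetry, so we write the real part).\<close>
definition Gamma_frac :: "real \<Rightarrow> real^'n \<Rightarrow> real \<Rightarrow> real" where
  "Gamma_frac \<theta> x t =
     (1 / (2 * pi) ^ CARD('n)) *
     (LINT \<xi>|lborel. cos (x \<bullet> \<xi>) * exp (- t * norm \<xi> powr \<theta>))"

definition Ffun :: "(real \<Rightarrow> real) \<Rightarrow> real \<Rightarrow> real" where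
  "Ffun f u = integral {u..} (\<lambda>s. 1 / f s)"

definition F0 :: "(real \<Rightarrow> real) \<Rightarrow> ereal" where
  "F0 f = Lim (at_right 0) (\<lambda>u. ereal (Ffun f u))"

definition Gfun :: "(real \<Rightarrow> real) \<Rightarrow> real \<Rightarrow> real" where
  "Gfun f u = (if u > 0 then 1 / Ffun f u
               else if F0 f = \<infinity> then 0 else 1 / real_of_ereal (F0 f))"

definition hyp_M :: "(real \<Rightarrow> real) \<Rightarrow> bool" where
  "hyp_M f \<longleftrightarrow> continuous_on {0..} f \<and> mono_on {0..} f \<and> (\<forall>u>0. f u > 0)"

definition hyp_S :: "(real \<Rightarrow> real) \<Rightarrow> bool" where
  "hyp_S f \<longleftrightarrow> (\<exists>\<tau>0>0.
      (\<exists>f'. continuous_on {\<tau>0..} f' \<and>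
            (\<forall>u\<ge>\<tau>0. (f has_real_derivative f' u) (at u within {\<tau>0..}))) \<and>
      (\<lambda>s. 1 / f s) integrable_on {\<tau>0..})"

definition hyp_C :: "(real \<Rightarrow> real) \<Rightarrow> bool" where
  "hyp_C f \<longleftrightarrow> (\<exists>\<tau>1\<ge>0. convex_on {\<tau>1..} f)"

definition hyp_L :: "(real \<Rightarrow> real) \<Rightarrow> bool" where
  "hyp_L f \<longleftrightarrow> (\<exists>q. ((\<lambda>u. deriv f u * Ffun f u) \<longlongrightarrow> q) at_top)"

definition q_f :: "(real \<Rightarrow> real) \<Rightarrow> real" where
  "q_f f = Lim at_top (\<lambda>u. deriv f u * Ffun f u)"

text \<open>Growth exponent \<open>p_f \<in> (1,\<infinity>]\<close>, \<open>1/p_f + 1/q_f = 1\<close>.\<close>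
definition p_f :: "(real \<Rightarrow> real) \<Rightarrow> ereal" where
  "p_f f = (if q_f f = 1 then \<infinity> else ereal (q_f f / (q_f f - 1)))"

definition supercritical :: "real \<Rightarrow> (real \<Rightarrow> real) \<Rightarrow> nat \<Rightarrow> bool" where
  "supercritical \<theta> f N \<longleftrightarrow> p_f f > ereal (1 + \<theta> / real N)"

definition QT :: "real \<Rightarrow> ((real^'n) \<times> real) set" where
  "QT T = UNIV \<times> {0<..<T}"

definition is_solution ::
  "real \<Rightarrow> (real \<Rightarrow> real) \<Rightarrow> (real^'n \<Rightarrow> real) \<Rightarrow> real \<Rightarrow> ((real^'n) \<times> real \<Rightarrow> real) \<Rightarrow> bool" where
  "is_solution \<theta> f \<mu> T u \<longleftrightarrow>
     (\<forall>z\<in>QT T. u z \<ge> 0) \<and>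
     u \<in> borel_measurable (lebesgue_on (QT T)) \<and>
     (AE z in lebesgue. z \<in> QT T \<longrightarrow>
        ennreal (u z) =
          (\<integral>\<^sup>+ y. ennreal (Gamma_frac \<theta> (fst z - y) (snd z) * \<mu> y) \<partial>lebesgue)
          + (\<integral>\<^sup>+ s. indicator {0<..<snd z} s *
                (\<integral>\<^sup>+ y. ennreal (Gamma_frac \<theta> (fst z - y) (snd z - s) * f (u (y, s))) \<partial>lebesgue)
              \<partial>lebesgue))"

definition locally_solvable ::
  "real \<Rightarrow> (real \<Rightarrow> real) \<Rightarrow> (real^'n \<Rightarrow> real) \<Rightarrow> bool" where
  "locally_solvable \<theta> f \<mu> \<longleftrightarrow> (\<exists>T>0. \<exists>u. is_solution \<theta> f \<mu> T u)"

definition nonneg_loc_integrable :: "(real^'n \<Rightarrow> real) \<Rightarrow> bool" where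
  "nonneg_loc_integrable \<mu> \<longleftrightarrow>
     (\<forall>x. \<mu> x \<ge> 0) \<and> (\<forall>K. compact K \<longrightarrow> set_integrable lebesgue K \<mu>)"

definition in_B :: "(real^'n \<Rightarrow> real) \<Rightarrow> bool" where
  "in_B \<mu> \<longleftrightarrow> (\<forall>r>0. \<exists>C. AE x in lebesgue. x \<notin> ball 0 r \<longrightarrow> \<bar>\<mu> x\<bar> \<le> C)"

definition Linf_loc_time :: "real \<Rightarrow> ((real^'n) \<times> real \<Rightarrow> real) \<Rightarrow> bool" where
  "Linf_loc_time T u \<longleftrightarrow>
     (\<forall>a b. 0 < a \<and> a \<le> b \<and> b < T \<longrightarrow>
        (\<exists>C. AE z in lebesgue. snd z \<in> {a..b} \<longrightarrow> \<bar>u z\<bar> \<le> C))"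

end

theory Submission
  imports Defs "HOL-Probability.Characteristic_Functions"
begin

text \<open>The kernel is positive because \<open>|\<xi>|^\<theta>\<close> is a mixture of the functions \<open>1 - exp (- s |\<xi>|^2)\<close>:
  truncating the mixture turns \<open>exp (- t |\<xi>|^\<theta>)\<close> into the exponential of a mixture of Gaussians, a
  limit of polynomials in it. Mass one and the semigroup law then follow by Fourier inversion.
  Write \<open>S t\<close> for the semigroup.

  Both halves rest on \<open>(f F^\<kappa>)' = F^(\<kappa>-1) (f' F - \<kappa>)\<close>, so that \<open>f F^\<kappa>\<close> is eventually increasing
  for \<open>\<kappa> < q\<close> and eventually decreasing for \<open>\<kappa> > q\<close>.

  (a) \<open>F^(1/2)\<close> is convex near infinity, so Jensen's inequality bounds \<open>F (S t \<mu> x)^(1/2)\<close> by the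
  mean of \<open>F (\<mu>)^(1/2)\<close>, which is at most a small multiple of \<open>t^(1/2)\<close> for \<open>|x| \<le> t^(1/\<theta>)\<close> when
  \<open>\<gamma>\<close> is large. On the other hand, for a solution \<open>u\<close>, convexity of \<open>f\<close> makes
  \<open>s \<mapsto> S (t - s) (u s) x\<close> grow at least like a solution of \<open>w' = f w / 2\<close> up to time \<open>t\<close>, whence
  \<open>t \<le> 4 F (S t \<mu> x)\<close>.

  (b) Choose \<open>k\<close> with \<open>q - 1 < k < min q (N/\<theta>)\<close>, let \<open>\<Phi>\<close> be the (concave) inverse of \<open>G^k\<close> near
  infinity and \<open>h\<close> the solution of the linear equation with initial value \<open>G (max \<tau> \<mu>)^k\<close>. Then
  \<open>\<Phi> (2 h)\<close> is a supersolution: Jensen gives \<open>S t \<mu> \<le> \<Phi> (h t)\<close>, and as \<open>f (\<Phi> z) / z\<close> is increasing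
  and \<open>h s \<le> const * \<epsilon>^k s^(-k)\<close>, the nonlinear term is at most \<open>h t\<close> times an explicit integral
  in \<open>s\<close>, which the increment \<open>\<Phi> (2 h) - \<Phi> h\<close> absorbs for small \<open>\<epsilon>\<close>. Monotone iteration below the
  supersolution yields a solution.\<close>

section \<open>Integrals over Euclidean space\<close>

lemma integrable_mult_bounded:
  fixes f g :: "'a \<Rightarrow> real"
  assumes f: "integrable M f" and [measurable]: "g \<in> borel_measurable M" and bound: "\<And>x. \<bar>g x\<bar> \<le> B"
  shows "integrable M (\<lambda>x. f x * g x)"
proof (rule Bochner_Integration.integrable_bound)
  show "integrable M (\<lambda>x. B * f x)" by (intro integrable_mult_right f)
  have "\<bar>f x\<bar> * \<bar>g x\<bar> \<le> \<bar>f x\<bar> * \<bar>B\<bar>" for x using bound[of x] by (intro mult_left_mono) auto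
  then show "AE x in M. norm (f x * g x) \<le> norm (B * f x)" by (simp add: abs_mult mult.commute)
qed (use f in measurable)

lemma tendsto_integral_mult_bounded:
  fixes f :: "'a \<Rightarrow> real" and g :: "nat \<Rightarrow> 'a \<Rightarrow> real"
  assumes f: "integrable M f" and [measurable]: "\<And>n. g n \<in> borel_measurable M"
    and bound: "\<And>n x. \<bar>g n x\<bar> \<le> B" and lim: "\<And>x. (\<lambda>n. g n x) \<longlonglongrightarrow> h x"
  shows "(\<lambda>n. \<integral>x. f x * g n x \<partial>M) \<longlonglongrightarrow> (\<integral>x. f x * h x \<partial>M)"
proof (rule integral_dominated_convergence)
  have [measurable]: "h \<in> borel_measurable M"
    by (rule borel_measurable_LIMSEQ_real[OF lim]) measurable
  show "(\<lambda>x. f x * h x) \<in> borel_measurable M" using f by measurable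
  show "integrable M (\<lambda>x. B * \<bar>f x\<bar>)" using f by simp
  show "AE x in M. (\<lambda>n. f x * g n x) \<longlonglongrightarrow> f x * h x" by (intro AE_I2 tendsto_intros lim)
  have "\<bar>f x\<bar> * \<bar>g n x\<bar> \<le> B * \<bar>f x\<bar>" for n x
    using mult_left_mono[OF bound abs_ge_zero[of "f x"]] by (simp add: mult.commute)
  then show "AE x in M. norm (f x * g n x) \<le> B * \<bar>f x\<bar>" for n by (simp add: abs_mult)
qed (use f in measurable)

lemma lborel_Fubini_bounded_kernel:
  fixes f :: "'a::euclidean_space \<Rightarrow> real" and g :: "'b::euclidean_space \<Rightarrow> real"
  assumes f: "integrable lborel f" and g: "integrable lborel g"
    and k: "(\<lambda>(x, y). k x y) \<in> borel_measurable (borel \<Otimes>\<^sub>M borel)" "\<And>x y. \<bar>k x y\<bar> \<le> B"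
  shows "(LBINT x. LBINT y. f x * g y * k x y) = (LBINT y. LBINT x. f x * g y * k x y)"
proof -
  have [measurable]: "f \<in> borel_measurable borel" "g \<in> borel_measurable borel"
    using f g by (auto dest: borel_measurable_integrable)
  have "integrable (lborel \<Otimes>\<^sub>M lborel) (\<lambda>(x, y). f x * g y)"
    using f g by (intro lborel_pair.Fubini_integrable) (auto simp: norm_mult abs_mult)
  then have "integrable (lborel \<Otimes>\<^sub>M lborel)
      (\<lambda>z. (case z of (x, y) \<Rightarrow> f x * g y) * (case z of (x, y) \<Rightarrow> k x y))"
    by (rule integrable_mult_bounded) (use k in auto)
  then have "integrable (lborel \<Otimes>\<^sub>M lborel) (\<lambda>(x, y). f x * g y * k x y)"
    by (simp add: case_prod_unfold)
  then show ?thesis by (rule lborel_pair.Fubini_integral[symmetric])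
qed

lemma nn_integral_lborel_affine:
  fixes f :: "'a::euclidean_space \<Rightarrow> ennreal"
  assumes [measurable]: "f \<in> borel_measurable borel" and c: "c \<noteq> 0"
  shows "(\<integral>\<^sup>+x. f x \<partial>lborel) = ennreal (\<bar>c\<bar> ^ DIM('a)) * (\<integral>\<^sup>+x. f (a + c *\<^sub>R x) \<partial>lborel)"
  by (subst lborel_affine[OF c, of a])
     (simp add: nn_integral_density nn_integral_distr nn_integral_cmult ennreal_power)

lemma nn_integral_lborel_reflect:
  fixes f :: "'a::euclidean_space \<Rightarrow> ennreal"
  assumes "f \<in> borel_measurable borel"
  shows "(\<integral>\<^sup>+y. f (x - y) \<partial>lborel) = (\<integral>\<^sup>+y. f y \<partial>lborel)"
  using nn_integral_lborel_affine[OF assms, of "-1" x] by simp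

lemma lborel_integral_affine:
  fixes f :: "'a::euclidean_space \<Rightarrow> real"
  assumes [measurable]: "f \<in> borel_measurable borel" and c: "c \<noteq> 0"
  shows "(\<integral>x. f x \<partial>lborel) = \<bar>c\<bar> ^ DIM('a) * (\<integral>x. f (a + c *\<^sub>R x) \<partial>lborel)"
  by (subst lborel_affine[OF c, of a])
     (simp add: integral_density integral_distr ennreal_power)

lemma lborel_integral_reflect:
  fixes f :: "'a::euclidean_space \<Rightarrow> real"
  assumes "f \<in> borel_measurable borel"
  shows "(LBINT y. f (x - y)) = (LBINT y. f y)"
  using lborel_integral_affine[OF assms, of "-1" x] by simp

lemma lborel_integral_odd_eq_0:
  fixes f :: "'a::euclidean_space \<Rightarrow> real"
  assumes [measurable]: "f \<in> borel_measurable borel" and odd: "\<And>x. f (- x) = - f x"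
  shows "(LBINT x. f x) = 0"
proof -
  have "(LBINT x. f x) = (LBINT x. f (0 - x))" by (rule lborel_integral_reflect[symmetric]) fact
  then show ?thesis by (simp add: odd)
qed

lemma lborel_integral_prod_Basis:
  fixes f :: "'a::euclidean_space \<Rightarrow> real \<Rightarrow> 'b::{real_normed_field, banach, second_countable_topology}"
  assumes int: "\<And>b. b \<in> Basis \<Longrightarrow> integrable lborel (f b)"
  shows "(LBINT x. (\<Prod>b\<in>Basis. f b (x \<bullet> b))) = (\<Prod>b\<in>Basis. (LBINT y. f b y))"
proof -
  interpret product_sigma_finite "\<lambda>b::'a. lborel :: real measure" by standard
  have [measurable]: "\<And>b. b \<in> Basis \<Longrightarrow> f b \<in> borel_measurable borel"
    using int by (auto dest: borel_measurable_integrable)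
  have "(LBINT x. (\<Prod>b\<in>Basis. f b (x \<bullet> b))) =
     (\<integral>g. (\<Prod>b\<in>Basis. f b ((\<Sum>b'\<in>Basis. g b' *\<^sub>R b') \<bullet> b)) \<partial>(\<Pi>\<^sub>M b\<in>Basis. lborel))"
    by (subst lborel_eq, subst integral_distr) simp_all
  also have "\<dots> = (\<integral>g. (\<Prod>b\<in>Basis. f b (g b)) \<partial>(\<Pi>\<^sub>M b\<in>Basis. lborel))"
    by (intro Bochner_Integration.integral_cong refl prod.cong) simp
  also have "\<dots> = (\<Prod>b\<in>Basis. (LBINT y. f b y))"
    by (rule product_integral_prod) (use int in auto)
  finally show ?thesis .
qed

lemma not_AE_notin_open:
  fixes S :: "'a::euclidean_space set"
  assumes "open S" "S \<noteq> {}" shows "\<not> (AE z in lborel. z \<notin> S)"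
proof
  assume "AE z in lborel. z \<notin> S"
  then have "S \<in> null_sets lborel" using assms(1) by (subst (asm) AE_iff_null_sets[symmetric]) auto
  then have "negligible S" by (simp add: negligible_iff_null_sets null_sets_completionI)
  then show False using open_not_negligible assms by blast
qed

lemma AE_lborel_slices:
  fixes P :: "'a::euclidean_space \<times> 'b::euclidean_space \<Rightarrow> bool"
  assumes "AE z in lborel. P z"
  shows "AE s in lborel. AE y in lborel. P (y, s)"
proof -
  obtain N where N: "N \<in> null_sets (lborel \<Otimes>\<^sub>M lborel)" "{z \<in> space lborel. \<not> P z} \<subseteq> N"
    using assms unfolding eventually_ae_filter lborel_prod by blast
  have "AE z in lborel \<Otimes>\<^sub>M lborel. z \<notin> N" by (rule AE_not_in[OF N(1)])
  then have "AE y in lborel. AE s in lborel. (y, s) \<notin> N"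
    by (rule lborel_pair.AE_pair)
  moreover have "{z \<in> space (lborel \<Otimes>\<^sub>M lborel). (fst z, snd z) \<notin> N}
      = space (lborel \<Otimes>\<^sub>M lborel) - N"
    by auto
  then have "{z \<in> space (lborel \<Otimes>\<^sub>M lborel). (fst z, snd z) \<notin> N} \<in> sets (lborel \<Otimes>\<^sub>M lborel)"
    using null_setsD2[OF N(1)] by (simp only: sets.compl_sets)
  ultimately have "AE s in lborel. AE y in lborel. (y, s) \<notin> N"
    by (subst (asm) lborel_pair.AE_commute) auto
  then show ?thesis
  proof (rule eventually_mono)
    fix s :: 'b assume "AE y in lborel. (y, s) \<notin> N"
    then show "AE y in lborel. P (y, s)"
      by (rule eventually_mono) (use N(2) in auto)
  qed
qed

lemma nn_integral_powr_near_0: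
  fixes a c :: real assumes "a > -1" "c \<ge> 0"
  shows "(\<integral>\<^sup>+s\<in>{0..c}. ennreal (s powr a) \<partial>lborel) = ennreal (c powr (a + 1) / (a + 1))"
  using has_integral_powr_from_0[OF assms] by (intro nn_integral_has_integral_lebesgue') auto

lemma nn_integral_powr_near_inf:
  fixes a c :: real assumes "a < -1" "c > 0"
  shows "(\<integral>\<^sup>+s\<in>{c..}. ennreal (s powr a) \<partial>lborel) = ennreal (- (c powr (a + 1)) / (a + 1))"
  using has_integral_powr_to_inf[OF assms] by (intro nn_integral_has_integral_lebesgue') auto

lemma nn_integral_powr_weight_finite:
  fixes w :: "real \<Rightarrow> real"
  assumes [measurable]: "w \<in> borel_measurable borel" and a: "0 < a" "a < p"
    and near_0: "\<And>s. s > 0 \<Longrightarrow> w s \<le> A * s powr p" and bounded: "\<And>s. s > 0 \<Longrightarrow> w s \<le> B"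
    and "A \<ge> 0" "B \<ge> 0"
  shows "(\<integral>\<^sup>+s\<in>{0<..}. ennreal (w s * s powr (-1-a)) \<partial>lborel) < \<infinity>"
proof -
  have pointwise: "ennreal (w s * s powr (-1-a)) * indicator {0<..} s
      \<le> ennreal A * (ennreal (s powr (p-1-a)) * indicator {0..1} s)
        + ennreal B * (ennreal (s powr (-1-a)) * indicator {1..} s)" for s :: real
  proof -
    consider (nonpos) "s \<le> 0" | (near) "0 < s" "s < 1" | (far) "1 \<le> s" by linarith
    then show ?thesis
    proof cases
      case near
      have "w s * s powr (-1-a) \<le> (A * s powr p) * s powr (-1-a)"
        using near_0 near by (intro mult_right_mono) auto
      also have "\<dots> = A * s powr (p-1-a)" by (simp add: powr_add[symmetric] algebra_simps)
      finally have "ennreal (w s * s powr (-1-a)) \<le> ennreal A * ennreal (s powr (p-1-a))"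
        using \<open>A \<ge> 0\<close> by (simp add: ennreal_mult[symmetric] ennreal_leI)
      then show ?thesis using near by simp
    next
      case far
      have "w s * s powr (-1-a) \<le> B * s powr (-1-a)"
        using bounded far by (intro mult_right_mono) auto
      then have "ennreal (w s * s powr (-1-a)) \<le> ennreal B * ennreal (s powr (-1-a))"
        using \<open>B \<ge> 0\<close> by (simp add: ennreal_mult[symmetric] ennreal_leI)
      then show ?thesis using far by (simp add: add_increasing)
    qed simp
  qed
  have "(\<integral>\<^sup>+s\<in>{0<..}. ennreal (w s * s powr (-1-a)) \<partial>lborel)
      \<le> (\<integral>\<^sup>+s. ennreal A * (ennreal (s powr (p-1-a)) * indicator {0..1} s)
          + ennreal B * (ennreal (s powr (-1-a)) * indicator {1..} s) \<partial>lborel)"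
    by (intro nn_integral_mono pointwise)
  also have "\<dots> = ennreal A * (\<integral>\<^sup>+s\<in>{0..1}. ennreal (s powr (p-1-a)) \<partial>lborel)
      + ennreal B * (\<integral>\<^sup>+s\<in>{1..}. ennreal (s powr (-1-a)) \<partial>lborel)"
    by (simp add: nn_integral_add nn_integral_cmult)
  also have "\<dots> < \<infinity>"
    using a by (simp add: nn_integral_powr_near_0 nn_integral_powr_near_inf ennreal_mult_less_top)
  finally show ?thesis .
qed

lemma nn_integral_powr_weight_scale:
  fixes w :: "real \<Rightarrow> real"
  assumes [measurable]: "w \<in> borel_measurable borel" and c: "c > 0"
  shows "(\<integral>\<^sup>+s\<in>{0<..}. ennreal (w (c * s) * s powr (-1-a)) \<partial>lborel)
     = ennreal (c powr a) * (\<integral>\<^sup>+s\<in>{0<..}. ennreal (w s * s powr (-1-a)) \<partial>lborel)"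
proof -
  have scale: "c powr a * c * (c * s) powr (-1-a) = s powr (-1-a)" for s
  proof -
    have "c powr a * c * c powr (-1-a) = 1"
      using c by (simp add: powr_diff powr_minus field_simps)
    then show ?thesis by (simp add: powr_mult mult.assoc[symmetric])
  qed
  have "ennreal (c powr a) * (\<integral>\<^sup>+s\<in>{0<..}. ennreal (w s * s powr (-1-a)) \<partial>lborel)
      = ennreal (c powr a) * (ennreal \<bar>c\<bar> * (\<integral>\<^sup>+s. ennreal (w (0 + c * s) * (0 + c * s) powr (-1-a))
          * indicator {0<..} (0 + c * s) \<partial>lborel))"
    using c by (subst nn_integral_real_affine[where c=c and t=0]) auto
  also have "\<dots> = (\<integral>\<^sup>+s. ennreal (c powr a * c)
      * (ennreal (w (c * s) * (c * s) powr (-1-a)) * indicator {0<..} s) \<partial>lborel)"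
    using c by (subst nn_integral_cmult)
      (auto simp: ennreal_mult mult.assoc indicator_def zero_less_mult_iff)
  also have "\<dots> = (\<integral>\<^sup>+s\<in>{0<..}. ennreal (w (c * s) * s powr (-1-a)) \<partial>lborel)"
  proof (intro nn_integral_cong)
    fix s
    have "(c powr a * c) * (w (c * s) * (c * s) powr (-1-a)) = w (c * s) * s powr (-1-a)"
      unfolding scale[of s, symmetric] by (simp only: mult_ac)
    then have "ennreal (c powr a * c) * ennreal (w (c * s) * (c * s) powr (-1-a))
        = ennreal (w (c * s) * s powr (-1-a))"
      using c by (simp only: ennreal_mult'[symmetric] mult_nonneg_nonneg powr_ge_zero less_imp_le)
    then show "ennreal (c powr a * c)
        * (ennreal (w (c * s) * (c * s) powr (-1-a)) * indicator {0<..} s)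
        = ennreal (w (c * s) * s powr (-1-a)) * indicator {0<..} s"
      by (simp only: mult.assoc[symmetric])
  qed
  finally show ?thesis ..
qed

lemma powr_weight_integral:
  fixes w :: "real \<Rightarrow> real"
  assumes [measurable]: "w \<in> borel_measurable borel" and a: "0 < a" "a < p"
    and near_0: "\<And>s. s > 0 \<Longrightarrow> w s \<le> A * s powr p" and bounded: "\<And>s. s > 0 \<Longrightarrow> w s \<le> B"
    and pos: "\<And>s. 0 < s \<Longrightarrow> s < 1 \<Longrightarrow> w s > 0"
  obtains I where "I > 0" "\<And>c. c > 0 \<Longrightarrow>
    (\<integral>\<^sup>+s\<in>{0<..}. ennreal (w (c * s) * s powr (-1-a)) \<partial>lborel) = ennreal (I * c powr a)"
proof -
  let ?J = "\<integral>\<^sup>+s\<in>{0<..}. ennreal (w s * s powr (-1-a)) \<partial>lborel"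
  have "0 < w (1/2)" by (rule pos) auto
  with near_0[of "1/2"] bounded[of "1/2"] have "A \<ge> 0" "B \<ge> 0"
    by (auto simp: zero_less_mult_iff dest: less_le_trans)
  then have finite: "?J < \<infinity>"
    using a near_0 bounded by (intro nn_integral_powr_weight_finite[of w a p A B]) auto
  have "?J \<noteq> 0"
  proof
    assume "?J = 0"
    then have "AE s in lborel. ennreal (w s * s powr (-1-a)) * indicator {0<..} s = 0"
      by (simp add: nn_integral_0_iff_AE)
    then have "AE s in lborel. s \<notin> {0<..<1::real}"
    proof (rule eventually_mono)
      fix s assume "ennreal (w s * s powr (-1-a)) * indicator {0<..} s = 0"
      then show "s \<notin> {0<..<1}" using pos[of s] by (auto simp: ennreal_eq_0_iff mult_le_0_iff not_le)
    qed
    then show False using not_AE_notin_open[of "{0<..<1::real}"] by simp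
  qed
  with finite obtain I where I: "?J = ennreal I" "I > 0"
    by (cases ?J) (auto simp: less_le)
  have "(\<integral>\<^sup>+s\<in>{0<..}. ennreal (w (c * s) * s powr (-1-a)) \<partial>lborel) = ennreal (I * c powr a)"
    if "c > 0" for c
    using nn_integral_powr_weight_scale[of w c a] I that by (simp add: ennreal_mult mult.commute)
  with I(2) that show ?thesis by blast
qed

lemma one_minus_cos_weight_integral:
  fixes a :: real assumes a: "0 < a" "a < 2"
  obtains I where "I > 0" "\<And>c. (\<integral>\<^sup>+s\<in>{0<..}. ennreal ((1 - cos (c * s)) * s powr (-1-a)) \<partial>lborel)
      = ennreal (I * \<bar>c\<bar> powr a)"
proof -
  have lt_1: "cos s < 1" if "0 < s" "s < 1" for s :: real
    using cos_monotone_0_pi[of 0 s] that pi_gt3 by simp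
  have near_0: "1 - cos s \<le> 1/2 * s powr 2" if "s > 0" for s :: real
  proof -
    have "1 - cos s = 2 * (sin (s / 2))\<^sup>2" using cos_double_sin[of "s / 2"] by simp
    also have "(sin (s / 2))\<^sup>2 \<le> (s / 2)\<^sup>2"
      using abs_sin_x_le_abs_x by (intro abs_le_square_iff[THEN iffD1])
    finally show ?thesis using that by (simp add: powr_numeral power_divide)
  qed
  have bounded: "1 - cos s \<le> 2" for s :: real using cos_ge_minus_one[of s] by linarith
  obtain I where I: "I > 0" and weight: "\<And>c. c > 0 \<Longrightarrow>
      (\<integral>\<^sup>+s\<in>{0<..}. ennreal ((1 - cos (c * s)) * s powr (-1-a)) \<partial>lborel) = ennreal (I * c powr a)"
    by (rule powr_weight_integral[of "\<lambda>s. 1 - cos s" a 2 "1/2" 2])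
      (use a lt_1 near_0 bounded in auto)
  have "(\<integral>\<^sup>+s\<in>{0<..}. ennreal ((1 - cos (c * s)) * s powr (-1-a)) \<partial>lborel)
      = ennreal (I * \<bar>c\<bar> powr a)" for c
  proof -
    have "cos (c * s) = cos (\<bar>c\<bar> * s)" for s by (cases "c \<ge> 0") auto
    then show ?thesis using weight[of "\<bar>c\<bar>"] by (cases "c = 0") auto
  qed
  then show ?thesis using that I by blast
qed

lemma one_minus_exp_powr_weight_integral:
  fixes a p :: real assumes a: "0 < a" "a < p"
  obtains I where "I > 0" "\<And>c. c \<ge> 0 \<Longrightarrow>
    (\<integral>\<^sup>+s\<in>{0<..}. ennreal ((1 - exp (- ((c * s) powr p))) * s powr (-1-a)) \<partial>lborel)
        = ennreal (I * c powr a)"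
proof -
  have near_0: "1 - exp (- x) \<le> x" for x :: real using exp_ge_add_one_self[of "-x"] by linarith
  obtain I where I: "I > 0" and weight: "\<And>c. c > 0 \<Longrightarrow>
      (\<integral>\<^sup>+s\<in>{0<..}. ennreal ((1 - exp (- ((c * s) powr p))) * s powr (-1-a)) \<partial>lborel)
          = ennreal (I * c powr a)"
    by (rule powr_weight_integral[of "\<lambda>s. 1 - exp (- (s powr p))" a p 1 1]) (use a near_0 in auto)
  have "(\<integral>\<^sup>+s\<in>{0<..}. ennreal ((1 - exp (- ((c * s) powr p))) * s powr (-1-a)) \<partial>lborel)
      = ennreal (I * c powr a)"
    if "c \<ge> 0" for c
    using weight[of c] that by (cases "c = 0") auto
  then show ?thesis using that I by blast
qed

lemma nn_integral_layer_cake: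
  fixes p :: "'a::euclidean_space \<Rightarrow> ennreal"
  assumes [measurable]: "p \<in> borel_measurable borel" "h \<in> borel_measurable borel"
      "r \<in> borel_measurable borel"
  shows "(\<integral>\<^sup>+x. p x * (\<integral>\<^sup>+s. h s * indicator (cball 0 (r s)) x \<partial>lborel) \<partial>lborel)
      = (\<integral>\<^sup>+s. h s * (\<integral>\<^sup>+x\<in>cball 0 (r s). p x \<partial>lborel) \<partial>(lborel :: real measure))"
proof -
  have [measurable]: "(\<lambda>(x, s). indicator (cball 0 (r s)) x :: ennreal)
      \<in> borel_measurable ((borel :: 'a measure) \<Otimes>\<^sub>M borel)"
    unfolding indicator_def mem_cball_0 by measurable
  have "(\<integral>\<^sup>+x. p x * (\<integral>\<^sup>+s. h s * indicator (cball 0 (r s)) x \<partial>lborel) \<partial>lborel)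
      = (\<integral>\<^sup>+x. (\<integral>\<^sup>+s. h s * (p x * indicator (cball 0 (r s)) x) \<partial>lborel) \<partial>lborel)"
    by (subst nn_integral_cmult[symmetric]) (auto simp: mult_ac)
  also have "\<dots> = (\<integral>\<^sup>+s. (\<integral>\<^sup>+x. h s * (p x * indicator (cball 0 (r s)) x) \<partial>lborel) \<partial>lborel)"
    by (rule lborel_pair.Fubini'[symmetric]) measurable
  also have "\<dots> = (\<integral>\<^sup>+s. h s * (\<integral>\<^sup>+x\<in>cball 0 (r s). p x \<partial>lborel) \<partial>lborel)"
    by (intro nn_integral_cong nn_integral_cmult) measurable
  finally show ?thesis .
qed

lemma exp_norm_powr_layers:
  fixes x :: "'a::euclidean_space" and t \<theta> :: real
  assumes t: "t > 0" and th: "\<theta> > 0"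
  shows "ennreal (exp (- t * norm x powr \<theta>))
    = (\<integral>\<^sup>+s. (ennreal (exp (- s)) * indicator {0..} s)
        * indicator (cball 0 ((s / t) powr (1 / \<theta>))) x \<partial>lborel)"
proof -
  let ?c = "t * norm x powr \<theta>"
  have "(ennreal (exp (- s)) * indicator {0..} s) * indicator (cball 0 ((s / t) powr (1 / \<theta>))) x
      = ennreal (exp (-1 * s)) * indicator {?c..} s" for s
  proof (cases "s \<ge> 0")
    case True
    let ?r = "(s / t) powr (1 / \<theta>)"
    have "norm x \<le> ?r \<longleftrightarrow> norm x powr \<theta> \<le> ?r powr \<theta>"
      using powr_mono2[of \<theta> "norm x" ?r] powr_less_mono2[of \<theta> ?r "norm x"] th
      by (auto simp: not_le[symmetric])
    also have "?r powr \<theta> = s / t" using True t th by (simp add: powr_powr)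
    also have "norm x powr \<theta> \<le> s / t \<longleftrightarrow> ?c \<le> s" using t by (simp add: field_simps)
    finally show ?thesis using True by (simp add: indicator_def)
  next
    case False
    moreover have "0 \<le> ?c" using t by simp
    ultimately show ?thesis by (simp add: indicator_def)
  qed
  moreover have "(\<integral>\<^sup>+s\<in>{?c..}. ennreal (exp (-1 * s)) \<partial>lborel) = ennreal (exp (-1 * ?c) / 1)"
    by (intro nn_integral_has_integral_lebesgue' has_integral_exp_minus_to_infinity) auto
  ultimately show ?thesis by simp
qed

lemma nn_integral_exp_norm_powr:
  fixes t \<theta> :: real assumes t: "t > 0" and th: "\<theta> > 0"
  shows "(\<integral>\<^sup>+x. ennreal (exp (- t * norm (x::'a::euclidean_space) powr \<theta>)) \<partial>lborel)
      = ennreal (unit_ball_vol (real DIM('a)) * Gamma (real DIM('a) / \<theta> + 1)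
          * t powr (- real DIM('a) / \<theta>))"
proof -
  let ?N = "real DIM('a)" and ?h = "\<lambda>s. ennreal (exp (- s)) * indicator {0..} s"
    and ?r = "\<lambda>s. (s / t) powr (1 / \<theta>)"
  let ?C = "unit_ball_vol ?N * t powr (- ?N / \<theta>)"
  have radius: "?r s ^ DIM('a) = t powr (- ?N / \<theta>) * s powr (?N / \<theta>)" if "s \<ge> 0" for s
  proof -
    have "?r s ^ DIM('a) = (s / t) powr (?N / \<theta>)"
      using that t by (cases "s = 0") (auto simp: powr_realpow[symmetric] powr_powr)
    then show ?thesis using that t by (simp add: powr_divide powr_minus_divide)
  qed
  have layer: "?h s * (\<integral>\<^sup>+x\<in>cball 0 (?r s). 1 \<partial>(lborel :: 'a measure))
      = ennreal ?C * (ennreal (s powr (?N / \<theta> + 1 - 1) / exp s) * indicator {0..} s)" for s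
  proof -
    have "(\<integral>\<^sup>+x\<in>cball 0 (?r s). 1 \<partial>(lborel :: 'a measure))
        = ennreal (unit_ball_vol ?N * ?r s ^ DIM('a))"
      by (simp add: emeasure_cball)
    then show ?thesis
      by (auto simp: radius indicator_def ennreal_mult'[symmetric] exp_minus field_simps)
  qed
  have "(\<integral>\<^sup>+x. ennreal (exp (- t * norm (x::'a) powr \<theta>)) \<partial>lborel)
      = (\<integral>\<^sup>+x. 1 * (\<integral>\<^sup>+s. ?h s * indicator (cball 0 (?r s)) x \<partial>lborel) \<partial>(lborel :: 'a measure))"
    by (simp only: exp_norm_powr_layers[OF t th] mult_1)
  also have "\<dots> = (\<integral>\<^sup>+s. ?h s * (\<integral>\<^sup>+x\<in>cball 0 (?r s). 1 \<partial>(lborel :: 'a measure)) \<partial>lborel)"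
    by (rule nn_integral_layer_cake) measurable
  also have "\<dots> = ennreal ?C * (\<integral>\<^sup>+s\<in>{0..}. ennreal (s powr (?N / \<theta> + 1 - 1) / exp s) \<partial>lborel)"
    unfolding layer by (rule nn_integral_cmult) measurable
  also have "(\<integral>\<^sup>+s\<in>{0..}. ennreal (s powr (?N / \<theta> + 1 - 1) / exp s) \<partial>lborel)
      = ennreal (Gamma (?N / \<theta> + 1))"
    using th by (intro nn_integral_has_integral_lebesgue' Gamma_integral_real)
      (auto simp: add_pos_pos)
  also have "ennreal ?C * ennreal (Gamma (?N / \<theta> + 1))
      = ennreal (unit_ball_vol ?N * Gamma (?N / \<theta> + 1) * t powr (- ?N / \<theta>))"
    by (subst ennreal_mult'[symmetric]) (auto simp: mult_ac)
  finally show ?thesis .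
qed

lemma norm_powr_neg_layers:
  fixes y :: "'a::euclidean_space"
  assumes b: "b > 0" and y: "y \<noteq> 0"
  shows "ennreal (norm y powr (-b))
    = (\<integral>\<^sup>+s. (ennreal (b * s powr (-1-b)) * indicator {0<..} s) * indicator (cball 0 s) y \<partial>lborel)"
proof -
  have s_pos: "0 < s" if "norm y \<le> s" for s using that y by (meson less_le_trans zero_less_norm_iff)
  have "(\<integral>\<^sup>+s. (ennreal (b * s powr (-1-b)) * indicator {0<..} s) * indicator (cball 0 s) y \<partial>lborel)
      = (\<integral>\<^sup>+s. ennreal b * (ennreal (s powr (-1-b)) * indicator {norm y..} s) \<partial>lborel)"
    using b by (intro nn_integral_cong) (auto simp: indicator_def ennreal_mult dest: s_pos)
  also have "\<dots> = ennreal b * ennreal (norm y powr (-b) / b)"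
    using y b by (subst nn_integral_cmult) (auto simp: nn_integral_powr_near_inf)
  also have "\<dots> = ennreal (norm y powr (-b))" using b by (simp add: ennreal_mult'[symmetric])
  finally show ?thesis ..
qed

lemma nn_integral_cball_le:
  fixes p :: "'a::euclidean_space \<Rightarrow> ennreal"
  assumes mass: "(\<integral>\<^sup>+y. p y \<partial>lborel) \<le> 1" and bound: "\<And>y. p y \<le> ennreal a" and "a \<ge> 0" "s > 0"
  shows "(\<integral>\<^sup>+y\<in>cball 0 s. p y \<partial>lborel)
    \<le> ennreal (min 1 (a * unit_ball_vol (real DIM('a)) * s powr real DIM('a)))"
proof -
  have "(\<integral>\<^sup>+y\<in>cball 0 s. p y \<partial>lborel) \<le> (\<integral>\<^sup>+y. p y \<partial>lborel)"
    by (intro nn_integral_mono) (auto simp: indicator_def)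
  moreover have "(\<integral>\<^sup>+y\<in>cball 0 s. p y \<partial>lborel)
      \<le> (\<integral>\<^sup>+y. ennreal a * indicator (cball 0 s) y \<partial>(lborel :: 'a measure))"
    by (intro nn_integral_mono mult_right_mono bound) simp
  moreover have "\<dots> = ennreal (a * unit_ball_vol (real DIM('a)) * s powr real DIM('a))"
    using \<open>a \<ge> 0\<close> \<open>s > 0\<close>
    by (simp add: nn_integral_cmult_indicator emeasure_cball ennreal_mult powr_realpow mult.assoc)
  ultimately show ?thesis using mass by (simp add: min_def) (metis order_trans)
qed

lemma nn_integral_norm_powr_neg_le:
  fixes p :: "'a::euclidean_space \<Rightarrow> ennreal"
  assumes [measurable]: "p \<in> borel_measurable borel" and mass: "(\<integral>\<^sup>+y. p y \<partial>lborel) \<le> 1"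
    and bound: "\<And>y. p y \<le> ennreal a" and "a \<ge> 0" and b: "b > 0"
  shows "(\<integral>\<^sup>+y. p y * ennreal (norm y powr (-b)) \<partial>lborel)
    \<le> ennreal b * (\<integral>\<^sup>+s\<in>{0<..}. ennreal (min 1 (a * unit_ball_vol (real DIM('a))
        * s powr real DIM('a)) * s powr (-1-b)) \<partial>lborel)"
proof -
  let ?w = "\<lambda>s. min 1 (a * unit_ball_vol (real DIM('a)) * s powr real DIM('a))"
  let ?h = "\<lambda>s. ennreal (b * s powr (-1-b)) * indicator {0<..} s"
  have layer_le: "?h s * (\<integral>\<^sup>+y\<in>cball 0 s. p y \<partial>lborel)
      \<le> ennreal b * (ennreal (?w s * s powr (-1-b)) * indicator {0<..} s)" for s
  proof (cases "s > 0")
    case True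
    then have "?h s * (\<integral>\<^sup>+y\<in>cball 0 s. p y \<partial>lborel) \<le> ennreal (b * s powr (-1-b)) * ennreal (?w s)"
      using nn_integral_cball_le[OF mass bound \<open>a \<ge> 0\<close>] by (auto intro: mult_left_mono)
    then show ?thesis
      using True b \<open>a \<ge> 0\<close> by (simp add: ennreal_mult'[symmetric] mult_ac)
  qed simp
  have "ennreal (norm y powr (-b)) \<le> (\<integral>\<^sup>+s. ?h s * indicator (cball 0 s) y \<partial>lborel)" for y :: 'a
  proof (cases "y = 0")
    case False
    then show ?thesis by (intro eq_refl norm_powr_neg_layers b)
  qed (use b in simp)
  then have "(\<integral>\<^sup>+y. p y * ennreal (norm y powr (-b)) \<partial>lborel)
      \<le> (\<integral>\<^sup>+y. p y * (\<integral>\<^sup>+s. ?h s * indicator (cball 0 s) y \<partial>lborel) \<partial>lborel)"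
    by (intro nn_integral_mono mult_left_mono) auto
  also have "\<dots> = (\<integral>\<^sup>+s. ?h s * (\<integral>\<^sup>+y\<in>cball 0 s. p y \<partial>lborel) \<partial>lborel)"
    by (rule nn_integral_layer_cake) measurable
  also have "\<dots> \<le> (\<integral>\<^sup>+s. ennreal b * (ennreal (?w s * s powr (-1-b)) * indicator {0<..} s) \<partial>lborel)"
    by (intro nn_integral_mono layer_le)
  also have "\<dots> = ennreal b * (\<integral>\<^sup>+s\<in>{0<..}. ennreal (?w s * s powr (-1-b)) \<partial>lborel)"
    by (rule nn_integral_cmult) measurable
  finally show ?thesis .
qed

lemma norm_powr_le_two_powr:
  fixes x y :: "'a::real_normed_vector"
  assumes "0 \<le> a"
  shows "norm y powr a \<le> 2 powr a * (norm (x - y) powr a + norm x powr a)"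
proof -
  have "norm y \<le> 2 * max (norm (x - y)) (norm x)" using norm_triangle_ineq4[of x "x - y"] by simp
  then have "norm y powr a \<le> (2 * max (norm (x - y)) (norm x)) powr a"
    using assms by (intro powr_mono2) auto
  also have "\<dots> \<le> 2 powr a * (norm (x - y) powr a + norm x powr a)"
    by (auto simp: powr_mult max_def)
  finally show ?thesis .
qed

lemma norm_powr_le_sum:
  fixes x :: "'a::euclidean_space" assumes a: "0 < a"
  shows "norm x powr a \<le> real DIM('a) powr a * (\<Sum>b\<in>Basis. \<bar>x \<bullet> b\<bar> powr a)"
proof -
  let ?S = "\<Sum>b\<in>Basis. \<bar>x \<bullet> b\<bar> powr a"
  have "?S \<ge> 0" by (intro sum_nonneg) auto
  have coordinate: "\<bar>x \<bullet> b\<bar> \<le> ?S powr (1 / a)" if "b \<in> Basis" for b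
  proof -
    have "(\<bar>x \<bullet> b\<bar> powr a) powr (1 / a) \<le> ?S powr (1 / a)"
      using a that by (intro powr_mono2 member_le_sum) auto
    then show ?thesis using a by (simp add: powr_powr)
  qed
  have "norm x \<le> (\<Sum>b\<in>Basis. \<bar>x \<bullet> b\<bar>)" by (rule norm_le_l1)
  also have "\<dots> \<le> real DIM('a) * ?S powr (1 / a)" using coordinate by (rule sum_bounded_above)
  finally have "norm x powr a \<le> (real DIM('a) * ?S powr (1 / a)) powr a"
    using a by (intro powr_mono2) auto
  also have "\<dots> = real DIM('a) powr a * ?S"
    using a \<open>?S \<ge> 0\<close> by (simp add: powr_mult powr_powr)
  finally show ?thesis .
qed

abbreviation gauss :: "real \<Rightarrow> 'a::euclidean_space \<Rightarrow> real" where
  "gauss d x \<equiv> exp (- d * (norm x)\<^sup>2)"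

lemma gauss_add: "gauss (d + s) x = gauss d x * gauss s x"
  by (simp add: exp_add[symmetric] algebra_simps)

lemma integrable_exp_norm_powr:
  fixes t \<theta> :: real assumes "t > 0" "\<theta> > 0"
  shows "integrable lborel (\<lambda>x::'a::euclidean_space. exp (- t * norm x powr \<theta>))"
  by (rule integrableI_nonneg) (auto simp: nn_integral_exp_norm_powr[OF assms, simplified])

lemma integrable_gauss: "d > 0 \<Longrightarrow> integrable lborel (gauss d :: 'a::euclidean_space \<Rightarrow> real)"
  using integrable_exp_norm_powr[of d 2, where 'a='a] by (simp add: powr_numeral)

lemma gauss_Suc_tendsto_1: "(\<lambda>n. gauss (1 / real (Suc n)) x) \<longlonglongrightarrow> 1"
proof -
  have "(\<lambda>n. gauss (1 / real (Suc n)) x) \<longlonglongrightarrow> gauss 0 x"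
    using LIMSEQ_inverse_real_of_nat by (intro tendsto_intros) (simp add: inverse_eq_divide)
  then show ?thesis by simp
qed

section \<open>The cosine transform\<close>

definition cos_transform :: "('a::euclidean_space \<Rightarrow> real) \<Rightarrow> 'a \<Rightarrow> real" where
  "cos_transform \<phi> x = (LBINT \<xi>. cos (x \<bullet> \<xi>) * \<phi> \<xi>)"

lemma cos_transform_measurable[measurable]:
  assumes [measurable]: "\<phi> \<in> borel_measurable borel"
  shows "cos_transform \<phi> \<in> borel_measurable borel"
  unfolding cos_transform_def[abs_def] by measurable

lemma cos_transform_cmult: "cos_transform (\<lambda>\<xi>. c * \<phi> \<xi>) x = c * cos_transform \<phi> x"
  unfolding cos_transform_def by (subst integral_mult_right_zero[symmetric]) (simp add: mult_ac)

lemma integrable_cos_mult: "integrable lborel \<phi> \<Longrightarrow> integrable lborel (\<lambda>\<xi>. cos (x \<bullet> \<xi>) * \<phi> \<xi>)"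
  by (subst mult.commute) (rule integrable_mult_bounded[where B=1], auto)

lemma cos_transform_add:
  assumes "integrable lborel \<phi>" "integrable lborel \<psi>"
  shows "cos_transform (\<lambda>\<xi>. \<phi> \<xi> + \<psi> \<xi>) x = cos_transform \<phi> x + cos_transform \<psi> x"
  unfolding cos_transform_def distrib_left
  by (intro Bochner_Integration.integral_add integrable_cos_mult assms)

lemma abs_cos_transform_le:
  assumes "integrable lborel \<phi>"
  shows "\<bar>cos_transform \<phi> x\<bar> \<le> (LBINT \<xi>. \<bar>\<phi> \<xi>\<bar>)"
proof -
  have "norm (cos_transform \<phi> x) \<le> (LBINT \<xi>. \<bar>\<phi> \<xi>\<bar>)"
    unfolding cos_transform_def
  proof (rule Bochner_Integration.integral_norm_bound_integral)
    show "norm (cos (x \<bullet> \<xi>) * \<phi> \<xi>) \<le> \<bar>\<phi> \<xi>\<bar>" for \<xi>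
      by (simp add: abs_mult mult_left_le_one_le)
  qed (use assms integrable_cos_mult in auto)
  then show ?thesis by simp
qed

lemma cos_transform_multiplication:
  assumes \<phi>: "integrable lborel \<phi>" and \<psi>: "integrable lborel \<psi>"
  shows "(LBINT x. cos_transform \<phi> x * \<psi> x) = (LBINT \<xi>. \<phi> \<xi> * cos_transform \<psi> \<xi>)"
proof -
  have "(LBINT x. cos_transform \<phi> x * \<psi> x) = (LBINT x. LBINT \<xi>. \<psi> x * \<phi> \<xi> * cos (x \<bullet> \<xi>))"
    unfolding cos_transform_def by (subst integral_mult_left_zero[symmetric]) (simp add: mult_ac)
  also have "\<dots> = (LBINT \<xi>. LBINT x. \<psi> x * \<phi> \<xi> * cos (x \<bullet> \<xi>))"
    by (rule lborel_Fubini_bounded_kernel[OF \<psi> \<phi>, where B=1]) auto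
  also have "\<dots> = (LBINT \<xi>. \<phi> \<xi> * cos_transform \<psi> \<xi>)"
    unfolding cos_transform_def
    by (subst integral_mult_right_zero[symmetric]) (simp add: mult_ac inner_commute)
  finally show ?thesis .
qed

lemma cos_transform_convolution:
  assumes \<phi>: "integrable lborel \<phi>" and \<psi>: "integrable lborel \<psi>" and even: "\<And>y. \<psi> (- y) = \<psi> y"
  shows "(LBINT y. cos_transform \<phi> (x - y) * \<psi> y) = cos_transform (\<lambda>\<xi>. \<phi> \<xi> * cos_transform \<psi> \<xi>) x"
proof -
  have [measurable]: "\<psi> \<in> borel_measurable borel"
    using \<psi> by (auto dest: borel_measurable_integrable)
  have inner: "(LBINT y. \<psi> y * \<phi> \<xi> * cos ((x - y) \<bullet> \<xi>))
      = cos (x \<bullet> \<xi>) * (\<phi> \<xi> * cos_transform \<psi> \<xi>)" for \<xi>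
  proof -
    have sin: "integrable lborel (\<lambda>y. \<psi> y * sin (\<xi> \<bullet> y))"
      by (rule integrable_mult_bounded[OF \<psi>, where B=1]) auto
    have "(LBINT y. \<psi> y * \<phi> \<xi> * cos ((x - y) \<bullet> \<xi>))
        = (LBINT y. (\<phi> \<xi> * cos (x \<bullet> \<xi>)) * (cos (\<xi> \<bullet> y) * \<psi> y)
            + (\<phi> \<xi> * sin (x \<bullet> \<xi>)) * (\<psi> y * sin (\<xi> \<bullet> y)))"
      by (simp add: inner_diff_left cos_diff inner_commute algebra_simps)
    also have "\<dots> = (\<phi> \<xi> * cos (x \<bullet> \<xi>)) * cos_transform \<psi> \<xi>
        + (\<phi> \<xi> * sin (x \<bullet> \<xi>)) * (LBINT y. \<psi> y * sin (\<xi> \<bullet> y))"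
      unfolding cos_transform_def using sin integrable_cos_mult[OF \<psi>]
      by (simp add: Bochner_Integration.integral_add)
    also have "(LBINT y. \<psi> y * sin (\<xi> \<bullet> y)) = 0"
      by (rule lborel_integral_odd_eq_0) (auto simp: even)
    finally show ?thesis by simp
  qed
  have "(LBINT y. cos_transform \<phi> (x - y) * \<psi> y)
      = (LBINT y. LBINT \<xi>. \<psi> y * \<phi> \<xi> * cos ((x - y) \<bullet> \<xi>))"
    unfolding cos_transform_def by (subst integral_mult_left_zero[symmetric]) (simp add: mult_ac)
  also have "\<dots> = (LBINT \<xi>. LBINT y. \<psi> y * \<phi> \<xi> * cos ((x - y) \<bullet> \<xi>))"
    by (rule lborel_Fubini_bounded_kernel[OF \<psi> \<phi>, where B=1]) auto
  also have "\<dots> = cos_transform (\<lambda>\<xi>. \<phi> \<xi> * cos_transform \<psi> \<xi>) x"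
    unfolding inner cos_transform_def ..
  finally show ?thesis .
qed

lemma gauss_fourier_real:
  fixes d x :: real assumes d: "d > 0"
  shows "(LBINT \<xi>. exp (\<i> * complex_of_real (x * \<xi>)) * complex_of_real (exp (- d * \<xi>\<^sup>2)))
       = complex_of_real (sqrt (pi / d) * exp (- x\<^sup>2 / (4 * d)))"
proof -
  let ?f = "\<lambda>\<xi>. exp (\<i> * complex_of_real (x * \<xi>)) * complex_of_real (exp (- d * \<xi>\<^sup>2))"
  define c where "c = 1 / sqrt (2 * d)"
  have c: "c > 0" "2 * d * c\<^sup>2 = 1" using d by (auto simp: c_def power_divide)
  define s where "s = x * c"
  have "complex_of_real (exp (- s\<^sup>2 / 2)) = char std_normal_distribution s"
    by (simp add: char_std_normal_distribution)
  also have "\<dots> = (LBINT y. std_normal_density y *\<^sub>R iexp (s * y))"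
    unfolding char_def by (subst integral_density) auto
  also have "\<dots> = (LBINT y. complex_of_real (1 / sqrt (2 * pi)) * ?f (0 + c * y))"
  proof (rule Bochner_Integration.integral_cong[OF refl])
    fix y
    have "d * (c * y)\<^sup>2 = y\<^sup>2 / 2" using c(2) by (simp add: power_mult_distrib)
    then show "std_normal_density y *\<^sub>R iexp (s * y)
        = complex_of_real (1 / sqrt (2 * pi)) * ?f (0 + c * y)"
      unfolding std_normal_density_def s_def by (simp add: scaleR_conv_of_real mult_ac)
  qed
  also have "\<dots> = complex_of_real (1 / sqrt (2 * pi)) * (LBINT y. ?f (0 + c * y))"
    by (rule integral_mult_right_zero)
  finally have char: "(LBINT y. ?f (0 + c * y)) = complex_of_real (sqrt (2 * pi) * exp (- s\<^sup>2 / 2))"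
    by (simp add: field_simps)
  have "(LBINT \<xi>. ?f \<xi>) = \<bar>c\<bar> *\<^sub>R (LBINT y. ?f (0 + c * y))"
    by (rule lborel_integral_real_affine) (use c in auto)
  also have "\<dots> = complex_of_real (c * sqrt (2 * pi) * exp (- s\<^sup>2 / 2))"
    unfolding char using c by (simp add: scaleR_conv_of_real)
  also have "c * sqrt (2 * pi) = sqrt (pi / d)"
    using d by (simp add: c_def real_sqrt_mult real_sqrt_divide field_simps)
  also have "- s\<^sup>2 / 2 = - x\<^sup>2 / (4 * d)"
    using d by (simp add: s_def c_def power_mult_distrib power_divide field_simps)
  finally show ?thesis .
qed

lemma cos_transform_gauss:
  fixes x :: "'a::euclidean_space" assumes d: "d > 0"
  shows "cos_transform (gauss d) x = sqrt (pi / d) ^ DIM('a) * exp (- (norm x)\<^sup>2 / (4 * d))"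
proof -
  let ?g = "\<lambda>\<xi>. exp (\<i> * complex_of_real (x \<bullet> \<xi>)) * complex_of_real (gauss d \<xi>)"
  let ?f = "\<lambda>b y. exp (\<i> * complex_of_real ((x \<bullet> b) * y)) * complex_of_real (exp (- d * y\<^sup>2))"
  have norm_sq: "(norm \<xi>)\<^sup>2 = (\<Sum>b\<in>Basis. (\<xi> \<bullet> b)\<^sup>2)" for \<xi> :: 'a
    by (subst power2_norm_eq_inner, subst euclidean_inner) (simp add: power2_eq_square)
  have factor: "?g \<xi> = (\<Prod>b\<in>Basis. ?f b (\<xi> \<bullet> b))" for \<xi>
  proof -
    have "x \<bullet> \<xi> = (\<Sum>b\<in>Basis. (x \<bullet> b) * (\<xi> \<bullet> b))" by (rule euclidean_inner)
    moreover have "gauss d \<xi> = (\<Prod>b\<in>Basis. exp (- d * (\<xi> \<bullet> b)\<^sup>2))"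
      unfolding norm_sq by (simp add: exp_sum[symmetric] sum_distrib_left sum_negf)
    ultimately show ?thesis by (simp add: exp_sum prod.distrib sum_distrib_left)
  qed
  have int: "integrable lborel ?g"
    by (rule Bochner_Integration.integrable_bound[OF integrable_gauss[OF d]]) (auto simp: norm_mult)
  have int_real: "integrable lborel (?f b)" for b
    by (rule Bochner_Integration.integrable_bound[OF integrable_gauss[OF d]]) (auto simp: norm_mult)
  have "(LBINT \<xi>. ?g \<xi>) = (\<Prod>b\<in>Basis. (LBINT y. ?f b y))"
    unfolding factor by (rule lborel_integral_prod_Basis) (rule int_real)
  also have "\<dots> = complex_of_real (\<Prod>b\<in>(Basis::'a set). sqrt (pi / d) * exp (- (x \<bullet> b)\<^sup>2 / (4 * d)))"
    by (simp only: gauss_fourier_real[OF d] of_real_prod)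
  also have "(\<Prod>b\<in>(Basis::'a set). sqrt (pi / d) * exp (- (x \<bullet> b)\<^sup>2 / (4 * d)))
      = sqrt (pi / d) ^ DIM('a) * exp (- (norm x)\<^sup>2 / (4 * d))"
    by (simp add: prod.distrib exp_sum[symmetric] sum_negf sum_divide_distrib norm_sq)
  finally have "Re (LBINT \<xi>. ?g \<xi>) = sqrt (pi / d) ^ DIM('a) * exp (- (norm x)\<^sup>2 / (4 * d))"
    by simp
  moreover have "Re (LBINT \<xi>. ?g \<xi>) = cos_transform (gauss d) x"
    using integral_Re[OF int] by (simp add: cos_transform_def Re_exp)
  ultimately show ?thesis by simp
qed

lemma cos_transform_cos_gauss:
  fixes \<xi> \<eta> :: "'a::euclidean_space" assumes d: "d > 0"
  shows "cos_transform (\<lambda>x. cos (\<eta> \<bullet> x) * gauss d x) \<xi>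
     = sqrt (pi / d) ^ DIM('a) * (exp (- (norm (\<xi> - \<eta>))\<^sup>2 / (4 * d))
         + exp (- (norm (\<xi> + \<eta>))\<^sup>2 / (4 * d))) / 2"
proof -
  have "cos (\<xi> \<bullet> x) * (cos (\<eta> \<bullet> x) * gauss d x)
      = (cos ((\<xi> - \<eta>) \<bullet> x) * gauss d x + cos ((\<xi> + \<eta>) \<bullet> x) * gauss d x) / 2" for x
    by (simp add: inner_diff_left inner_add_left cos_add cos_diff algebra_simps)
  then have "cos_transform (\<lambda>x. cos (\<eta> \<bullet> x) * gauss d x) \<xi>
     = (cos_transform (gauss d) (\<xi> - \<eta>) + cos_transform (gauss d) (\<xi> + \<eta>)) / 2"
    unfolding cos_transform_def
    by (simp only: integral_divide_zero Bochner_Integration.integral_add integrable_cos_mult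
        integrable_gauss d)
  then show ?thesis by (simp only: cos_transform_gauss[OF d] distrib_left)
qed

lemma cos_transform_gauss_mean:
  fixes \<phi> :: "'a::euclidean_space \<Rightarrow> real"
  assumes \<phi>: "integrable lborel \<phi>" and even: "\<And>\<xi>. \<phi> (- \<xi>) = \<phi> \<xi>" and d: "d > 0"
  shows "(LBINT x. cos_transform \<phi> x * (cos (\<eta> \<bullet> x) * gauss d x))
      = (2 * sqrt pi) ^ DIM('a) * (LBINT w. gauss 1 w * \<phi> (\<eta> + (2 * sqrt d) *\<^sub>R w))"
proof -
  have [measurable]: "\<phi> \<in> borel_measurable borel"
    using \<phi> by (auto dest: borel_measurable_integrable)
  define E where "E z = exp (- (norm z)\<^sup>2 / (4 * d))" for z :: 'a
  have [measurable]: "E \<in> borel_measurable borel" unfolding E_def by measurable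
  have E_int: "integrable lborel (\<lambda>\<xi>. \<phi> \<xi> * E (\<xi> + z))" for z
    by (rule integrable_mult_bounded[OF \<phi>, where B=1]) (use d in \<open>auto simp: E_def\<close>)
  let ?K = "sqrt (pi / d) ^ DIM('a)"
  have "(LBINT x. cos_transform \<phi> x * (cos (\<eta> \<bullet> x) * gauss d x))
      = (LBINT \<xi>. \<phi> \<xi> * cos_transform (\<lambda>x. cos (\<eta> \<bullet> x) * gauss d x) \<xi>)"
    by (intro cos_transform_multiplication \<phi> integrable_cos_mult integrable_gauss d)
  also have "\<dots> = (LBINT \<xi>. ?K / 2 * (\<phi> \<xi> * E (\<xi> + - \<eta>) + \<phi> \<xi> * E (\<xi> + \<eta>)))"
    unfolding cos_transform_cos_gauss[OF d] E_def
    by (intro Bochner_Integration.integral_cong refl) (simp add: field_simps)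
  also have "\<dots> = ?K / 2 * ((LBINT \<xi>. \<phi> \<xi> * E (\<xi> + - \<eta>)) + (LBINT \<xi>. \<phi> \<xi> * E (\<xi> + \<eta>)))"
    by (simp only: integral_mult_right_zero Bochner_Integration.integral_add[OF E_int E_int])
  also have "(LBINT \<xi>. \<phi> \<xi> * E (\<xi> + \<eta>)) = (LBINT \<xi>. \<phi> (0 - \<xi>) * E ((0 - \<xi>) + \<eta>))"
    by (rule lborel_integral_reflect[symmetric]) measurable
  also have "(\<lambda>\<xi>. \<phi> (0 - \<xi>) * E ((0 - \<xi>) + \<eta>)) = (\<lambda>\<xi>. \<phi> \<xi> * E (\<xi> + - \<eta>))"
    by (auto simp: fun_eq_iff even E_def norm_minus_commute)
  also have "?K / 2 * ((LBINT \<xi>. \<phi> \<xi> * E (\<xi> + - \<eta>)) + (LBINT \<xi>. \<phi> \<xi> * E (\<xi> + - \<eta>)))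
      = ?K * (LBINT \<xi>. \<phi> \<xi> * E (\<xi> + - \<eta>))"
    by simp
  also have "(LBINT \<xi>. \<phi> \<xi> * E (\<xi> + - \<eta>)) = \<bar>2 * sqrt d\<bar> ^ DIM('a)
      * (LBINT w. \<phi> (\<eta> + (2 * sqrt d) *\<^sub>R w) * E (\<eta> + (2 * sqrt d) *\<^sub>R w + - \<eta>))"
    using d by (intro lborel_integral_affine) auto
  also have "(\<lambda>w. \<phi> (\<eta> + (2 * sqrt d) *\<^sub>R w) * E (\<eta> + (2 * sqrt d) *\<^sub>R w + - \<eta>))
      = (\<lambda>w. gauss 1 w * \<phi> (\<eta> + (2 * sqrt d) *\<^sub>R w))"
    using d by (auto simp: E_def power_mult_distrib mult.commute)
  also have "?K * (\<bar>2 * sqrt d\<bar> ^ DIM('a) * (LBINT w. gauss 1 w * \<phi> (\<eta> + (2 * sqrt d) *\<^sub>R w)))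
      = (sqrt (pi / d) * (2 * sqrt d)) ^ DIM('a)
          * (LBINT w. gauss 1 w * \<phi> (\<eta> + (2 * sqrt d) *\<^sub>R w))"
    using d by (simp add: power_mult_distrib)
  also have "sqrt (pi / d) * (2 * sqrt d) = 2 * sqrt pi" using d by (simp add: real_sqrt_divide)
  finally show ?thesis .
qed

lemma cos_transform_gauss_mean_tendsto:
  fixes \<phi> :: "'a::euclidean_space \<Rightarrow> real"
  assumes \<phi>: "integrable lborel \<phi>" and even: "\<And>\<xi>. \<phi> (- \<xi>) = \<phi> \<xi>"
    and bound: "\<And>\<xi>. \<bar>\<phi> \<xi>\<bar> \<le> B" and cont: "continuous_on UNIV \<phi>"
  shows "(\<lambda>n. LBINT x. cos_transform \<phi> x * (cos (\<eta> \<bullet> x) * gauss (1 / real (Suc n)) x))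
    \<longlonglongrightarrow> (2 * pi) ^ DIM('a) * \<phi> \<eta>"
proof -
  let ?d = "\<lambda>n. 1 / real (Suc n)"
  have [measurable]: "\<phi> \<in> borel_measurable borel"
    using \<phi> by (auto dest: borel_measurable_integrable)
  have "(\<lambda>n. \<phi> (\<eta> + (2 * sqrt (?d n)) *\<^sub>R w)) \<longlonglongrightarrow> \<phi> \<eta>" for w
  proof (rule continuous_on_tendsto_compose[OF cont])
    have "(\<lambda>n. \<eta> + (2 * sqrt (?d n)) *\<^sub>R w) \<longlonglongrightarrow> \<eta> + (2 * sqrt 0) *\<^sub>R w"
      using LIMSEQ_inverse_real_of_nat by (intro tendsto_intros) (simp add: inverse_eq_divide)
    then show "(\<lambda>n. \<eta> + (2 * sqrt (?d n)) *\<^sub>R w) \<longlonglongrightarrow> \<eta>" by simp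
  qed auto
  then have "(\<lambda>n. LBINT w. gauss 1 w * \<phi> (\<eta> + (2 * sqrt (?d n)) *\<^sub>R w))
      \<longlonglongrightarrow> (LBINT w::'a. gauss 1 w * \<phi> \<eta>)"
    by (intro tendsto_integral_mult_bounded[where B=B] integrable_gauss bound) auto
  then have "(\<lambda>n. (2 * sqrt pi) ^ DIM('a) * (LBINT w. gauss 1 w * \<phi> (\<eta> + (2 * sqrt (?d n)) *\<^sub>R w)))
      \<longlonglongrightarrow> (2 * sqrt pi) ^ DIM('a) * (LBINT w::'a. gauss 1 w * \<phi> \<eta>)"
    by (rule tendsto_mult_left)
  also have "(\<lambda>n. (2 * sqrt pi) ^ DIM('a) * (LBINT w. gauss 1 w * \<phi> (\<eta> + (2 * sqrt (?d n)) *\<^sub>R w)))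
      = (\<lambda>n. LBINT x. cos_transform \<phi> x * (cos (\<eta> \<bullet> x) * gauss (?d n) x))"
    by (intro ext cos_transform_gauss_mean[symmetric] \<phi> even) simp
  also have "(LBINT w::'a. gauss 1 w * \<phi> \<eta>) = sqrt pi ^ DIM('a) * \<phi> \<eta>"
    using cos_transform_gauss[of 1 "0::'a"] by (simp add: cos_transform_def)
  also have "(2 * sqrt pi) ^ DIM('a) * (sqrt pi ^ DIM('a) * \<phi> \<eta>)
      = ((2 * sqrt pi) * sqrt pi) ^ DIM('a) * \<phi> \<eta>"
    by (simp only: power_mult_distrib mult.assoc)
  also have "(2 * sqrt pi) * sqrt pi = 2 * pi" by simp
  finally show ?thesis .
qed

lemma
  fixes \<phi> :: "'a::euclidean_space \<Rightarrow> real"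
  assumes \<phi>: "integrable lborel \<phi>" and even: "\<And>\<xi>. \<phi> (- \<xi>) = \<phi> \<xi>"
    and bound: "\<And>\<xi>. \<bar>\<phi> \<xi>\<bar> \<le> B" and cont: "continuous_on UNIV \<phi>"
    and nonneg: "\<And>x. 0 \<le> cos_transform \<phi> x"
  shows integrable_cos_transform: "integrable lborel (cos_transform \<phi>)"
    and cos_transform_inversion: "cos_transform (cos_transform \<phi>) \<eta> = (2 * pi) ^ DIM('a) * \<phi> \<eta>"
proof -
  let ?d = "\<lambda>n. 1 / real (Suc n)"
  note regularized = cos_transform_gauss_mean_tendsto[OF \<phi> even bound cont]
  have [measurable]: "\<phi> \<in> borel_measurable borel"
    using \<phi> by (auto dest: borel_measurable_integrable)
  show int: "integrable lborel (cos_transform \<phi>)"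
  proof (rule integrable_monotone_convergence)
    show "integrable lborel (\<lambda>x. cos_transform \<phi> x * gauss (?d n) x)" for n
      by (subst mult.commute,
          rule integrable_mult_bounded[OF integrable_gauss _ abs_cos_transform_le[OF \<phi>]])
         (simp, measurable)
    show "AE x in lborel. mono (\<lambda>n. cos_transform \<phi> x * gauss (?d n) x)"
      by (intro AE_I2 monoI mult_left_mono nonneg) (auto intro!: mult_right_mono divide_left_mono)
    show "AE x in lborel. (\<lambda>n. cos_transform \<phi> x * gauss (?d n) x) \<longlonglongrightarrow> cos_transform \<phi> x"
      using tendsto_mult[OF tendsto_const gauss_Suc_tendsto_1] by (intro AE_I2) auto
    show "(\<lambda>n. LBINT x. cos_transform \<phi> x * gauss (?d n) x) \<longlonglongrightarrow> (2 * pi) ^ DIM('a) * \<phi> 0"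
      using regularized[of 0] by simp
  qed measurable
  have "(\<lambda>n. LBINT x. cos_transform \<phi> x * (cos (\<eta> \<bullet> x) * gauss (?d n) x))
      \<longlonglongrightarrow> (LBINT x. cos_transform \<phi> x * cos (\<eta> \<bullet> x))"
  proof (rule tendsto_integral_mult_bounded[OF int, where B=1])
    show "\<bar>cos (\<eta> \<bullet> x) * gauss (?d n) x\<bar> \<le> 1" for n x by (simp add: abs_mult mult_le_one)
    show "(\<lambda>n. cos (\<eta> \<bullet> x) * gauss (?d n) x) \<longlonglongrightarrow> cos (\<eta> \<bullet> x)" for x
      using tendsto_mult[OF tendsto_const gauss_Suc_tendsto_1] by auto
  qed measurable
  from LIMSEQ_unique[OF this regularized]
  show "cos_transform (cos_transform \<phi>) \<eta> = (2 * pi) ^ DIM('a) * \<phi> \<eta>"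
    by (simp add: cos_transform_def[of "cos_transform \<phi>"] mult.commute)
qed

section \<open>Positivity of the kernel\<close>

text \<open>Testing against Gaussians of every width makes sense for functions that are merely bounded,
  and is stable under multiplication by a mixture of Gaussians.\<close>

definition gauss_positive :: "('a::euclidean_space \<Rightarrow> real) \<Rightarrow> bool" where
  "gauss_positive \<phi> \<longleftrightarrow> \<phi> \<in> borel_measurable borel \<and> (\<exists>B. \<forall>\<xi>. \<bar>\<phi> \<xi>\<bar> \<le> B) \<and>
     (\<forall>d>0. \<forall>x. 0 \<le> cos_transform (\<lambda>\<xi>. gauss d \<xi> * \<phi> \<xi>) x)"

lemma gauss_positiveE:
  assumes "gauss_positive \<phi>"
  obtains B where "\<phi> \<in> borel_measurable borel" "\<And>\<xi>. \<bar>\<phi> \<xi>\<bar> \<le> B"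
    "\<And>d x. d > 0 \<Longrightarrow> 0 \<le> cos_transform (\<lambda>\<xi>. gauss d \<xi> * \<phi> \<xi>) x"
    "\<And>d. d > 0 \<Longrightarrow> integrable lborel (\<lambda>\<xi>. gauss d \<xi> * \<phi> \<xi>)"
proof -
  obtain B where "\<phi> \<in> borel_measurable borel" "\<And>\<xi>. \<bar>\<phi> \<xi>\<bar> \<le> B"
    "\<And>d x. d > 0 \<Longrightarrow> 0 \<le> cos_transform (\<lambda>\<xi>. gauss d \<xi> * \<phi> \<xi>) x"
    using assms by (auto simp: gauss_positive_def)
  moreover from this have "integrable lborel (\<lambda>\<xi>. gauss d \<xi> * \<phi> \<xi>)" if "d > 0" for d
    using that by (intro integrable_mult_bounded[where B=B] integrable_gauss) auto
  ultimately show ?thesis by (rule that)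
qed

lemma gauss_positive_gauss: "0 \<le> s \<Longrightarrow> gauss_positive (gauss s :: 'a::euclidean_space \<Rightarrow> real)"
proof -
  assume "0 \<le> s"
  have "0 \<le> cos_transform (\<lambda>\<xi>. gauss d \<xi> * gauss s \<xi>) x" if "d > 0" for d and x :: 'a
    unfolding gauss_add[symmetric] using that \<open>0 \<le> s\<close> by (subst cos_transform_gauss) auto
  then show ?thesis
    using \<open>0 \<le> s\<close> unfolding gauss_positive_def by (auto intro!: exI[of _ 1])
qed

lemma gauss_positive_cmult:
  assumes "gauss_positive \<phi>" "c \<ge> 0"
  shows "gauss_positive (\<lambda>\<xi>. c * \<phi> \<xi>)"
proof -
  obtain B where [measurable]: "\<phi> \<in> borel_measurable borel" and B: "\<And>\<xi>. \<bar>\<phi> \<xi>\<bar> \<le> B"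
    and pos: "\<And>d x. d > 0 \<Longrightarrow> 0 \<le> cos_transform (\<lambda>\<xi>. gauss d \<xi> * \<phi> \<xi>) x"
    using assms(1) by (rule gauss_positiveE) blast
  have "\<bar>c * \<phi> \<xi>\<bar> \<le> c * B" for \<xi>
    using B[of \<xi>] assms(2) by (auto simp: abs_mult intro: mult_left_mono)
  moreover have "0 \<le> cos_transform (\<lambda>\<xi>. gauss d \<xi> * (c * \<phi> \<xi>)) x" if "d > 0" for d x
    using pos[OF that] assms(2) by (simp add: mult.left_commute[of _ c] cos_transform_cmult)
  ultimately show ?thesis unfolding gauss_positive_def by auto
qed

lemma gauss_positive_add:
  assumes "gauss_positive \<phi>" "gauss_positive \<psi>"
  shows "gauss_positive (\<lambda>\<xi>. \<phi> \<xi> + \<psi> \<xi>)"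
proof -
  obtain B where [measurable]: "\<phi> \<in> borel_measurable borel" and B: "\<And>\<xi>. \<bar>\<phi> \<xi>\<bar> \<le> B"
    and \<phi>: "\<And>d. d > 0 \<Longrightarrow> integrable lborel (\<lambda>\<xi>. gauss d \<xi> * \<phi> \<xi>)"
      "\<And>d x. d > 0 \<Longrightarrow> 0 \<le> cos_transform (\<lambda>\<xi>. gauss d \<xi> * \<phi> \<xi>) x"
    using assms(1) by (rule gauss_positiveE) blast
  obtain B' where [measurable]: "\<psi> \<in> borel_measurable borel" and B': "\<And>\<xi>. \<bar>\<psi> \<xi>\<bar> \<le> B'"
    and \<psi>: "\<And>d. d > 0 \<Longrightarrow> integrable lborel (\<lambda>\<xi>. gauss d \<xi> * \<psi> \<xi>)"
      "\<And>d x. d > 0 \<Longrightarrow> 0 \<le> cos_transform (\<lambda>\<xi>. gauss d \<xi> * \<psi> \<xi>) x"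
    using assms(2) by (rule gauss_positiveE) blast
  have "\<bar>\<phi> \<xi> + \<psi> \<xi>\<bar> \<le> B + B'" for \<xi> using B[of \<xi>] B'[of \<xi>] by linarith
  moreover have "0 \<le> cos_transform (\<lambda>\<xi>. gauss d \<xi> * (\<phi> \<xi> + \<psi> \<xi>)) x" if "d > 0" for d x
    unfolding distrib_left cos_transform_add[OF \<phi>(1)[OF that] \<psi>(1)[OF that]]
    by (intro add_nonneg_nonneg \<phi>(2) \<psi>(2) that)
  ultimately show ?thesis unfolding gauss_positive_def by auto
qed

lemma gauss_positive_limit:
  fixes \<phi> :: "nat \<Rightarrow> 'a::euclidean_space \<Rightarrow> real"
  assumes pos: "\<And>n. gauss_positive (\<phi> n)" and bound: "\<And>n \<xi>. \<bar>\<phi> n \<xi>\<bar> \<le> B"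
    and lim: "\<And>\<xi>. (\<lambda>n. \<phi> n \<xi>) \<longlonglongrightarrow> \<psi> \<xi>"
  shows "gauss_positive \<psi>"
proof -
  have [measurable]: "\<phi> n \<in> borel_measurable borel" for n
    using pos by (auto simp: gauss_positive_def)
  have [measurable]: "\<psi> \<in> borel_measurable borel"
    by (rule borel_measurable_LIMSEQ_real[OF lim]) auto
  have "\<bar>\<psi> \<xi>\<bar> \<le> B" for \<xi>
    by (rule LIMSEQ_le_const2[OF tendsto_rabs[OF lim]]) (use bound in auto)
  moreover have "0 \<le> cos_transform (\<lambda>\<xi>. gauss d \<xi> * \<psi> \<xi>) x" if "d > 0" for d x
  proof (rule LIMSEQ_le_const)
    show "(\<lambda>n. cos_transform (\<lambda>\<xi>. gauss d \<xi> * \<phi> n \<xi>) x) \<longlonglongrightarrow> cos_transform (\<lambda>\<xi>. gauss d \<xi> * \<psi> \<xi>) x"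
      unfolding cos_transform_def mult.assoc[symmetric]
      by (intro tendsto_integral_mult_bounded[OF _ _ bound lim] integrable_cos_mult integrable_gauss
          that) measurable
    show "\<exists>N. \<forall>n\<ge>N. 0 \<le> cos_transform (\<lambda>\<xi>. gauss d \<xi> * \<phi> n \<xi>) x"
      using pos that unfolding gauss_positive_def by blast
  qed
  ultimately show ?thesis unfolding gauss_positive_def by auto
qed

lemma cos_transform_nonneg_if_gauss_positive:
  assumes pos: "gauss_positive \<phi>" and int: "integrable lborel \<phi>"
  shows "0 \<le> cos_transform \<phi> x"
proof (rule LIMSEQ_le_const)
  let ?d = "\<lambda>n. 1 / real (Suc n)"
  have "(\<lambda>n. LBINT \<xi>. (cos (x \<bullet> \<xi>) * \<phi> \<xi>) * gauss (?d n) \<xi>) \<longlonglongrightarrow> (LBINT \<xi>. (cos (x \<bullet> \<xi>) * \<phi> \<xi>) * 1)"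
    by (intro tendsto_integral_mult_bounded[where B=1] integrable_cos_mult int
        gauss_Suc_tendsto_1) auto
  then show "(\<lambda>n. cos_transform (\<lambda>\<xi>. gauss (?d n) \<xi> * \<phi> \<xi>) x) \<longlonglongrightarrow> cos_transform \<phi> x"
    by (simp add: cos_transform_def mult_ac)
  have "0 \<le> cos_transform (\<lambda>\<xi>. gauss (?d n) \<xi> * \<phi> \<xi>) x" for n
    using pos unfolding gauss_positive_def
    by (meson of_nat_0_less_iff zero_less_Suc zero_less_divide_1_iff)
  then show "\<exists>N. \<forall>n\<ge>N. 0 \<le> cos_transform (\<lambda>\<xi>. gauss (?d n) \<xi> * \<phi> \<xi>) x" by blast
qed

lemma
  fixes \<xi> :: "'a::euclidean_space"
  assumes int: "set_integrable lborel A w" and A: "A \<in> sets borel" "A \<subseteq> {0..}"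
    and nonneg: "\<And>s. s \<in> A \<Longrightarrow> 0 \<le> w s"
  shows set_integrable_gauss_mixture: "set_integrable lborel A (\<lambda>s. w s * gauss s \<xi>)"
    and gauss_mixture_nonneg: "0 \<le> (LBINT s:A. w s * gauss s \<xi>)"
    and gauss_mixture_le: "(LBINT s:A. w s * gauss s \<xi>) \<le> (LBINT s:A. w s)"
proof -
  have le: "w s * gauss s \<xi> \<le> w s" if "s \<in> A" for s
    using nonneg[OF that] that A(2) by (intro mult_left_le) auto
  show mixture_int: "set_integrable lborel A (\<lambda>s. w s * gauss s \<xi>)"
  proof (rule set_integrable_bound[OF int])
    have "(\<lambda>s. (indicator A s *\<^sub>R w s) * gauss s \<xi>) \<in> borel_measurable lborel"
      using int unfolding set_integrable_def by measurable
    then show "set_borel_measurable lborel A (\<lambda>s. w s * gauss s \<xi>)"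
      by (simp add: set_borel_measurable_def mult.assoc)
  qed (use le nonneg in \<open>auto simp: abs_mult\<close>)
  show "0 \<le> (LBINT s:A. w s * gauss s \<xi>)"
    unfolding set_lebesgue_integral_def using nonneg
    by (intro integral_nonneg_AE AE_I2) (auto simp: indicator_def)
  show "(LBINT s:A. w s * gauss s \<xi>) \<le> (LBINT s:A. w s)"
    by (rule set_integral_mono[OF mixture_int int le])
qed

lemma cos_transform_mult_mixture_nonneg:
  fixes \<phi> :: "'a::euclidean_space \<Rightarrow> real"
  assumes pos: "gauss_positive \<phi>" and d: "d > 0"
    and v: "integrable lborel v" "\<And>s. 0 \<le> v s" "\<And>s. s < 0 \<Longrightarrow> v s = 0"
  shows "0 \<le> cos_transform (\<lambda>\<xi>. gauss d \<xi> * (\<phi> \<xi> * (LBINT s. v s * gauss s \<xi>))) x"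
proof -
  obtain B where [measurable]: "\<phi> \<in> borel_measurable borel" and B: "\<And>\<xi>. \<bar>\<phi> \<xi>\<bar> \<le> B"
    and \<phi>: "\<And>d x. d > 0 \<Longrightarrow> 0 \<le> cos_transform (\<lambda>\<xi>. gauss d \<xi> * \<phi> \<xi>) x"
    using pos by (rule gauss_positiveE) blast
  have "B \<ge> 0" using B[of 0] by linarith
  have [measurable]: "v \<in> borel_measurable borel"
    using v(1) by (auto dest: borel_measurable_integrable)
  let ?k = "\<lambda>\<xi> s. cos (x \<bullet> \<xi>) * (\<phi> \<xi> * gauss (max 0 s) \<xi>)"
  have k_bound: "\<bar>?k \<xi> s\<bar> \<le> B" for \<xi> s
  proof -
    have "\<bar>cos (x \<bullet> \<xi>)\<bar> * (\<bar>\<phi> \<xi>\<bar> * gauss (max 0 s) \<xi>) \<le> 1 * (B * 1)"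
      using B[of \<xi>] \<open>B \<ge> 0\<close> by (intro mult_mono) auto
    then show ?thesis by (simp add: abs_mult)
  qed
  have truncate: "v s * gauss s \<xi> = v s * gauss (max 0 s) \<xi>" for s and \<xi> :: 'a
    using v(3)[of s] by (cases "s < 0") (auto simp: max_absorb2)
  have "cos_transform (\<lambda>\<xi>. gauss d \<xi> * (\<phi> \<xi> * (LBINT s. v s * gauss s \<xi>))) x
      = (LBINT \<xi>. LBINT s. gauss d \<xi> * v s * ?k \<xi> s)"
    unfolding cos_transform_def truncate
    by (subst integral_mult_right_zero[symmetric])+ (simp add: mult_ac)
  also have "\<dots> = (LBINT s. LBINT \<xi>. gauss d \<xi> * v s * ?k \<xi> s)"
    by (rule lborel_Fubini_bounded_kernel[OF integrable_gauss[OF d] v(1) _ k_bound]) measurable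
  also have "\<dots> = (LBINT s. v s * cos_transform (\<lambda>\<xi>. gauss (d + max 0 s) \<xi> * \<phi> \<xi>) x)"
    unfolding cos_transform_def
    by (subst integral_mult_right_zero[symmetric]) (simp only: gauss_add mult_ac)
  also have "\<dots> \<ge> 0"
    using d v(2) by (intro integral_nonneg_AE AE_I2 mult_nonneg_nonneg \<phi>) auto
  finally show ?thesis .
qed

lemma gauss_positive_mult_mixture:
  fixes \<phi> :: "'a::euclidean_space \<Rightarrow> real" and w :: "real \<Rightarrow> real"
  assumes pos: "gauss_positive \<phi>"
    and int: "set_integrable lborel A w" and A: "A \<in> sets borel" "A \<subseteq> {0..}"
    and nonneg: "\<And>s. s \<in> A \<Longrightarrow> 0 \<le> w s"
  shows "gauss_positive (\<lambda>\<xi>. \<phi> \<xi> * (LBINT s:A. w s * gauss s \<xi>))"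
proof -
  let ?g = "\<lambda>\<xi>::'a. LBINT s:A. w s * gauss s \<xi>"
  obtain B where [measurable]: "\<phi> \<in> borel_measurable borel" and B: "\<And>\<xi>. \<bar>\<phi> \<xi>\<bar> \<le> B"
    using pos by (rule gauss_positiveE) blast
  have "B \<ge> 0" using B[of 0] by linarith
  define v where "v s = indicator A s * w s" for s
  have v: "integrable lborel v" "0 \<le> v s" "s < 0 \<Longrightarrow> v s = 0" for s
    using int A(2) nonneg unfolding v_def set_integrable_def by (auto simp: indicator_def)
  then have [measurable]: "v \<in> borel_measurable borel" by (auto dest: borel_measurable_integrable)
  have g_eq: "?g \<xi> = (LBINT s. v s * gauss s \<xi>)" for \<xi>
    by (simp add: v_def set_lebesgue_integral_def mult.assoc)
  have "\<bar>?g \<xi>\<bar> \<le> (LBINT s:A. w s)" for \<xi>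
  proof -
    have "0 \<le> ?g \<xi>" by (rule gauss_mixture_nonneg[OF int A nonneg])
    moreover have "?g \<xi> \<le> (LBINT s:A. w s)" by (rule gauss_mixture_le[OF int A nonneg])
    ultimately show ?thesis by (simp only: abs_of_nonneg)
  qed
  then have "\<bar>\<phi> \<xi> * ?g \<xi>\<bar> \<le> B * (LBINT s:A. w s)" for \<xi>
    unfolding abs_mult using B \<open>B \<ge> 0\<close> by (intro mult_mono) auto
  moreover have "0 \<le> cos_transform (\<lambda>\<xi>. gauss d \<xi> * (\<phi> \<xi> * ?g \<xi>)) x" if "d > 0" for d x
    unfolding g_eq by (rule cos_transform_mult_mixture_nonneg[OF pos that v])
  moreover have "(\<lambda>\<xi>. \<phi> \<xi> * ?g \<xi>) \<in> borel_measurable borel" unfolding g_eq by measurable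
  ultimately show ?thesis unfolding gauss_positive_def by blast
qed

lemma gauss_positive_exp:
  assumes mult: "\<And>\<phi>. gauss_positive \<phi> \<Longrightarrow> gauss_positive (\<lambda>\<xi>. \<phi> \<xi> * g \<xi>)"
    and bound: "\<And>\<xi>. 0 \<le> g \<xi>" "\<And>\<xi>. g \<xi> \<le> B" and c: "c \<ge> 0"
  shows "gauss_positive (\<lambda>\<xi>. exp (c * g \<xi>))"
proof (rule gauss_positive_limit)
  have "gauss_positive (\<lambda>\<xi>. (1 + c * g \<xi> / real n) ^ k)" for n k
  proof (induction k)
    case 0
    show ?case using gauss_positive_gauss[of 0] by simp
  next
    case (Suc k)
    have "gauss_positive
        (\<lambda>\<xi>. (1 + c * g \<xi> / real n) ^ k + c / real n * ((1 + c * g \<xi> / real n) ^ k * g \<xi>))"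
      using c by (intro gauss_positive_add gauss_positive_cmult mult Suc) auto
    then show ?case by (simp add: algebra_simps)
  qed
  then show "gauss_positive (\<lambda>\<xi>. (1 + c * g \<xi> / real n) ^ n)" for n .
  show "(\<lambda>n. (1 + c * g \<xi> / real n) ^ n) \<longlonglongrightarrow> exp (c * g \<xi>)" for \<xi>
    by (rule tendsto_exp_limit_sequentially)
  show "\<bar>(1 + c * g \<xi> / real n) ^ n\<bar> \<le> exp (c * B)" for n \<xi>
  proof (cases "n = 0")
    case False
    have nonneg: "0 \<le> c * g \<xi>" using bound c by simp
    then have "(1 + c * g \<xi> / real n) ^ n \<le> exp (c * g \<xi>)"
      using False by (intro exp_ge_one_plus_x_over_n_power_n) auto
    also have "\<dots> \<le> exp (c * B)" using bound c by (simp add: mult_left_mono)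
    finally show ?thesis using nonneg by simp
  qed (use bound[of \<xi>] c in auto)
qed

lemma gauss_positive_exp_mixture:
  assumes int: "set_integrable lborel A w" and A: "A \<in> sets borel" "A \<subseteq> {0..}"
    and nonneg: "\<And>s. s \<in> A \<Longrightarrow> 0 \<le> w s"
    and c: "c \<ge> 0"
  shows "gauss_positive (\<lambda>\<xi>::'a::euclidean_space. exp (- c * (LBINT s:A. w s * (1 - gauss s \<xi>))))"
proof -
  have "(LBINT s:A. w s * (1 - gauss s \<xi>))
      = (LBINT s:A. w s) - (LBINT s:A. w s * gauss s \<xi>)" for \<xi> :: 'a
    unfolding right_diff_distrib mult_1_right
    by (rule set_integral_diff(2)[OF int set_integrable_gauss_mixture[OF int A nonneg]])
  moreover have "exp (- c * (m - g)) = exp (- c * m) * exp (c * g)" for m g :: real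
    by (simp add: exp_add[symmetric] algebra_simps)
  moreover have "gauss_positive
      (\<lambda>\<xi>::'a. exp (- c * (LBINT s:A. w s)) * exp (c * (LBINT s:A. w s * gauss s \<xi>)))"
  proof (intro gauss_positive_cmult gauss_positive_exp)
    show "gauss_positive (\<lambda>\<xi>::'a. \<phi> \<xi> * (LBINT s:A. w s * gauss s \<xi>))" if "gauss_positive \<phi>" for \<phi>
      by (rule gauss_positive_mult_mixture[OF that int A nonneg])
  qed (use c gauss_mixture_nonneg[OF int A nonneg] gauss_mixture_le[OF int A nonneg] in auto)
  ultimately show ?thesis by (simp only:)
qed

lemma gauss_positive_exp_singular_mixture:
  fixes w :: "real \<Rightarrow> real"
  assumes nonneg: "\<And>s. 0 < s \<Longrightarrow> 0 \<le> w s" and int: "\<And>a. 0 < a \<Longrightarrow> set_integrable lborel {a..} w"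
    and mixture_int: "\<And>\<xi>::'a. set_integrable lborel {0<..} (\<lambda>s. w s * (1 - gauss s \<xi>))"
    and c: "c \<ge> 0"
  shows "gauss_positive
      (\<lambda>\<xi>::'a::euclidean_space. exp (- c * (LBINT s:{0<..}. w s * (1 - gauss s \<xi>))))"
proof (rule gauss_positive_limit)
  let ?A = "\<lambda>n. {1 / real (Suc n)..}"
  have A_pos: "s > 0" if "s \<in> ?A n" for s n
    using that by (auto intro: less_le_trans[of 0 "1 / real (Suc n)"])
  show "gauss_positive (\<lambda>\<xi>::'a. exp (- c * (LBINT s:?A n. w s * (1 - gauss s \<xi>))))" for n
  proof (rule gauss_positive_exp_mixture[OF int _ _ _ c])
    show "?A n \<subseteq> {0..}" using A_pos[of _ n] by force
    show "0 \<le> w s" if "s \<in> ?A n" for s using A_pos[OF that] by (rule nonneg)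
  qed auto
  have "0 \<le> (LBINT s:?A n. w s * (1 - gauss s \<xi>))" for n and \<xi> :: 'a
    unfolding set_lebesgue_integral_def using nonneg A_pos[of _ n]
    by (intro integral_nonneg_AE AE_I2) (auto simp: indicator_def less_imp_le)
  then show "\<bar>exp (- c * (LBINT s:?A n. w s * (1 - gauss s \<xi>)))\<bar> \<le> 1" for n and \<xi> :: 'a
    using c by simp
  have "(\<Union>n. ?A n) = {0<..}"
  proof (intro equalityI subsetI)
    fix s :: real assume "s \<in> {0<..}"
    then obtain n where "inverse (real (Suc n)) < s" using reals_Archimedean by auto
    then show "s \<in> (\<Union>n. ?A n)" by (auto simp: inverse_eq_divide intro!: exI[of _ n])
  qed (use A_pos in auto)
  moreover have "incseq ?A" by (intro incseq_SucI) (auto simp: frac_le intro: order_trans[rotated])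
  ultimately have "(\<lambda>n. LBINT s:?A n. w s * (1 - gauss s \<xi>))
      \<longlonglongrightarrow> (LBINT s:{0<..}. w s * (1 - gauss s \<xi>))" for \<xi> :: 'a
    using set_integral_cont_up[of ?A lborel "\<lambda>s. w s * (1 - gauss s \<xi>)"] mixture_int by simp
  then show "(\<lambda>n. exp (- c * (LBINT s:?A n. w s * (1 - gauss s \<xi>))))
      \<longlonglongrightarrow> exp (- c * (LBINT s:{0<..}. w s * (1 - gauss s \<xi>)))" for \<xi> :: 'a
    by (intro tendsto_intros)
qed

abbreviation stable :: "real \<Rightarrow> real \<Rightarrow> 'a::euclidean_space \<Rightarrow> real" where
  "stable \<theta> t \<xi> \<equiv> exp (- t * norm \<xi> powr \<theta>)"

lemma norm_powr_gauss_mixture: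
  assumes "0 < \<theta>" "\<theta> < 2"
  obtains I where "I > 0"
    "\<And>\<xi>::'a::euclidean_space. set_integrable lborel {0<..}
        (\<lambda>s. s powr (-1 - \<theta> / 2) * (1 - gauss s \<xi>))"
    "\<And>\<xi>::'a. (LBINT s:{0<..}. s powr (-1 - \<theta> / 2) * (1 - gauss s \<xi>)) = I * norm \<xi> powr \<theta>"
proof -
  obtain I where I: "I > 0" and weight: "\<And>c. c \<ge> 0 \<Longrightarrow>
      (\<integral>\<^sup>+s\<in>{0<..}. ennreal ((1 - exp (- ((c * s) powr 1))) * s powr (-1 - \<theta> / 2)) \<partial>lborel)
          = ennreal (I * c powr (\<theta> / 2))"
    by (rule one_minus_exp_powr_weight_integral[of "\<theta> / 2" 1]) (use assms in auto)
  let ?f = "\<lambda>(\<xi>::'a) s. indicator {0<..} s * (s powr (-1 - \<theta> / 2) * (1 - gauss s \<xi>))"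
  have nonneg: "0 \<le> ?f \<xi> s" for s \<xi> by (auto simp: indicator_def)
  have nn_integral: "(\<integral>\<^sup>+s. ennreal (?f \<xi> s) \<partial>lborel) = ennreal (I * norm \<xi> powr \<theta>)" for \<xi>
  proof -
    have "(norm \<xi>)\<^sup>2 powr (\<theta> / 2) = norm \<xi> powr \<theta>"
      by (cases "\<xi> = 0") (auto simp: powr_powr simp flip: powr_numeral)
    then have "ennreal (I * norm \<xi> powr \<theta>)
        = (\<integral>\<^sup>+s\<in>{0<..}. ennreal ((1 - exp (- (((norm \<xi>)\<^sup>2 * s) powr 1)))
            * s powr (-1 - \<theta> / 2)) \<partial>lborel)"
      by (subst weight) simp_all
    also have "\<dots> = (\<integral>\<^sup>+s. ennreal (?f \<xi> s) \<partial>lborel)"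
      by (intro nn_integral_cong) (auto simp: indicator_def mult_ac)
    finally show ?thesis ..
  qed
  have "set_integrable lborel {0<..} (\<lambda>s. s powr (-1 - \<theta> / 2) * (1 - gauss s \<xi>))" for \<xi> :: 'a
    unfolding set_integrable_def real_scaleR_def
    by (rule integrableI_nonneg) (use nonneg nn_integral in auto)
  moreover have "(LBINT s:{0<..}. s powr (-1 - \<theta> / 2) * (1 - gauss s \<xi>))
      = I * norm \<xi> powr \<theta>" for \<xi> :: 'a
    unfolding set_lebesgue_integral_def real_scaleR_def
    using nn_integral[of \<xi>] nonneg I by (subst integral_eq_nn_integral) auto
  ultimately show ?thesis using that I by blast
qed

lemma set_integrable_powr_near_inf:
  fixes p c :: real assumes "p < -1" "c > 0"
  shows "set_integrable lborel {c..} (\<lambda>s. s powr p)"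
proof -
  have "(\<integral>\<^sup>+s. ennreal (indicator {c..} s * s powr p) \<partial>lborel)
      = (\<integral>\<^sup>+s\<in>{c..}. ennreal (s powr p) \<partial>lborel)"
    by (intro nn_integral_cong) (auto simp: indicator_def)
  also have "\<dots> < \<infinity>" using assms by (subst nn_integral_powr_near_inf) auto
  finally show ?thesis
    unfolding set_integrable_def real_scaleR_def by (intro integrableI_nonneg) auto
qed

lemma gauss_positive_stable:
  fixes t \<theta> :: real assumes t: "t \<ge> 0" and th: "0 < \<theta>" "\<theta> \<le> 2"
  shows "gauss_positive (stable \<theta> t :: 'a::euclidean_space \<Rightarrow> real)"
proof (cases "\<theta> = 2")
  case True
  then show ?thesis using gauss_positive_gauss[OF t] by (simp add: powr_numeral)
next
  case False
  then have "\<theta> < 2" using th by simp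
  let ?w = "\<lambda>s. s powr (-1 - \<theta> / 2)"
  obtain I where I: "I > 0"
    and int: "\<And>\<xi>::'a. set_integrable lborel {0<..} (\<lambda>s. ?w s * (1 - gauss s \<xi>))"
    and mixture: "\<And>\<xi>::'a. (LBINT s:{0<..}. ?w s * (1 - gauss s \<xi>)) = I * norm \<xi> powr \<theta>"
    using norm_powr_gauss_mixture[OF th(1) \<open>\<theta> < 2\<close>] by blast
  have "gauss_positive (\<lambda>\<xi>::'a. exp (- (t / I) * (LBINT s:{0<..}. ?w s * (1 - gauss s \<xi>))))"
    using t th I by (intro gauss_positive_exp_singular_mixture int
        set_integrable_powr_near_inf) auto
  then show ?thesis unfolding mixture using I by simp
qed

section \<open>The fundamental solution\<close>

lemma Gamma_frac_eq_cos_transform: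
  "Gamma_frac \<theta> (x::real^'n) t = 1 / (2 * pi) ^ CARD('n) * cos_transform (stable \<theta> t) x"
  by (simp only: Gamma_frac_def cos_transform_def)

lemma Gamma_frac_measurable[measurable (raw)]:
  assumes [measurable]: "f \<in> M \<rightarrow>\<^sub>M borel" "g \<in> M \<rightarrow>\<^sub>M borel"
  shows "(\<lambda>z. Gamma_frac \<theta> (f z :: real^'n) (g z)) \<in> borel_measurable M"
  unfolding Gamma_frac_def by measurable

lemma Gamma_frac_uminus: "Gamma_frac \<theta> (- x) t = Gamma_frac \<theta> x t"
  by (simp add: Gamma_frac_def)

locale fractional_heat =
  fixes \<theta> :: real
  assumes theta: "0 < \<theta>" "\<theta> \<le> 2"
begin

lemma integrable_stable: "t > 0 \<Longrightarrow> integrable lborel (stable \<theta> t :: real^'n \<Rightarrow> real)"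
  using theta by (intro integrable_exp_norm_powr)

lemma Gamma_frac_nonneg:
  fixes x :: "real^'n"
  assumes "t > 0"
  shows "0 \<le> Gamma_frac \<theta> x t"
  unfolding Gamma_frac_eq_cos_transform using assms theta
  by (intro mult_nonneg_nonneg cos_transform_nonneg_if_gauss_positive gauss_positive_stable
      integrable_stable) auto

lemma Gamma_frac_bounded:
  obtains A where "A > 0" "\<And>t (x::real^'n). t > 0 \<Longrightarrow>
      Gamma_frac \<theta> x t \<le> A * t powr (- real CARD('n) / \<theta>)"
proof -
  let ?N = "real CARD('n)"
  let ?K = "unit_ball_vol ?N * Gamma (?N / \<theta> + 1)"
  have K: "?K > 0" using theta by (simp add: add_pos_pos)
  have "Gamma_frac \<theta> x t \<le> 1 / (2 * pi) ^ CARD('n) * ?K * t powr (- ?N / \<theta>)" if t: "t > 0"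
    for t and x :: "real^'n"
  proof -
    have "(LBINT \<xi>::real^'n. stable \<theta> t \<xi>) = ?K * t powr (- ?N / \<theta>)"
      using K by (subst integral_eq_nn_integral)
        (auto simp: nn_integral_exp_norm_powr[OF t theta(1), simplified])
    then have "cos_transform (stable \<theta> t) x \<le> ?K * t powr (- ?N / \<theta>)"
      using abs_cos_transform_le[OF integrable_stable[OF t], of x] by simp
    then show ?thesis
      unfolding Gamma_frac_eq_cos_transform mult.assoc by (rule mult_left_mono) simp
  qed
  moreover have "1 / (2 * pi) ^ CARD('n) * ?K > 0" using K by simp
  ultimately show ?thesis using that by blast
qed

lemma
  assumes t: "t > 0"
  shows Gamma_frac_integrable: "integrable lborel (\<lambda>x::real^'n. Gamma_frac \<theta> x t)"
    and cos_transform_Gamma_frac: "cos_transform (\<lambda>x::real^'n. Gamma_frac \<theta> x t) = stable \<theta> t"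
proof -
  let ?\<phi> = "stable \<theta> t :: real^'n \<Rightarrow> real"
  have cont: "continuous_on UNIV ?\<phi>"
    using theta by (intro continuous_intros continuous_on_powr') auto
  have nonneg: "0 \<le> cos_transform ?\<phi> x" for x
    using t theta by (intro cos_transform_nonneg_if_gauss_positive gauss_positive_stable
        integrable_stable) auto
  have le_1: "\<bar>?\<phi> \<xi>\<bar> \<le> 1" for \<xi> using t by simp
  show "integrable lborel (\<lambda>x::real^'n. Gamma_frac \<theta> x t)"
    unfolding Gamma_frac_eq_cos_transform
    by (intro integrable_mult_right integrable_cos_transform[OF integrable_stable[OF t] _ le_1 cont
        nonneg]) simp
  have "cos_transform (cos_transform ?\<phi>) \<eta> = (2 * pi) ^ CARD('n) * ?\<phi> \<eta>" for \<eta>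
    using cos_transform_inversion[OF integrable_stable[OF t] _ le_1 cont nonneg] by simp
  then show "cos_transform (\<lambda>x::real^'n. Gamma_frac \<theta> x t) = ?\<phi>"
    unfolding Gamma_frac_eq_cos_transform cos_transform_cmult by (simp add: fun_eq_iff)
qed

lemma nn_integral_Gamma_frac:
  fixes x :: "real^'n"
  assumes t: "t > 0"
  shows "(\<integral>\<^sup>+y. ennreal (Gamma_frac \<theta> (x - y) t) \<partial>lborel) = 1"
proof -
  have "(LBINT y::real^'n. Gamma_frac \<theta> y t) = 1"
    using fun_cong[OF cos_transform_Gamma_frac[OF t, where 'n='n], of 0] theta
    by (simp add: cos_transform_def)
  then have "(\<integral>\<^sup>+y. ennreal (Gamma_frac \<theta> (y::real^'n) t) \<partial>lborel) = 1"
    by (subst nn_integral_eq_integral[OF Gamma_frac_integrable[OF t]])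
      (auto simp: Gamma_frac_nonneg[OF t])
  then show ?thesis
    by (subst nn_integral_lborel_reflect[where f="\<lambda>z. ennreal (Gamma_frac \<theta> z t)"]) auto
qed

lemma Gamma_frac_convolution:
  fixes x :: "real^'n"
  assumes t: "t > 0" and s: "s > 0"
  shows "(LBINT y. Gamma_frac \<theta> (x - y) t * Gamma_frac \<theta> y s) = Gamma_frac \<theta> x (t + s)"
proof -
  have "(LBINT y. Gamma_frac \<theta> (x - y) t * Gamma_frac \<theta> y s)
      = 1 / (2 * pi) ^ CARD('n) * (LBINT y. cos_transform (stable \<theta> t) (x - y) * Gamma_frac \<theta> y s)"
    unfolding Gamma_frac_eq_cos_transform[of \<theta> _ t]
    by (simp only: mult.assoc integral_mult_right_zero)
  also have "(LBINT y. cos_transform (stable \<theta> t) (x - y) * Gamma_frac \<theta> y s)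
      = cos_transform (\<lambda>\<xi>. stable \<theta> t \<xi> * stable \<theta> s \<xi>) x"
    using cos_transform_convolution
        [OF integrable_stable[OF t] Gamma_frac_integrable[OF s] Gamma_frac_uminus, of x]
    by (simp only: cos_transform_Gamma_frac[OF s])
  also have "(\<lambda>\<xi>::real^'n. stable \<theta> t \<xi> * stable \<theta> s \<xi>) = stable \<theta> (t + s)"
    by (simp add: fun_eq_iff exp_add[symmetric] algebra_simps)
  finally show ?thesis by (simp only: Gamma_frac_eq_cos_transform)
qed

lemma Gamma_frac_semigroup:
  fixes x z :: "real^'n"
  assumes t: "t > 0" and s: "s > 0"
  shows "(\<integral>\<^sup>+y. ennreal (Gamma_frac \<theta> (x - y) t) * ennreal (Gamma_frac \<theta> (y - z) s) \<partial>lborel)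
    = ennreal (Gamma_frac \<theta> (x - z) (t + s))"
proof -
  let ?f = "\<lambda>y. Gamma_frac \<theta> ((x - z) - y) t * Gamma_frac \<theta> y s"
  obtain A where "A > 0"
    and A: "\<And>t (x::real^'n). t > 0 \<Longrightarrow> Gamma_frac \<theta> x t \<le> A * t powr (- real CARD('n) / \<theta>)"
    using Gamma_frac_bounded[where 'n='n] by metis
  have "\<bar>Gamma_frac \<theta> (x - z - y) t\<bar> \<le> A * t powr (- real CARD('n) / \<theta>)" for y
    using A[OF t, of "x - z - y"] Gamma_frac_nonneg[OF t, of "x - z - y"] by simp
  then have "integrable lborel (\<lambda>y. Gamma_frac \<theta> y s * Gamma_frac \<theta> (x - z - y) t)"
    by (intro integrable_mult_bounded[OF Gamma_frac_integrable[OF s]]) measurable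
  then have int: "integrable lborel ?f" by (simp only: mult.commute)
  have "(\<integral>\<^sup>+y. ennreal (Gamma_frac \<theta> (x - y) t) * ennreal (Gamma_frac \<theta> (y - z) s) \<partial>lborel)
      = (\<integral>\<^sup>+y. ennreal (Gamma_frac \<theta> (x - (z + y)) t)
          * ennreal (Gamma_frac \<theta> ((z + y) - z) s) \<partial>lborel)"
    by (subst nn_integral_lborel_affine[where c=1 and a=z]) auto
  also have "\<dots> = (\<integral>\<^sup>+y. ennreal (?f y) \<partial>lborel)"
    by (intro nn_integral_cong)
      (simp add: ennreal_mult[symmetric] Gamma_frac_nonneg t s algebra_simps)
  also have "\<dots> = ennreal (LBINT y. ?f y)"
    by (rule nn_integral_eq_integral[OF int]) (simp add: Gamma_frac_nonneg t s)
  finally show ?thesis by (simp only: Gamma_frac_convolution[OF t s])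
qed

lemma nn_integral_Gamma_frac_cos_defect:
  fixes \<eta> :: "real^'n"
  assumes t: "t > 0"
  shows "(\<integral>\<^sup>+y. ennreal (Gamma_frac \<theta> y t * (1 - cos (\<eta> \<bullet> y))) \<partial>lborel)
      = ennreal (1 - stable \<theta> t \<eta>)"
proof -
  let ?G = "\<lambda>y::real^'n. Gamma_frac \<theta> y t"
  have G: "integrable lborel ?G" "integrable lborel (\<lambda>y. cos (\<eta> \<bullet> y) * ?G y)"
    using Gamma_frac_integrable[OF t] by (auto intro: integrable_cos_mult)
  have transform: "(LBINT y. cos (\<zeta> \<bullet> y) * ?G y) = stable \<theta> t \<zeta>" for \<zeta>
    using fun_cong[OF cos_transform_Gamma_frac[OF t]] by (simp only: cos_transform_def)
  have split: "?G y * (1 - cos (\<eta> \<bullet> y)) = ?G y - cos (\<eta> \<bullet> y) * ?G y" for y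
    by (simp add: algebra_simps)
  have "(\<integral>\<^sup>+y. ennreal (?G y * (1 - cos (\<eta> \<bullet> y))) \<partial>lborel)
      = ennreal (LBINT y. ?G y * (1 - cos (\<eta> \<bullet> y)))"
  proof (rule nn_integral_eq_integral)
    show "integrable lborel (\<lambda>y. ?G y * (1 - cos (\<eta> \<bullet> y)))" unfolding split using G by simp
    show "AE y in lborel. 0 \<le> ?G y * (1 - cos (\<eta> \<bullet> y))"
      by (intro AE_I2 mult_nonneg_nonneg Gamma_frac_nonneg t) simp
  qed
  also have "(LBINT y. ?G y * (1 - cos (\<eta> \<bullet> y))) = 1 - stable \<theta> t \<eta>"
    using transform[of 0] theta
      unfolding split by (simp add: Bochner_Integration.integral_diff[OF G] transform)
  finally show ?thesis .
qed

lemma nn_integral_Gamma_frac_cos_defect_ray: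
  fixes e :: "real^'n"
  assumes t: "t > 0" and e: "norm e = 1" and s: "s > 0"
  shows "(\<integral>\<^sup>+y. ennreal (Gamma_frac \<theta> y t * (1 - cos ((s *\<^sub>R e) \<bullet> y))) \<partial>lborel)
    = ennreal (1 - exp (- ((t powr (1/\<theta>) * s) powr \<theta>)))"
proof -
  have "(t powr (1/\<theta>) * s) powr \<theta> = t * norm (s *\<^sub>R e) powr \<theta>"
    using t s theta e by (simp add: powr_mult powr_powr)
  then show ?thesis unfolding nn_integral_Gamma_frac_cos_defect[OF t] by simp
qed

lemma nn_integral_Gamma_frac_cos_weight:
  fixes e :: "real^'n"
  assumes t: "t > 0" and e: "norm e = 1"
  shows "(\<integral>\<^sup>+y. ennreal (Gamma_frac \<theta> y t) *
      (\<integral>\<^sup>+s\<in>{0<..}. ennreal ((1 - cos ((s *\<^sub>R e) \<bullet> y)) * s powr a) \<partial>lborel) \<partial>lborel)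
    = (\<integral>\<^sup>+s\<in>{0<..}. ennreal ((1 - exp (- ((t powr (1/\<theta>) * s) powr \<theta>))) * s powr a) \<partial>lborel)"
proof -
  let ?G = "\<lambda>y::real^'n. Gamma_frac \<theta> y t" and ?c = "\<lambda>s y. 1 - cos ((s *\<^sub>R e) \<bullet> y)"
    and ?m = "\<lambda>s. ennreal (s powr a) * indicator {0<..} s"
  have integrand: "ennreal (?G y) * (\<integral>\<^sup>+s\<in>{0<..}. ennreal (?c s y * s powr a) \<partial>lborel)
      = (\<integral>\<^sup>+s. ennreal (?G y * ?c s y) * ?m s \<partial>lborel)" for y
  proof -
    have "ennreal (?G y) * (\<integral>\<^sup>+s\<in>{0<..}. ennreal (?c s y * s powr a) \<partial>lborel)
        = (\<integral>\<^sup>+s. ennreal (?G y) * (ennreal (?c s y * s powr a) * indicator {0<..} s) \<partial>lborel)"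
      by (rule nn_integral_cmult[symmetric]) measurable
    then show ?thesis
      using Gamma_frac_nonneg[OF t, of y] by (simp add: ennreal_mult' ennreal_mult'' mult.assoc)
  qed
  have defect: "(\<integral>\<^sup>+y. ennreal (?G y * ?c s y) * ?m s \<partial>lborel)
      = ennreal ((1 - exp (- ((t powr (1/\<theta>) * s) powr \<theta>))) * s powr a) * indicator {0<..} s" for s
  proof (cases "s > 0")
    case True
    have "(\<integral>\<^sup>+y. ennreal (?G y * ?c s y) * ?m s \<partial>lborel)
        = (\<integral>\<^sup>+y. ennreal (?G y * ?c s y) \<partial>lborel) * ?m s"
      by (rule nn_integral_multc) measurable
    also note nn_integral_Gamma_frac_cos_defect_ray[OF t e True]
    finally show ?thesis using True by (simp add: ennreal_mult'')
  qed simp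
  have "(\<integral>\<^sup>+y. (\<integral>\<^sup>+s. ennreal (?G y * ?c s y) * ?m s \<partial>lborel) \<partial>lborel)
      = (\<integral>\<^sup>+s. (\<integral>\<^sup>+y. ennreal (?G y * ?c s y) * ?m s \<partial>lborel) \<partial>lborel)"
    by (rule lborel_pair.Fubini'[symmetric]) measurable
  then show ?thesis unfolding integrand defect .
qed

lemma Gamma_frac_directional_moment:
  assumes a: "0 < a" "a < \<theta>"
  obtains C where "C > 0" "\<And>t (e::real^'n). t > 0 \<Longrightarrow> norm e = 1 \<Longrightarrow>
     (\<integral>\<^sup>+y. ennreal (Gamma_frac \<theta> y t) * ennreal (\<bar>e \<bullet> y\<bar> powr a) \<partial>lborel)
         = ennreal (C * t powr (a / \<theta>))"
proof -
  obtain I where I: "I > 0" and cos_weight: "\<And>c.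
      (\<integral>\<^sup>+s\<in>{0<..}. ennreal ((1 - cos (c * s)) * s powr (-1-a)) \<partial>lborel) = ennreal (I * \<bar>c\<bar> powr a)"
    using one_minus_cos_weight_integral[of a] a theta by auto
  obtain J where J: "J > 0" and exp_weight: "\<And>c. c \<ge> 0 \<Longrightarrow>
      (\<integral>\<^sup>+s\<in>{0<..}. ennreal ((1 - exp (- ((c * s) powr \<theta>))) * s powr (-1-a)) \<partial>lborel)
          = ennreal (J * c powr a)"
    using one_minus_exp_powr_weight_integral[OF a] by blast
  have "(\<integral>\<^sup>+y. ennreal (Gamma_frac \<theta> y t) * ennreal (\<bar>e \<bullet> y\<bar> powr a) \<partial>lborel)
      = ennreal (J / I * t powr (a / \<theta>))"
    if t: "t > 0" and e: "norm e = 1" for t and e :: "real^'n"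
  proof -
    have ray_weight: "(\<integral>\<^sup>+s\<in>{0<..}. ennreal ((1 - cos ((s *\<^sub>R e) \<bullet> y)) * s powr (-1-a)) \<partial>lborel)
        = ennreal I * ennreal (\<bar>e \<bullet> y\<bar> powr a)" for y
      using I cos_weight[of "e \<bullet> y"] by (simp add: ennreal_mult mult.commute)
    have "ennreal I * (\<integral>\<^sup>+y. ennreal (Gamma_frac \<theta> y t) * ennreal (\<bar>e \<bullet> y\<bar> powr a) \<partial>lborel)
        = (\<integral>\<^sup>+y. ennreal (Gamma_frac \<theta> y t) * (ennreal I * ennreal (\<bar>e \<bullet> y\<bar> powr a)) \<partial>lborel)"
      by (subst nn_integral_cmult[symmetric]) (auto simp: mult_ac)
    also have "\<dots> = ennreal I * ennreal (J / I * t powr (a / \<theta>))"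
      unfolding ray_weight[symmetric] nn_integral_Gamma_frac_cos_weight[OF t e]
      using I J by (subst exp_weight) (auto simp: ennreal_mult[symmetric] powr_powr)
    finally show ?thesis using I by (simp add: ennreal_mult_cancel_left)
  qed
  moreover have "J / I > 0" using I J by simp
  ultimately show ?thesis using that by blast
qed

lemma Gamma_frac_moment:
  assumes a: "0 < a" "a < \<theta>"
  obtains C where "C > 0" "\<And>t. t > 0 \<Longrightarrow>
     (\<integral>\<^sup>+y. ennreal (Gamma_frac \<theta> (y::real^'n) t) * ennreal (norm y powr a) \<partial>lborel)
         \<le> ennreal (C * t powr (a / \<theta>))"
proof -
  obtain D where D: "D > 0" and directional: "\<And>t (e::real^'n). t > 0 \<Longrightarrow> norm e = 1 \<Longrightarrow>
     (\<integral>\<^sup>+y. ennreal (Gamma_frac \<theta> y t) * ennreal (\<bar>e \<bullet> y\<bar> powr a) \<partial>lborel)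
         = ennreal (D * t powr (a / \<theta>))"
    using Gamma_frac_directional_moment[OF a] by blast
  let ?N = "real CARD('n)"
  have "(\<integral>\<^sup>+y. ennreal (Gamma_frac \<theta> (y::real^'n) t) * ennreal (norm y powr a) \<partial>lborel)
      \<le> ennreal (?N powr a * ?N * D * t powr (a / \<theta>))" if t: "t > 0" for t
  proof -
    let ?G = "\<lambda>y::real^'n. Gamma_frac \<theta> y t"
    have "ennreal (?G y) * ennreal (norm y powr a)
        \<le> ennreal (?N powr a) * (\<Sum>e\<in>Basis. ennreal (?G y) * ennreal (\<bar>e \<bullet> y\<bar> powr a))" for y
    proof -
      have "ennreal (norm y powr a) \<le> ennreal (?N powr a * (\<Sum>e\<in>Basis. \<bar>e \<bullet> y\<bar> powr a))"
        using norm_powr_le_sum[OF a(1), of y] by (simp add: ennreal_leI inner_commute)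
      also have "\<dots> = ennreal (?N powr a) * (\<Sum>e\<in>Basis. ennreal (\<bar>e \<bullet> y\<bar> powr a))"
        by (simp add: ennreal_mult sum_nonneg sum_ennreal)
      finally have "ennreal (?G y) * ennreal (norm y powr a)
          \<le> ennreal (?G y) * (ennreal (?N powr a) * (\<Sum>e\<in>Basis. ennreal (\<bar>e \<bullet> y\<bar> powr a)))"
        by (rule mult_left_mono) simp
      then show ?thesis by (simp only: sum_distrib_left mult.left_commute[of "ennreal (?G y)"])
    qed
    then have "(\<integral>\<^sup>+y. ennreal (?G y) * ennreal (norm y powr a) \<partial>lborel)
        \<le> (\<integral>\<^sup>+y. ennreal (?N powr a)
            * (\<Sum>e\<in>Basis. ennreal (?G y) * ennreal (\<bar>e \<bullet> y\<bar> powr a)) \<partial>lborel)"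
      by (intro nn_integral_mono)
    also have "\<dots> = ennreal (?N powr a)
        * (\<Sum>e\<in>Basis. (\<integral>\<^sup>+y. ennreal (?G y) * ennreal (\<bar>e \<bullet> y\<bar> powr a) \<partial>lborel))"
      by (subst nn_integral_cmult, measurable, subst nn_integral_sum) auto
    also have "\<dots> = ennreal (?N powr a) * (\<Sum>e\<in>(Basis::(real^'n) set). ennreal (D * t powr (a / \<theta>)))"
      using directional[OF t] by (intro arg_cong2[where f="(*)"] sum.cong) auto
    also have "\<dots> = ennreal (?N powr a * ?N * D * t powr (a / \<theta>))"
      using D by (simp add: ennreal_mult' ennreal_of_nat_eq_real_of_nat mult.assoc)
    finally show ?thesis .
  qed
  moreover have "?N powr a * ?N * D > 0" using D by simp
  ultimately show ?thesis using that by blast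
qed

end

section \<open>The nonlinearity\<close>

lemma eventually_mono_if_derivative_nonneg:
  fixes g g' :: "real \<Rightarrow> real"
  assumes "\<forall>\<^sub>F u in at_top. (g has_real_derivative g' u) (at u) \<and> 0 \<le> g' u"
  obtains a where "a > 0" "mono_on {a..} g"
proof -
  obtain a where a: "\<And>u. u \<ge> a \<Longrightarrow> (g has_real_derivative g' u) (at u) \<and> 0 \<le> g' u"
    using assms by (auto simp: eventually_at_top_linorder)
  have "mono_on {max a 1..} g"
  proof (rule mono_onI)
    fix u v assume "u \<in> {max a 1..}" "u \<le> v"
    then show "g u \<le> g v"
      by (intro DERIV_nonneg_imp_nondecreasing[OF \<open>u \<le> v\<close>])
        (use a in \<open>meson atLeast_iff max.boundedE order_trans\<close>)
  qed
  then show ?thesis by (rule that[rotated]) simp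
qed

locale admissible =
  fixes f :: "real \<Rightarrow> real"
  assumes M: "hyp_M f" and S: "hyp_S f" and L: "hyp_L f"
begin

abbreviation F :: "real \<Rightarrow> real" where "F \<equiv> Ffun f"

lemma f_cont: "continuous_on {0..} f" and f_mono: "0 \<le> u \<Longrightarrow> u \<le> v \<Longrightarrow> f u \<le> f v"
  and f_pos: "u > 0 \<Longrightarrow> f u > 0"
  using M by (auto simp: hyp_M_def mono_on_def)

lemma f_nonneg:
  assumes "u \<ge> 0" shows "f u \<ge> 0"
proof (cases "u = 0")
  case True
  have "(f \<longlongrightarrow> f 0) (at 0 within {0..})" using f_cont by (simp add: continuous_on_def)
  then have "(f \<longlongrightarrow> f 0) (at_right 0)" by (rule tendsto_within_subset) auto
  moreover have "\<forall>\<^sub>F v in at_right 0. 0 \<le> f v"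
    using eventually_at_right_less by eventually_elim (simp add: f_pos less_imp_le)
  ultimately show ?thesis using True by (simp add: tendsto_lowerbound)
qed (use assms f_pos[of u] in simp)

lemma f_cont_pos: "continuous_on A f" if "\<And>u. u \<in> A \<Longrightarrow> u > 0"
  using that by (intro continuous_on_subset[OF f_cont]) (auto intro: less_imp_le)

lemma inv_f_cont:
  assumes "0 < a" shows "continuous_on {a..b} (\<lambda>s. 1 / f s)"
proof (intro continuous_intros f_cont_pos)
  show "\<forall>s\<in>{a..b}. f s \<noteq> 0" using assms f_pos by (auto simp: less_imp_neq[THEN not_sym])
qed (use assms in auto)

lemma f_eventually_has_derivative: "\<forall>\<^sub>F u in at_top. (f has_real_derivative deriv f u) (at u)"
proof -
  obtain \<tau> f' where f': "\<And>u. u \<ge> \<tau> \<Longrightarrow> (f has_real_derivative f' u) (at u within {\<tau>..})"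
    using S unfolding hyp_S_def by blast
  show ?thesis
    using eventually_gt_at_top[of \<tau>]
  proof eventually_elim
    case (elim u)
    then have "at u within {\<tau>..} = at u"
      by (intro at_within_interior) (auto simp: interior_Ici[of "\<tau> - 1"])
    then have "(f has_real_derivative f' u) (at u)" using f'[of u] elim by simp
    then show ?case by (simp add: DERIV_imp_deriv)
  qed
qed

lemma inv_f_abs_integrable:
  assumes "u > 0" shows "set_integrable lebesgue {u..} (\<lambda>s. 1 / f s)"
proof -
  obtain \<tau> where \<tau>: "\<tau> > 0" "(\<lambda>s. 1 / f s) integrable_on {\<tau>..}"
    using S unfolding hyp_S_def by blast
  let ?m = "min u \<tau>"
  have m: "?m > 0" using assms \<tau>(1) by simp
  have nonneg: "0 \<le> 1 / f s" if "s \<ge> ?m" for s using f_pos[of s] that m by simp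
  have "set_integrable lebesgue {?m..\<tau>} (\<lambda>s. 1 / f s)"
    by (rule nonnegative_absolutely_integrable_1[OF
        integrable_continuous_real[OF inv_f_cont[OF m]]])
       (use nonneg in auto)
  moreover have "set_integrable lebesgue {\<tau>..} (\<lambda>s. 1 / f s)"
    by (rule nonnegative_absolutely_integrable_1[OF \<tau>(2)]) (use nonneg in auto)
  ultimately have "set_integrable lebesgue ({?m..\<tau>} \<union> {\<tau>..}) (\<lambda>s. 1 / f s)"
    by (intro set_integrable_Un) auto
  then show ?thesis by (rule set_integrable_subset) auto
qed

lemma inv_f_integrable: "u > 0 \<Longrightarrow> (\<lambda>s. 1 / f s) integrable_on {u..}"
  by (rule set_lebesgue_integral_eq_integral(1)[OF inv_f_abs_integrable])

lemma F_split:
  assumes "0 < u" "u \<le> v" shows "F u = integral {u..v} (\<lambda>s. 1 / f s) + F v"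
proof -
  have "((\<lambda>s. 1 / f s) has_integral (integral {u..v} (\<lambda>s. 1 / f s) + F v)) ({u..v} \<union> {v..})"
  proof (rule has_integral_Un)
    show "((\<lambda>s. 1 / f s) has_integral integral {u..v} (\<lambda>s. 1 / f s)) {u..v}"
      using integrable_continuous_real[OF inv_f_cont[OF assms(1)]] by (rule integrable_integral)
    show "((\<lambda>s. 1 / f s) has_integral F v) {v..}"
      unfolding Ffun_def using inv_f_integrable[of v] assms by (intro integrable_integral) auto
    have "{u..v} \<inter> {v..} \<subseteq> {v}" by auto
    then show "negligible ({u..v} \<inter> {v..})" by (rule negligible_subset[OF negligible_sing])
  qed
  moreover have "{u..v} \<union> {v..} = {u..}" using assms by auto
  ultimately show ?thesis unfolding Ffun_def[of f u] by (simp add: integral_unique)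
qed

lemma F_has_derivative:
  assumes "u > 0" shows "(F has_real_derivative - 1 / f u) (at u)"
proof -
  let ?a = "u / 2" and ?b = "u + 1"
  have a: "?a > 0" using assms by simp
  have "((\<lambda>x. integral {?a..x} (\<lambda>s. 1 / f s)) has_real_derivative 1 / f u) (at u within {?a..?b})"
    by (rule integral_has_real_derivative[OF inv_f_cont[OF a]]) (use assms in auto)
  moreover have "at u within {?a..?b} = at u" using assms by (intro at_within_interior) auto
  ultimately have "((\<lambda>x. F ?a - integral {?a..x} (\<lambda>s. 1 / f s))
      has_real_derivative 0 - 1 / f u) (at u)"
    by (intro DERIV_diff DERIV_const) simp
  then show ?thesis
    unfolding diff_0 minus_divide_left
  proof (rule has_field_derivative_transform_within_open)
    show "open {?a<..}" "u \<in> {?a<..}" using assms by auto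
    show "F ?a - integral {?a..x} (\<lambda>s. 1 / f s) = F x" if "x \<in> {?a<..}" for x
      using F_split[OF a, of x] that by simp
  qed
qed

lemma F_cont: "continuous_on {0<..} F"
  by (rule DERIV_continuous_on) (rule has_field_derivative_at_within[OF F_has_derivative], simp)

lemma F_diff_ge:
  assumes "0 < u" "u \<le> v" shows "(v - u) / f v \<le> F u - F v"
proof -
  have "integral {u..v} (\<lambda>s. 1 / f v) \<le> integral {u..v} (\<lambda>s. 1 / f s)"
    using assms integrable_continuous_real[OF inv_f_cont[OF assms(1)]]
    by (intro integral_le integrable_const_ivl)
      (auto intro!: divide_left_mono f_mono mult_pos_pos f_pos)
  then show ?thesis using F_split[OF assms] assms by simp
qed

lemma F_strict_antimono:
  assumes "0 < u" "u < v" shows "F v < F u"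
proof -
  have "0 < (v - u) / f v" using assms f_pos[of v] by simp
  then show ?thesis using F_diff_ge[of u v] assms by simp
qed

lemma F_antimono: "0 < u \<Longrightarrow> u \<le> v \<Longrightarrow> F v \<le> F u"
  using F_strict_antimono[of u v] by (cases "u = v") auto

lemma F_le_iff: "0 < u \<Longrightarrow> 0 < v \<Longrightarrow> F v \<le> F u \<longleftrightarrow> u \<le> v"
  using F_antimono[of u v] F_strict_antimono[of v u] by (meson not_le)

lemma F_nonneg: "u > 0 \<Longrightarrow> F u \<ge> 0"
  unfolding Ffun_def using f_pos less_le_trans
  by (intro integral_nonneg inv_f_integrable) (auto intro!: less_imp_le)

lemma F_pos: "u > 0 \<Longrightarrow> F u > 0"
  using F_strict_antimono[of u "u + 1"] F_nonneg[of "u + 1"] by simp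

lemma F_tendsto_0: "(F \<longlongrightarrow> 0) at_top"
proof -
  let ?g = "\<lambda>s. 1 / f s"
  have "((\<lambda>b. LINT x:{1..b}|lebesgue. ?g x) \<longlongrightarrow> (LINT x:{1..}|lebesgue. ?g x)) at_top"
    by (rule tendsto_set_lebesgue_integral_at_top[OF _ inv_f_abs_integrable]) auto
  moreover have "(LINT x:{1..}|lebesgue. ?g x) = F 1"
    unfolding Ffun_def by (rule set_lebesgue_integral_eq_integral(2)[OF inv_f_abs_integrable]) simp
  moreover have "\<forall>\<^sub>F b in at_top. (LINT x:{1..b}|lebesgue. ?g x) = F 1 - F b"
    using eventually_ge_at_top[of 1]
  proof eventually_elim
    case (elim b)
    have "set_integrable lebesgue {1..b} ?g"
      by (rule set_integrable_subset[OF inv_f_abs_integrable[of 1]]) auto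
    then have "(LINT x:{1..b}|lebesgue. ?g x) = integral {1..b} ?g"
      by (rule set_lebesgue_integral_eq_integral(2))
    then show ?case using F_split[of 1 b] elim by simp
  qed
  ultimately have "((\<lambda>b. F 1 - F b) \<longlongrightarrow> F 1) at_top"
    by (simp only: tendsto_cong)
  then have "((\<lambda>b. F 1 - (F 1 - F b)) \<longlongrightarrow> F 1 - F 1) at_top"
    by (intro tendsto_diff tendsto_const)
  then show ?thesis by simp
qed

definition F_inv :: "real \<Rightarrow> real" where "F_inv = inv_into {0<..} F"

lemma F_inv_F: "u > 0 \<Longrightarrow> F_inv (F u) = u"
  unfolding F_inv_def
  by (intro inv_into_f_f inj_onI) (auto simp: F_le_iff intro!: antisym simp flip: F_le_iff)

lemma
  assumes a: "0 < a" and y: "0 < y" "y \<le> F a"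
  shows F_F_inv: "F (F_inv y) = y" and F_inv_ge: "a \<le> F_inv y"
proof -
  have "\<forall>\<^sub>F u in at_top. F u < y \<and> a \<le> u"
    using order_tendstoD(2)[OF F_tendsto_0 y(1)] eventually_ge_at_top by (rule eventually_conj)
  then obtain b where b: "F b < y" "a \<le> b" by (auto simp: eventually_at_top_linorder)
  moreover have "continuous_on {a..b} F" by (rule continuous_on_subset[OF F_cont]) (use a in auto)
  ultimately obtain u where "u \<ge> a" "F u = y"
    using IVT2'[of F b y a] y by auto
  then show "F (F_inv y) = y" "a \<le> F_inv y" using F_inv_F[of u] a by auto
qed

lemma f_unbounded: assumes "w > 0" obtains v where "v \<ge> w" "f v \<ge> y"
proof (rule ccontr)
  assume "\<not> thesis"
  with that have lt: "f v < y" if "v \<ge> w" for v using that by (meson not_le)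
  have y: "y > 0" using lt[of w] f_pos[OF assms] by simp
  define v where "v = w + y * (F w + 1)"
  have v: "v \<ge> w" using y F_nonneg[OF assms] by (simp add: v_def)
  have "(v - w) / y \<le> (v - w) / f v"
    using lt[OF v] v f_pos[of v] assms by (intro divide_left_mono) auto
  also have "\<dots> \<le> F w - F v" using F_diff_ge[OF assms v] .
  also have "\<dots> \<le> F w" using F_nonneg[of v] v assms by simp
  finally show False using y by (simp add: v_def)
qed

lemma F_powr_has_derivative:
  assumes "u > 0"
  shows "((\<lambda>u. F u powr \<kappa>) has_real_derivative - (\<kappa> / (f u * F u powr (1 - \<kappa>)))) (at u)"
proof -
  have "((\<lambda>u. F u powr \<kappa>) has_real_derivative (\<kappa> * F u powr (\<kappa> - 1) * (- 1 / f u))) (at u)"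
    using DERIV_fun_powr[OF F_has_derivative[OF assms] F_pos[OF assms], of \<kappa>] by simp
  also have "\<kappa> * F u powr (\<kappa> - 1) * (- 1 / f u) = - (\<kappa> / (f u * F u powr (1 - \<kappa>)))"
    using powr_minus_divide[of "F u" "1 - \<kappa>"] by simp
  finally show ?thesis .
qed

lemma F_powr_above_tangent:
  assumes a: "a > 0" and antimono: "antimono_on {a<..} (\<lambda>u. \<kappa> / (f u * F u powr (1 - \<kappa>)))"
    and "x > a" "y > a"
  shows "F x powr \<kappa> - \<kappa> / (f x * F x powr (1 - \<kappa>)) * (y - x) \<le> F y powr \<kappa>"
proof -
  let ?d = "\<lambda>u. - (\<kappa> / (f u * F u powr (1 - \<kappa>)))"
  have deriv: "((\<lambda>u. F u powr \<kappa>) has_real_derivative ?d u) (at u)" if "u \<in> {a<..}" for u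
    using that a by (intro F_powr_has_derivative) auto
  have "convex_on {a<..} (\<lambda>u. F u powr \<kappa>)"
    using antimono by (intro convex_on_realI[where f'="?d"] deriv) (auto simp: monotone_on_def)
  then have "?d x * (y - x) \<le> F y powr \<kappa> - F x powr \<kappa>"
    using assms by (intro convex_on_imp_above_tangent has_field_derivative_at_within[OF deriv])
      (auto simp: interior_open)
  then show ?thesis by (simp add: algebra_simps)
qed

definition q :: real where "q = q_f f"

lemma q_tendsto: "((\<lambda>u. deriv f u * F u) \<longlongrightarrow> q) at_top"
proof -
  obtain q' where q': "((\<lambda>u. deriv f u * F u) \<longlongrightarrow> q') at_top" using L by (auto simp: hyp_L_def)
  then have "q = q'" unfolding q_def q_f_def by (intro tendsto_Lim) auto
  then show ?thesis using q' by simp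
qed

lemma fF_powr_has_derivative:
  assumes f': "(f has_real_derivative deriv f u) (at u)" and u: "u > 0"
  shows "((\<lambda>u. f u * F u powr k)
    has_real_derivative F u powr (k - 1) * (deriv f u * F u - k)) (at u)"
proof -
  have "F u powr k = F u powr (k - 1) * F u" using F_pos[OF u] by (simp add: powr_diff)
  moreover have "f u * (k / (f u * F u powr (1 - k))) = k * F u powr (k - 1)"
    using f_pos[OF u] powr_minus_divide[of "F u" "1 - k"] by simp
  ultimately have "deriv f u * F u powr k + - (k / (f u * F u powr (1 - k))) * f u
      = F u powr (k - 1) * (deriv f u * F u - k)"
    by (simp add: algebra_simps)
  then show ?thesis using DERIV_mult[OF f' F_powr_has_derivative[OF u, of k]] by simp
qed

lemma fF_powr_eventually_mono:
  assumes "k < q" obtains a where "a > 0" "mono_on {a..} (\<lambda>u. f u * F u powr k)"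
proof -
  have "\<forall>\<^sub>F u in at_top. (f has_real_derivative deriv f u) (at u) \<and> k < deriv f u * F u \<and> 0 < u"
    by (intro eventually_conj f_eventually_has_derivative order_tendstoD[OF q_tendsto] assms
        eventually_gt_at_top)
  then have "\<forall>\<^sub>F u in at_top. ((\<lambda>u. f u * F u powr k) has_real_derivative
      F u powr (k - 1) * (deriv f u * F u - k)) (at u) \<and>
      0 \<le> F u powr (k - 1) * (deriv f u * F u - k)"
    by eventually_elim (auto intro!: fF_powr_has_derivative)
  then show ?thesis by (rule eventually_mono_if_derivative_nonneg) (rule that)
qed

lemma fF_powr_eventually_antimono:
  assumes "k > q" obtains a where "a > 0" "antimono_on {a..} (\<lambda>u. f u * F u powr k)"
proof -
  have "\<forall>\<^sub>F u in at_top. (f has_real_derivative deriv f u) (at u) \<and> deriv f u * F u < k \<and> 0 < u"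
    by (intro eventually_conj f_eventually_has_derivative order_tendstoD[OF q_tendsto] assms
        eventually_gt_at_top)
  then have "\<forall>\<^sub>F u in at_top. ((\<lambda>u. - (f u * F u powr k)) has_real_derivative
      - (F u powr (k - 1) * (deriv f u * F u - k))) (at u) \<and>
      0 \<le> - (F u powr (k - 1) * (deriv f u * F u - k))"
    by eventually_elim (auto intro!: DERIV_minus fF_powr_has_derivative mult_nonneg_nonpos)
  then obtain a where "a > 0" "mono_on {a..} (\<lambda>u. - (f u * F u powr k))"
    by (rule eventually_mono_if_derivative_nonneg)
  then show ?thesis using that by (auto simp: monotone_on_def)
qed

lemma q_ge_1: "q \<ge> 1"
proof (rule ccontr)
  assume "\<not> q \<ge> 1"
  then obtain k where k: "q < k" "k < 1" using dense[of q 1] by auto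
  obtain a where a: "a > 0" "antimono_on {a..} (\<lambda>u. f u * F u powr k)"
    using fF_powr_eventually_antimono[OF k(1)] by blast
  define C where "C = f a * F a powr k"
  have C: "C > 0" using f_pos[OF a(1)] F_pos[OF a(1)] by (simp add: C_def)
  define b where "b = a + C * F a powr (1 - k) / (1 - k)"
  have b: "b > a" using F_pos[OF a(1)] C k a(1) by (simp add: b_def)
  have "F b powr (1 - k) + (1 - k) / C * b \<le> F a powr (1 - k) + (1 - k) / C * a"
  proof (rule DERIV_nonpos_imp_nonincreasing[OF less_imp_le[OF b],
        of "\<lambda>u. F u powr (1 - k) + (1 - k) / C * u"])
    fix u assume "a \<le> u"
    then have u: "u > 0" using a(1) by simp
    have "f u * F u powr k \<le> C" using a \<open>a \<le> u\<close> unfolding C_def by (auto simp: monotone_on_def)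
    then have "(1 - k) / C \<le> (1 - k) / (f u * F u powr k)"
      using C k f_pos[OF u] F_pos[OF u] by (intro divide_left_mono) auto
    moreover have "((\<lambda>u. F u powr (1 - k) + (1 - k) / C * u) has_real_derivative
        - ((1 - k) / (f u * F u powr k)) + (1 - k) / C * 1) (at u)"
      using F_powr_has_derivative[OF u, of "1 - k"]
      by (intro DERIV_add DERIV_cmult DERIV_ident) simp
    ultimately show "\<exists>y. ((\<lambda>u. F u powr (1 - k) + (1 - k) / C * u) has_real_derivative y) (at u)
        \<and> y \<le> 0"
      by (intro exI conjI) auto
  qed
  moreover have "(1 - k) / C * b = (1 - k) / C * a + F a powr (1 - k)"
    using C k by (simp add: b_def field_simps)
  moreover have "F b powr (1 - k) > 0" using F_pos[of b] a(1) b by simp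
  ultimately show False by linarith
qed

lemma supercritical_q:
  assumes "supercritical \<theta> f N" "\<theta> > 0" "N > 0" shows "q - 1 < real N / \<theta>"
proof (cases "q = 1")
  case False
  then have q1: "q > 1" using q_ge_1 by simp
  have "1 + \<theta> / real N < q / (q - 1)"
    using assms(1) False by (simp add: supercritical_def p_f_def q_def[symmetric])
  moreover have "q / (q - 1) = 1 + 1 / (q - 1)" using q1 by (simp add: field_simps)
  ultimately have "\<theta> / real N < 1 / (q - 1)" by simp
  then show ?thesis using q1 assms by (simp add: field_simps)
qed (use assms in simp)

end

section \<open>The semigroup and the Duhamel term\<close>

context fractional_heat
begin

definition heat :: "real \<Rightarrow> (real^'n \<Rightarrow> ennreal) \<Rightarrow> real^'n \<Rightarrow> ennreal" where
  "heat t v x = (\<integral>\<^sup>+y. ennreal (Gamma_frac \<theta> (x - y) t) * v y \<partial>lborel)"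

lemma heat_measurable_param[measurable (raw)]:
  assumes [measurable]: "t \<in> M \<rightarrow>\<^sub>M borel" "x \<in> M \<rightarrow>\<^sub>M borel"
      "(\<lambda>(m, y). v m y) \<in> borel_measurable (M \<Otimes>\<^sub>M borel)"
  shows "(\<lambda>m. heat (t m) (v m) (x m :: real^'n)) \<in> borel_measurable M"
  unfolding heat_def by measurable

lemma heat_measurable:
  assumes [measurable]: "v \<in> borel_measurable borel"
  shows "(\<lambda>z. heat (snd z) v (fst z :: real^'n)) \<in> borel_measurable borel"
  unfolding borel_prod[symmetric] by measurable

lemma heat_mono_AE: "(AE y in lborel. v y \<le> w y) \<Longrightarrow> heat t v x \<le> heat t w x"
  unfolding heat_def by (rule nn_integral_mono_AE)
    (erule AE_mp, rule AE_I2, auto intro: mult_left_mono)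

lemma heat_mono: "(\<And>y. v y \<le> w y) \<Longrightarrow> heat t v x \<le> heat t w x"
  by (rule heat_mono_AE) simp

lemma heat_cong_AE: "(AE y in lborel. v y = w y) \<Longrightarrow> heat t v x = heat t w x"
  unfolding heat_def by (intro nn_integral_cong_AE) auto

lemma heat_add:
  assumes [measurable]: "v \<in> borel_measurable borel" "w \<in> borel_measurable borel"
  shows "heat t (\<lambda>y. v y + w y) x = heat t v x + heat t w x"
  unfolding heat_def distrib_left by (rule nn_integral_add) measurable

lemma heat_cmult:
  assumes [measurable]: "v \<in> borel_measurable borel"
  shows "heat t (\<lambda>y. c * v y) x = c * heat t v x"
  unfolding heat_def mult.left_commute[of _ c] by (rule nn_integral_cmult) measurable

lemma heat_const: "t > 0 \<Longrightarrow> heat t (\<lambda>_. c) (x::real^'n) = c"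
  unfolding heat_def by (subst nn_integral_multc) (auto simp: nn_integral_Gamma_frac)

text \<open>Jensen's inequality comes down to this monotonicity, applied to a supporting line.\<close>

lemma heat_affine_le:
  fixes x :: "real^'n"
  assumes t: "t > 0" and [measurable]: "v \<in> borel_measurable borel" "w \<in> borel_measurable borel"
    and le: "AE y in lborel. a * v y + b \<le> c * w y + d"
  shows "a * heat t v x + b \<le> c * heat t w x + d"
proof -
  have affine: "heat t (\<lambda>y. c * v y + d) x = c * heat t v x + d"
    if [measurable]: "v \<in> borel_measurable borel" for c d v
    by (subst heat_add) (simp_all add: heat_cmult heat_const[OF t])
  show ?thesis using heat_mono_AE[OF le, of t x]
    by (simp only: affine[OF assms(2)] affine[OF assms(3)])
qed

lemma heat_nn_integral:
  fixes v :: "'b::euclidean_space \<Rightarrow> real^'n \<Rightarrow> ennreal"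
  assumes [measurable]: "(\<lambda>(s, y). v s y) \<in> borel_measurable (borel \<Otimes>\<^sub>M borel)"
  shows "heat t (\<lambda>y. \<integral>\<^sup>+s. v s y \<partial>lborel) x = (\<integral>\<^sup>+s. heat t (v s) x \<partial>lborel)"
proof -
  have "heat t (\<lambda>y. \<integral>\<^sup>+s. v s y \<partial>lborel) x
      = (\<integral>\<^sup>+y. (\<integral>\<^sup>+s. ennreal (Gamma_frac \<theta> (x - y) t) * v s y \<partial>lborel) \<partial>lborel)"
    unfolding heat_def by (intro nn_integral_cong nn_integral_cmult[symmetric]) measurable
  also have "\<dots> = (\<integral>\<^sup>+s. heat t (v s) x \<partial>lborel)"
    unfolding heat_def by (rule lborel_pair.Fubini'[symmetric]) measurable
  finally show ?thesis .
qed

lemma heat_semigroup: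
  fixes x :: "real^'n"
  assumes t: "t > 0" and s: "s > 0" and [measurable]: "v \<in> borel_measurable borel"
  shows "heat t (heat s v) x = heat (t + s) v x"
proof -
  have "heat t (heat s v) x = heat t (\<lambda>y. \<integral>\<^sup>+z. ennreal (Gamma_frac \<theta> (y - z) s) * v z \<partial>lborel) x"
    by (intro arg_cong[where f="\<lambda>w. heat t w x"] ext heat_def)
  also have "\<dots> = (\<integral>\<^sup>+z. heat t (\<lambda>y. ennreal (Gamma_frac \<theta> (y - z) s) * v z) x \<partial>lborel)"
    by (rule heat_nn_integral) measurable
  also have "\<dots> = (\<integral>\<^sup>+z.
      (\<integral>\<^sup>+y. ennreal (Gamma_frac \<theta> (x - y) t) * ennreal (Gamma_frac \<theta> (y - z) s) \<partial>lborel)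
          * v z \<partial>lborel)"
    unfolding heat_def mult.assoc[symmetric]
    by (intro nn_integral_cong nn_integral_multc) measurable
  also have "\<dots> = heat (t + s) v x"
    by (simp only: Gamma_frac_semigroup[OF t s] heat_def)
  finally show ?thesis .
qed

lemma heat_norm_powr_neg:
  assumes b: "0 < b" "b < real CARD('n)"
  obtains C where "C > 0" "\<And>t (x::real^'n). t > 0 \<Longrightarrow>
     heat t (\<lambda>y. ennreal (norm y powr (-b))) x \<le> ennreal (C * t powr (- b / \<theta>))"
proof -
  let ?N = "real CARD('n)" and ?V = "unit_ball_vol (real CARD('n))"
  obtain A where A: "A > 0" "\<And>t (x::real^'n). t > 0 \<Longrightarrow> Gamma_frac \<theta> x t \<le> A * t powr (- ?N / \<theta>)"
    using Gamma_frac_bounded[where 'n='n] by metis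
  let ?w = "\<lambda>s. min 1 (A * ?V * s powr ?N)"
  obtain I where I: "I > 0" and scaled: "\<And>c. c > 0 \<Longrightarrow>
      (\<integral>\<^sup>+s\<in>{0<..}. ennreal (?w (c * s) * s powr (-1-b)) \<partial>lborel) = ennreal (I * c powr b)"
    by (rule powr_weight_integral[of ?w b ?N "A * ?V" 1]) (use A b in auto)
  have "heat t (\<lambda>y. ennreal (norm y powr (-b))) x \<le> ennreal (b * I * t powr (- b / \<theta>))"
    if t: "t > 0" for t and x :: "real^'n"
  proof -
    let ?c = "t powr (- 1 / \<theta>)"
    have "heat t (\<lambda>y. ennreal (norm y powr (-b))) x
        \<le> ennreal b * (\<integral>\<^sup>+s\<in>{0<..}. ennreal (min 1 (A * t powr (- ?N / \<theta>) * ?V * s powr ?N)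
            * s powr (-1-b)) \<partial>lborel)"
      using nn_integral_norm_powr_neg_le[where p="\<lambda>y. ennreal (Gamma_frac \<theta> (x - y) t)" and a="A
          * t powr (- ?N / \<theta>)" and b=b]
        nn_integral_Gamma_frac[OF t, of x] A t b by (simp add: ennreal_leI heat_def)
    also have "(\<lambda>s. A * t powr (- ?N / \<theta>) * ?V * s powr ?N) = (\<lambda>s. A * ?V * (?c * s) powr ?N)"
      by (simp add: fun_eq_iff powr_mult powr_powr)
    also have "ennreal b * (\<integral>\<^sup>+s\<in>{0<..}. ennreal (?w (?c * s) * s powr (-1-b)) \<partial>lborel)
        = ennreal b * ennreal (I * ?c powr b)"
      using t by (subst scaled) auto
    also have "\<dots> = ennreal (b * I * t powr (- b / \<theta>))"
      using b I by (simp add: ennreal_mult'[symmetric] powr_powr)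
    finally show ?thesis .
  qed
  moreover have "b * I > 0" using b I by simp
  ultimately show ?thesis using that by blast
qed

lemma heat_norm_powr:
  assumes a: "0 < a" "a < \<theta>"
  obtains C where "C > 0" "\<And>t (x::real^'n). t > 0 \<Longrightarrow> norm x \<le> t powr (1/\<theta>) \<Longrightarrow>
     heat t (\<lambda>y. ennreal (norm y powr a)) x \<le> ennreal (C * t powr (a / \<theta>))"
proof -
  obtain C where C: "C > 0" "\<And>t. t > 0 \<Longrightarrow>
     (\<integral>\<^sup>+y. ennreal (Gamma_frac \<theta> (y::real^'n) t) * ennreal (norm y powr a) \<partial>lborel)
         \<le> ennreal (C * t powr (a / \<theta>))"
    using Gamma_frac_moment[OF a, where 'n='n] by blast
  have "heat t (\<lambda>y. ennreal (norm y powr a)) x \<le> ennreal (2 powr a * (C + 1) * t powr (a / \<theta>))"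
    if t: "t > 0" and x: "norm x \<le> t powr (1/\<theta>)" for t and x :: "real^'n"
  proof -
    have centered: "heat t (\<lambda>y. ennreal (norm (x - y) powr a)) x \<le> ennreal (C * t powr (a / \<theta>))"
      using C(2)[OF t] nn_integral_lborel_reflect
        [of "\<lambda>y. ennreal (Gamma_frac \<theta> y t) * ennreal (norm y powr a)" x]
      by (simp add: heat_def)
    have "norm x powr a \<le> (t powr (1/\<theta>)) powr a" using x a by (intro powr_mono2) auto
    then have xa: "norm x powr a \<le> t powr (a / \<theta>)" by (simp add: powr_powr)
    have "norm y powr a \<le> 2 powr a * norm (x - y) powr a + 2 powr a * t powr (a / \<theta>)" for y
      using norm_powr_le_two_powr[of a y x] a(1) mult_left_mono[OF xa powr_ge_zero[of 2 a]]
      unfolding distrib_left by linarith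
    then have "AE y in lborel. 1 * ennreal (norm y powr a) + 0
        \<le> ennreal (2 powr a) * ennreal (norm (x - y) powr a) + ennreal (2 powr a * t powr (a / \<theta>))"
      by (simp add: ennreal_mult[symmetric] ennreal_plus[symmetric] ennreal_leI del: ennreal_plus)
    then have "1 * heat t (\<lambda>y. ennreal (norm y powr a)) x + 0
        \<le> ennreal (2 powr a) * heat t (\<lambda>y. ennreal (norm (x - y) powr a)) x
            + ennreal (2 powr a * t powr (a / \<theta>))"
      by (intro heat_affine_le t) measurable
    also have "\<dots> \<le> ennreal (2 powr a) * ennreal (C * t powr (a / \<theta>))
        + ennreal (2 powr a * t powr (a / \<theta>))"
      by (intro add_right_mono mult_left_mono centered) simp
    also have "\<dots> = ennreal (2 powr a * (C + 1) * t powr (a / \<theta>))"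
      using C(1)
      by (simp add: ennreal_mult'[symmetric] ennreal_plus[symmetric] algebra_simps del: ennreal_plus)
    finally show ?thesis by simp
  qed
  moreover have "2 powr a * (C + 1) > 0" using C(1) by simp
  ultimately show ?thesis using that by blast
qed

definition duhamel :: "((real^'n) \<times> real \<Rightarrow> ennreal) \<Rightarrow> (real^'n) \<times> real \<Rightarrow> ennreal" where
  "duhamel v z = (\<integral>\<^sup>+s\<in>{0<..<snd z}. heat (snd z - s) (\<lambda>y. v (y, s)) (fst z) \<partial>lborel)"

lemma duhamel_measurable:
  fixes v :: "(real^'n) \<times> real \<Rightarrow> ennreal"
  assumes "v \<in> borel_measurable borel"
  shows "duhamel v \<in> borel_measurable borel"
proof -
  have [measurable]: "v \<in> borel_measurable (borel \<Otimes>\<^sub>M borel)" using assms by (simp add: borel_prod)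
  show ?thesis
    unfolding duhamel_def[abs_def] indicator_def greaterThanLessThan_iff borel_prod[symmetric]
    by measurable
qed

lemma duhamel_mono:
  assumes "\<And>y s. 0 < s \<Longrightarrow> s < snd z \<Longrightarrow> v (y, s) \<le> w (y, s)"
  shows "duhamel v z \<le> duhamel w z"
  unfolding duhamel_def using assms
  by (intro nn_integral_mono) (auto simp: indicator_def intro!: heat_mono)

lemma duhamel_mono_QT:
  assumes "z \<in> QT T" "\<And>w. w \<in> QT T \<Longrightarrow> v w \<le> v' w"
  shows "duhamel v z \<le> duhamel v' z"
  by (rule duhamel_mono) (use assms in \<open>auto simp: QT_def\<close>)

lemma duhamel_cong_AE:
  fixes v w :: "(real^'n) \<times> real \<Rightarrow> ennreal"
  assumes "AE z in lborel. z \<in> QT T \<longrightarrow> v z = w z" "z \<in> QT T"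
  shows "duhamel v z = duhamel w z"
  unfolding duhamel_def
proof (rule nn_integral_cong_AE, use AE_lborel_slices[OF assms(1)] in eventually_elim)
  case (elim s)
  show ?case
  proof (cases "0 < s \<and> s < snd z")
    case True
    then have "AE y in lborel. v (y, s) = w (y, s)"
      using elim assms(2) by (auto simp: QT_def elim!: eventually_mono)
    then show ?thesis by (simp add: heat_cong_AE)
  qed auto
qed

lemma duhamel_SUP:
  fixes v :: "nat \<Rightarrow> (real^'n) \<times> real \<Rightarrow> ennreal"
  assumes inc: "\<And>z. incseq (\<lambda>n. v n z)" and meas: "\<And>n. v n \<in> borel_measurable borel"
  shows "duhamel (\<lambda>z. SUP n. v n z) z = (SUP n. duhamel (v n) z)"
proof -
  have [measurable]: "v n \<in> borel_measurable (borel \<Otimes>\<^sub>M borel)" for n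
    using meas by (simp add: borel_prod)
  have heat_SUP: "heat t (\<lambda>y. SUP n. v n (y, s)) x = (SUP n. heat t (\<lambda>y. v n (y, s)) x)" for t s x
    unfolding heat_def SUP_mult_left_ennreal
    by (rule nn_integral_monotone_convergence_SUP)
       (use inc in \<open>auto simp: incseq_def le_fun_def intro!: mult_left_mono\<close>)
  have "incseq (\<lambda>n s. heat (snd z - s) (\<lambda>y. v n (y, s)) (fst z) * indicator {0<..<snd z} s)"
    using inc by (auto simp: incseq_def le_fun_def intro!: mult_right_mono heat_mono)
  then show ?thesis
    unfolding duhamel_def heat_SUP SUP_mult_right_ennreal
    by (rule nn_integral_monotone_convergence_SUP) measurable
qed

lemma duhamel_comp_SUP:
  fixes v :: "nat \<Rightarrow> (real^'n) \<times> real \<Rightarrow> ennreal"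
  assumes \<phi>: "sup_continuous \<phi>" and [measurable]: "\<phi> \<in> borel_measurable borel"
    and inc: "\<And>z. incseq (\<lambda>n. v n z)" and [measurable]: "\<And>n. v n \<in> borel_measurable borel"
  shows "duhamel (\<lambda>w. \<phi> (SUP n. v n w)) z = (SUP n. duhamel (\<lambda>w. \<phi> (v n w)) z)"
  unfolding sup_continuousD[OF \<phi> inc]
proof (rule duhamel_SUP)
  show "incseq (\<lambda>n. \<phi> (v n w))" for w
    using inc sup_continuous_mono[OF \<phi>] by (auto simp: incseq_def mono_def)
qed measurable

lemma duhamel_le_heat:
  fixes x :: "real^'n"
  assumes [measurable]: "A \<in> borel_measurable borel" "w \<in> borel_measurable borel"
    and le: "\<And>y s. 0 < s \<Longrightarrow> s < t \<Longrightarrow> v (y, s) \<le> A s * heat s w y"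
  shows "duhamel v (x, t) \<le> (\<integral>\<^sup>+s\<in>{0<..<t}. A s \<partial>lborel) * heat t w x"
proof -
  have "duhamel v (x, t) \<le> (\<integral>\<^sup>+s. A s * indicator {0<..<t} s * heat t w x \<partial>lborel)"
    unfolding duhamel_def fst_conv snd_conv
  proof (rule nn_integral_mono)
    fix s
    show "heat (t - s) (\<lambda>y. v (y, s)) x * indicator {0<..<t} s
        \<le> A s * indicator {0<..<t} s * heat t w x"
    proof (cases "0 < s \<and> s < t")
      case True
      then have "heat (t - s) (\<lambda>y. v (y, s)) x \<le> heat (t - s) (\<lambda>y. A s * heat s w y) x"
        using le by (intro heat_mono) auto
      also have "\<dots> = A s * heat (t - s) (heat s w) x" by (rule heat_cmult) measurable
      also have "heat (t - s) (heat s w) x = heat t w x" using True by (subst heat_semigroup) auto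
      finally show ?thesis using True by simp
    qed auto
  qed
  also have "\<dots> = (\<integral>\<^sup>+s\<in>{0<..<t}. A s \<partial>lborel) * heat t w x" by (rule nn_integral_multc) measurable
  finally show ?thesis .
qed

lemma heat_duhamel:
  fixes x :: "real^'n"
  assumes s: "0 < s" "s < t" and v: "v \<in> borel_measurable borel"
  shows "heat (t - s) (\<lambda>y. duhamel v (y, s)) x
      = (\<integral>\<^sup>+r\<in>{0<..<s}. heat (t - r) (\<lambda>y. v (y, r)) x \<partial>lborel)"
proof -
  have [measurable]: "v \<in> borel_measurable (borel \<Otimes>\<^sub>M borel)" using v by (simp add: borel_prod)
  have "heat (t - s) (\<lambda>y. duhamel v (y, s)) x
      = (\<integral>\<^sup>+r. heat (t - s) (\<lambda>y. heat (s - r) (\<lambda>y'. v (y', r)) y * indicator {0<..<s} r) x \<partial>lborel)"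
    unfolding duhamel_def fst_conv snd_conv indicator_def greaterThanLessThan_iff
    by (rule heat_nn_integral) measurable
  also have "\<dots> = (\<integral>\<^sup>+r\<in>{0<..<s}. heat (t - r) (\<lambda>y. v (y, r)) x \<partial>lborel)"
  proof (rule nn_integral_cong)
    fix r
    have "heat (t - s) (heat (s - r) (\<lambda>y'. v (y', r))) x = heat (t - r) (\<lambda>y. v (y, r)) x"
      if "0 < r" "r < s"
      using heat_semigroup[of "t - s" "s - r" "\<lambda>y'. v (y', r)" x] that s by simp
    then show "heat (t - s) (\<lambda>y. heat (s - r) (\<lambda>y'. v (y', r)) y * indicator {0<..<s} r) x
        = heat (t - r) (\<lambda>y. v (y, r)) x * indicator {0<..<s} r"
      by (subst mult.commute, subst heat_cmult) (auto simp: indicator_def)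
  qed
  finally show ?thesis .
qed

section \<open>Solutions\<close>

lemma QT_borel[measurable]: "QT T \<in> sets borel"
  unfolding QT_def by (intro borel_open open_Times) auto

definition mild_map ::
  "(real \<Rightarrow> real) \<Rightarrow> (real^'n \<Rightarrow> real) \<Rightarrow> ((real^'n) \<times> real \<Rightarrow> real) \<Rightarrow> (real^'n) \<times> real \<Rightarrow> ennreal" where
  "mild_map f \<mu> u z = heat (snd z) (\<lambda>y. ennreal (\<mu> y)) (fst z) + duhamel (\<lambda>w. ennreal (f (u w))) z"

lemma mild_map_cong_AE:
  fixes \<mu> \<mu>' :: "real^'n \<Rightarrow> real"
  assumes \<mu>: "AE x in lborel. \<mu> x = \<mu>' x" and u: "AE z in lborel. z \<in> QT T \<longrightarrow> u z = u' z"
    and z: "z \<in> QT T"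
  shows "mild_map f \<mu> u z = mild_map f \<mu>' u' z"
proof -
  have "AE x in lborel. ennreal (\<mu> x) = ennreal (\<mu>' x)"
    using \<mu> by (rule eventually_mono) simp
  moreover have "AE z in lborel. z \<in> QT T \<longrightarrow> ennreal (f (u z)) = ennreal (f (u' z))"
    using u by (rule eventually_mono) simp
  ultimately show ?thesis
    unfolding mild_map_def by (intro arg_cong2[where f="(+)"] heat_cong_AE duhamel_cong_AE[OF _ z])
qed

lemma is_solution_iff:
  fixes \<mu> :: "real^'n \<Rightarrow> real"
  shows "is_solution \<theta> f \<mu> T u \<longleftrightarrow>
     (\<forall>z\<in>QT T. u z \<ge> 0) \<and> u \<in> borel_measurable (lebesgue_on (QT T)) \<and>
     (AE z in lborel. z \<in> QT T \<longrightarrow> ennreal (u z) = mild_map f \<mu> u z)"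
proof -
  have heat_eq: "(\<integral>\<^sup>+y. ennreal (Gamma_frac \<theta> (x - y) t * g y) \<partial>lebesgue)
      = heat t (\<lambda>y. ennreal (g y)) x"
    if "t > 0" for t g and x :: "real^'n"
    unfolding heat_def nn_integral_completion
    by (intro nn_integral_cong ennreal_mult' Gamma_frac_nonneg that)
  have duhamel_eq: "(\<integral>\<^sup>+s. indicator {0<..<snd z} s *
                (\<integral>\<^sup>+y. ennreal (Gamma_frac \<theta> (fst z - y) (snd z - s)
                    * f (u (y, s))) \<partial>lebesgue) \<partial>lebesgue)
      = duhamel (\<lambda>w. ennreal (f (u w))) z" for z :: "(real^'n) \<times> real"
    unfolding duhamel_def nn_integral_completion[of _ "\<lambda>s. indicator {0<..<snd z} s * _ s"]
    by (intro nn_integral_cong) (auto simp: indicator_def heat_eq)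
  show ?thesis
    unfolding is_solution_def AE_completion_iff duhamel_eq mild_map_def
    by (intro conj_cong refl AE_cong) (auto simp: QT_def heat_eq)
qed

definition borel_solution ::
  "(real \<Rightarrow> real) \<Rightarrow> (real^'n \<Rightarrow> real) \<Rightarrow> real \<Rightarrow> ((real^'n) \<times> real \<Rightarrow> real) \<Rightarrow> bool" where
  "borel_solution f \<mu> T u \<longleftrightarrow> u \<in> borel_measurable borel \<and> (\<forall>z. u z \<ge> 0) \<and>
     (AE z in lborel. z \<in> QT T \<longrightarrow> ennreal (u z) = mild_map f \<mu> u z)"

lemma borel_solutionD:
  assumes "borel_solution f \<mu> T u"
  shows "u \<in> borel_measurable borel" "0 \<le> u z"
    "AE z in lborel. z \<in> QT T \<longrightarrow> ennreal (u z) = mild_map f \<mu> u z"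
  using assms unfolding borel_solution_def by blast+

lemma is_solution_if_borel_solution:
  fixes \<mu> :: "real^'n \<Rightarrow> real"
  assumes u: "borel_solution f \<mu>' T u" and \<mu>: "AE x in lborel. \<mu> x = \<mu>' x"
  shows "is_solution \<theta> f \<mu> T u"
proof -
  have "u \<in> borel_measurable lebesgue"
    using borel_solutionD(1)[OF u] by (simp add: measurable_completion)
  then have "u \<in> borel_measurable (lebesgue_on (QT T))" by (rule measurable_restrict_space1)
  then show ?thesis
    using borel_solutionD(2,3)[OF u] unfolding is_solution_iff
    by (simp add: mild_map_cong_AE[OF \<mu>, of T u u] cong: imp_cong)
qed

lemma borel_solution_if_is_solution:
  fixes \<mu> :: "real^'n \<Rightarrow> real"
  assumes sol: "is_solution \<theta> f \<mu> T u" and \<mu>: "AE x in lborel. \<mu> x = \<mu>' x"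
  obtains u' where "borel_solution f \<mu>' T u'"
proof -
  have nonneg: "\<And>z. z \<in> QT T \<Longrightarrow> u z \<ge> 0" and meas: "u \<in> borel_measurable (lebesgue_on (QT T))"
    and eq: "AE z in lborel. z \<in> QT T \<longrightarrow> ennreal (u z) = mild_map f \<mu> u z"
    using sol unfolding is_solution_iff by auto
  have "(\<lambda>z. if z \<in> QT T then u z else 0) \<in> borel_measurable lebesgue"
    by (rule borel_measurable_if_I[OF meas]) simp
  then obtain g where g: "g \<in> borel_measurable lborel"
      "AE z in lborel. (if z \<in> QT T then u z else 0) = g z"
    using completion_ex_borel_measurable_real by blast
  define u' where "u' z = max 0 (g z)" for z
  have u_eq: "AE z in lborel. z \<in> QT T \<longrightarrow> u z = u' z"
    using g(2)
  proof (rule eventually_mono)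
    fix z assume "(if z \<in> QT T then u z else 0) = g z"
    then show "z \<in> QT T \<longrightarrow> u z = u' z" using nonneg[of z] by (auto simp: u'_def)
  qed
  have "AE z in lborel. z \<in> QT T \<longrightarrow> ennreal (u' z) = mild_map f \<mu>' u' z"
    using eq u_eq by eventually_elim (use mild_map_cong_AE[OF \<mu> u_eq] in auto)
  then have "borel_solution f \<mu>' T u'" using g(1) by (auto simp: borel_solution_def u'_def[abs_def])
  then show ?thesis by (rule that)
qed

lemma duhamel_fixed_point_below:
  fixes v0 U :: "(real^'n) \<times> real \<Rightarrow> ennreal"
  assumes \<phi>: "sup_continuous \<phi>"
    and [measurable]: "\<phi> \<in> borel_measurable borel" "v0 \<in> borel_measurable borel"
    and super: "\<And>z. v0 z + duhamel (\<lambda>w. \<phi> (U w)) z \<le> U z"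
  obtains v where "v \<in> borel_measurable borel" "\<And>z. v z \<le> U z"
      "\<And>z. v z = v0 z + duhamel (\<lambda>w. \<phi> (v w)) z"
proof -
  define P where "P v = (\<lambda>z. v0 z + duhamel (\<lambda>w. \<phi> (v w)) z)" for v
  have P_mono: "mono P"
    using sup_continuous_mono[OF \<phi>]
    by (auto simp: mono_def le_fun_def P_def intro!: add_left_mono duhamel_mono)
  define v where "v n = (P ^^ n) bot" for n
  have v_Suc: "v (Suc n) = P (v n)" for n by (simp add: v_def)
  have meas[measurable]: "v n \<in> borel_measurable borel" for n
  proof (induction n)
    case (Suc n)
    note [measurable] = Suc duhamel_measurable
    show ?case unfolding v_Suc P_def by measurable
  qed (simp add: v_def bot_fun_def)
  have inc: "incseq (\<lambda>n. v n z)" for z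
    unfolding v_def by (intro monoI le_funD[OF monoD[OF mono_funpow[OF P_mono]]])
  have "P U \<le> U" using super by (simp add: P_def le_fun_def)
  then have le: "v n z \<le> U z" for n z
    unfolding v_def by (intro le_funD[OF Kleene_iter_lpfp[OF P_mono]])
  define v_sup where "v_sup z = (SUP n. v n z)" for z
  have "v_sup z = P v_sup z" for z
  proof -
    have "v_sup z = (SUP n. v (Suc n) z)"
      unfolding v_sup_def using incseq_SucD[OF inc] by (intro antisym SUP_mono) blast+
    also have "\<dots> = (SUP n. v0 z + duhamel (\<lambda>w. \<phi> (v n w)) z)" by (simp only: v_Suc P_def)
    also have "\<dots> = v0 z + (SUP n. duhamel (\<lambda>w. \<phi> (v n w)) z)"
      by (rule ennreal_SUP_add_right[symmetric]) simp
    also have "(SUP n. duhamel (\<lambda>w. \<phi> (v n w)) z) = duhamel (\<lambda>w. \<phi> (v_sup w)) z"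
      unfolding v_sup_def by (rule duhamel_comp_SUP[symmetric, OF \<phi> _ inc meas]) measurable
    finally show ?thesis by (simp only: P_def)
  qed
  moreover have "v_sup \<in> borel_measurable borel" unfolding v_sup_def by measurable
  moreover have "v_sup z \<le> U z" for z unfolding v_sup_def by (rule SUP_least) (rule le)
  ultimately show ?thesis unfolding P_def by (rule that[rotated 2]) 
qed

end

lemma measurable_comp_max_0:
  fixes f :: "real \<Rightarrow> real"
  assumes "continuous_on {0..} f" and [measurable]: "u \<in> borel_measurable M"
  shows "(\<lambda>z. f (max 0 (u z))) \<in> borel_measurable M"
proof -
  have "continuous_on UNIV (\<lambda>r. f (max 0 r))"
    by (rule continuous_on_compose2[OF assms(1)]) (auto intro!: continuous_intros)
  then have "(\<lambda>r. f (max 0 r)) \<in> borel_measurable borel" by (rule borel_measurable_continuous_onI)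
  then show ?thesis by (rule measurable_compose[OF assms(2)])
qed

lemma nonneg_loc_integrable_borel:
  assumes "nonneg_loc_integrable \<mu>"
  obtains \<mu>' where "\<mu>' \<in> borel_measurable borel" "\<And>x. \<mu>' x \<ge> 0"
      "AE x in lborel. \<mu> x = \<mu>' (x::real^'n)"
proof -
  have "(\<lambda>x. \<mu> x) \<in> borel_measurable lebesgue"
  proof (rule borel_measurable_LIMSEQ_real)
    show "(\<lambda>x. indicator (cball 0 (real n)) x *\<^sub>R \<mu> x) \<in> borel_measurable lebesgue" for n
      using assms unfolding nonneg_loc_integrable_def set_integrable_def
      by (intro borel_measurable_integrable) auto
    fix x :: "real^'n"
    have "eventually (\<lambda>n. real n \<ge> norm x) sequentially"
      using filterlim_real_sequentially by (auto simp: filterlim_at_top)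
    then have "eventually (\<lambda>n. indicator (cball 0 (real n)) x *\<^sub>R \<mu> x = \<mu> x) sequentially"
      by eventually_elim simp
    then show "(\<lambda>n. indicator (cball 0 (real n)) x *\<^sub>R \<mu> x) \<longlonglongrightarrow> \<mu> x" by (rule tendsto_eventually)
  qed
  then obtain g where g: "g \<in> borel_measurable lborel" "AE x in lborel. \<mu> x = g x"
    using completion_ex_borel_measurable_real[of \<mu> lborel] by auto
  show ?thesis
  proof (rule that[of "\<lambda>x. max 0 (g x)"])
    show "(\<lambda>x. max 0 (g x)) \<in> borel_measurable borel" using g(1) by simp
    have "\<mu> x \<ge> 0" for x using assms by (simp add: nonneg_loc_integrable_def)
    then have "\<mu> x = g x \<Longrightarrow> \<mu> x = max 0 (g x)" for x by (metis max_absorb2)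
    with g(2) show "AE x in lborel. \<mu> x = max 0 (g x)" by (auto elim: eventually_mono)
  qed auto
qed

locale semilinear_heat = fractional_heat \<theta> + admissible f for \<theta> f
begin

definition f_ext :: "ennreal \<Rightarrow> ennreal" where
  "f_ext v = (if v = top then top else ennreal (f (enn2real v)))"

lemma f_ext_ennreal: "r \<ge> 0 \<Longrightarrow> f_ext (ennreal r) = ennreal (f r)"
  by (simp add: f_ext_def)

lemma f_comp_measurable: "u \<in> borel_measurable M \<Longrightarrow> (\<And>z. 0 \<le> u z) \<Longrightarrow>
    (\<lambda>z. f (u z)) \<in> borel_measurable M"
  using measurable_comp_max_0[OF f_cont, of u M] by (simp add: max_absorb2)

lemma f_ext_measurable: "f_ext \<in> borel_measurable borel"
proof -
  have [measurable]: "(\<lambda>v. f (enn2real v)) \<in> borel_measurable borel"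
    by (rule f_comp_measurable) auto
  show ?thesis unfolding f_ext_def[abs_def] by measurable
qed

lemma f_ext_mono: "mono f_ext"
proof (rule monoI)
  fix v w :: ennreal assume "v \<le> w"
  then show "f_ext v \<le> f_ext w"
    by (cases v; cases w) (auto simp: f_ext_def top_unique intro!: ennreal_leI f_mono)
qed

lemma f_ext_sup_continuous: "sup_continuous f_ext"
  unfolding sup_continuous_def
proof (intro allI impI)
  fix M :: "nat \<Rightarrow> ennreal" assume M: "incseq M"
  let ?x = "SUP i. M i"
  show "f_ext ?x = (SUP i. f_ext (M i))"
  proof (cases "?x = top")
    case True
    have "(SUP i. f_ext (M i)) = top"
      unfolding SUP_eq_top_iff
    proof (intro allI impI)
      fix y :: ennreal assume "y < top"
      then obtain r where r: "y = ennreal r" "r \<ge> 0" by (cases y) auto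
      obtain b where b: "b \<ge> 1" "f b \<ge> r + 1" using f_unbounded[of 1] by auto
      have "ennreal b < ?x" unfolding True by simp
      then obtain i where "ennreal b < M i" by (auto simp: less_SUP_iff)
      then have "f_ext (ennreal b) \<le> f_ext (M i)" using f_ext_mono by (simp add: mono_def)
      moreover have "y < f_ext (ennreal b)" using b r by (simp add: f_ext_ennreal ennreal_less_iff)
      ultimately show "\<exists>i\<in>UNIV. y < f_ext (M i)" by (auto intro: less_le_trans)
    qed
    moreover have "f_ext top = top" by (simp add: f_ext_def)
    ultimately show ?thesis by (simp only: True)
  next
    case False
    then obtain r where r: "?x = ennreal r" "r \<ge> 0" by (cases ?x) auto
    have M_lim: "M \<longlonglongrightarrow> ennreal r" unfolding r(1)[symmetric] by (rule LIMSEQ_SUP[OF M])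
    have finite: "M i \<noteq> top" for i using False SUP_upper[of i UNIV M] by (metis UNIV_I top_unique)
    have "(\<lambda>i. f (enn2real (M i))) \<longlonglongrightarrow> f r"
      using tendsto_enn2real[OF M_lim r(2)] r(2)
      by (intro continuous_on_tendsto_compose[OF f_cont]) auto
    then have "(\<lambda>i. f_ext (M i)) \<longlonglongrightarrow> f_ext ?x"
      using finite r by (simp add: f_ext_def tendsto_ennrealI)
    moreover have "incseq (\<lambda>i. f_ext (M i))" using M f_ext_mono by (auto simp: incseq_def mono_def)
    then have "(\<lambda>i. f_ext (M i)) \<longlonglongrightarrow> (SUP i. f_ext (M i))" by (rule LIMSEQ_SUP)
    ultimately show ?thesis by (rule LIMSEQ_unique)
  qed
qed

lemma borel_solution_below_supersolution:
  fixes \<mu> :: "real^'n \<Rightarrow> real"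
  assumes \<mu>[measurable]: "\<mu> \<in> borel_measurable borel"
    and U_nonneg: "\<And>z. z \<in> QT T \<Longrightarrow> 0 \<le> U z"
    and super: "\<And>z. z \<in> QT T \<Longrightarrow> mild_map f \<mu> U z \<le> ennreal (U z)"
  obtains u where "borel_solution f \<mu> T u" "\<And>z. z \<in> QT T \<Longrightarrow> u z \<le> U z"
proof -
  define v0 where "v0 z = heat (snd z) (\<lambda>y. ennreal (\<mu> y)) (fst z)" for z :: "(real^'n) \<times> real"
  define V where "V z = (if z \<in> QT T then ennreal (U z) else \<infinity>)" for z
  have V_super: "v0 z + duhamel (\<lambda>w. f_ext (V w)) z \<le> V z" for z
  proof (cases "z \<in> QT T")
    case True
    have "duhamel (\<lambda>w. f_ext (V w)) z \<le> duhamel (\<lambda>w. ennreal (f (U w))) z"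
      using U_nonneg by (intro duhamel_mono_QT[OF True]) (simp add: V_def f_ext_ennreal)
    then have "v0 z + duhamel (\<lambda>w. f_ext (V w)) z \<le> v0 z + duhamel (\<lambda>w. ennreal (f (U w))) z"
      by (rule add_left_mono)
    also have "\<dots> \<le> V z" using super[OF True] True by (simp add: v0_def V_def mild_map_def)
    finally show ?thesis .
  qed (simp add: V_def)
  have v0_meas: "v0 \<in> borel_measurable borel"
    unfolding v0_def[abs_def] by (rule heat_measurable) measurable
  obtain v where v: "v \<in> borel_measurable borel" "\<And>z. v z \<le> V z"
      "\<And>z. v z = v0 z + duhamel (\<lambda>w. f_ext (v w)) z"
    using duhamel_fixed_point_below[OF f_ext_sup_continuous f_ext_measurable v0_meas V_super]
    by blast
  define u where "u z = enn2real (v z)" for z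
  have v_eq: "v z = ennreal (u z)" if "z \<in> QT T" for z
    using v(2)[of z] that
    by (auto simp: u_def V_def intro!: ennreal_enn2real[symmetric] intro: le_less_trans)
  have u_nonneg: "0 \<le> u z" for z by (simp add: u_def)
  have "ennreal (u z) = v0 z + duhamel (\<lambda>w. ennreal (f (u w))) z" if "z \<in> QT T" for z
  proof -
    have "duhamel (\<lambda>w. f_ext (v w)) z = duhamel (\<lambda>w. ennreal (f (u w))) z"
      by (intro antisym duhamel_mono_QT[OF that]) (simp_all add: v_eq f_ext_ennreal u_nonneg)
    then show ?thesis using v(3)[of z] v_eq[OF that] by simp
  qed
  then have "borel_solution f \<mu> T u"
    using v(1) by (simp add: borel_solution_def mild_map_def u_def[abs_def] v0_def)
  moreover have "u z \<le> U z" if "z \<in> QT T" for z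
    using v(2)[of z] U_nonneg[OF that] that by (simp add: v_eq V_def ennreal_le_iff)
  ultimately show ?thesis by (rule that)
qed

end

section \<open>Existence\<close>

text \<open>\<open>\<Phi>\<close> inverts \<open>G ^ k\<close> on \<open>[\<tau>, \<infinity>)\<close>, where \<open>G = 1 / F\<close> is the transform of the paper.\<close>

locale concave_profile = semilinear_heat \<theta> f for \<theta> f +
  fixes k k' a \<tau> :: real
  assumes k: "0 < k'" "k' < k" and a: "0 < a" "a < \<tau>"
    and fF_mono: "mono_on {a..} (\<lambda>u. f u * F u powr k)"
    and fF_antimono: "antimono_on {a..} (\<lambda>u. f u * F u powr (k' + 1))"
begin

abbreviation Gk :: "real \<Rightarrow> real" where "Gk u \<equiv> F u powr (- k)"

definition \<Phi> :: "real \<Rightarrow> real" where "\<Phi> z = F_inv (z powr (- 1 / k))"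

definition slope :: "real \<Rightarrow> real" where "slope u = f u * F u powr (k + 1) / k"

lemma k_pos: "k > 0" and tau_pos: "\<tau> > 0"
  using k a by auto

lemma Gk_pos: "u > 0 \<Longrightarrow> Gk u > 0"
  using F_pos[of u] by simp

lemma Gk_mono: "0 < u \<Longrightarrow> u \<le> v \<Longrightarrow> Gk u \<le> Gk v"
  using F_antimono[of u v] F_pos[of v] k_pos by (intro powr_mono2') auto

lemma Gk_measurable:
  assumes [measurable]: "\<mu> \<in> borel_measurable M"
  shows "(\<lambda>y. Gk (max \<tau> (\<mu> y))) \<in> borel_measurable M"
proof -
  have "continuous_on UNIV (\<lambda>r. F (max \<tau> r))"
    by (rule continuous_on_compose2[OF F_cont]) (use tau_pos in \<open>auto intro!: continuous_intros\<close>)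
  then have [measurable]: "(\<lambda>r. F (max \<tau> r)) \<in> borel_measurable borel"
    by (rule borel_measurable_continuous_onI)
  have "(\<lambda>y. F (max \<tau> (\<mu> y))) \<in> borel_measurable M" by measurable
  then show ?thesis by measurable
qed

lemma \<Phi>_Gk: "u > 0 \<Longrightarrow> \<Phi> (Gk u) = u"
  using F_inv_F[of u] F_pos[of u] k_pos by (simp add: \<Phi>_def powr_powr)

lemma
  assumes z: "Gk \<tau> \<le> z"
  shows F_\<Phi>: "F (\<Phi> z) = z powr (- 1 / k)" and \<Phi>_ge: "\<tau> \<le> \<Phi> z" and Gk_\<Phi>: "Gk (\<Phi> z) = z"
proof -
  have z_pos: "z > 0" using z Gk_pos[OF tau_pos] by linarith
  have "z powr (- 1 / k) \<le> Gk \<tau> powr (- 1 / k)"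
    using z Gk_pos[OF tau_pos] k_pos by (intro powr_mono2') auto
  also have "\<dots> = F \<tau>" using k_pos F_pos[OF tau_pos] by (simp add: powr_powr)
  finally have "0 < z powr (- 1 / k)" "z powr (- 1 / k) \<le> F \<tau>" using z_pos by auto
  then show F_eq: "F (\<Phi> z) = z powr (- 1 / k)" and "\<tau> \<le> \<Phi> z"
    using F_F_inv[OF tau_pos] F_inv_ge[OF tau_pos] by (simp_all add: \<Phi>_def)
  show "Gk (\<Phi> z) = z" unfolding F_eq using z_pos k_pos by (simp add: powr_powr)
qed

lemma \<Phi>_mono:
  assumes "Gk \<tau> \<le> z" "z \<le> z'" shows "\<Phi> z \<le> \<Phi> z'"
proof -
  have "z > 0" using assms(1) Gk_pos[OF tau_pos] by linarith
  then have "z powr (- 1 / k) \<ge> z' powr (- 1 / k)"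
    using assms(2) k_pos by (intro powr_mono2') auto
  then show ?thesis
    using F_le_iff[of "\<Phi> z" "\<Phi> z'"] F_\<Phi>[of z] F_\<Phi>[of z'] \<Phi>_ge[of z] \<Phi>_ge[of z'] assms tau_pos
    by simp
qed

lemma slope_nonneg: "u > 0 \<Longrightarrow> 0 \<le> slope u"
  using f_pos[of u] k_pos by (simp add: slope_def)

lemma slope_antimono:
  assumes "a \<le> u" "u \<le> v" shows "slope v \<le> slope u"
proof -
  have uv: "0 < u" "0 < v" using assms a by auto
  have split: "f w * F w powr (k + 1) = (f w * F w powr (k' + 1)) * F w powr (k - k')" for w
    by (simp add: mult.assoc powr_add[symmetric] add.commute)
  have "(f v * F v powr (k' + 1)) * F v powr (k - k')
      \<le> (f u * F u powr (k' + 1)) * F u powr (k - k')"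
  proof (rule mult_mono)
    show "f v * F v powr (k' + 1) \<le> f u * F u powr (k' + 1)"
      using fF_antimono assms by (auto simp: monotone_on_def)
    show "F v powr (k - k') \<le> F u powr (k - k')"
      using k assms F_antimono[OF uv(1)] F_nonneg[OF uv(2)] by (intro powr_mono2) auto
  qed (use f_pos[OF uv(1)] in auto)
  then show ?thesis unfolding slope_def split using k_pos by (simp add: divide_right_mono)
qed

lemma \<Phi>_below_tangent:
  assumes z: "Gk \<tau> \<le> z" "Gk \<tau> \<le> z0" shows "\<Phi> z \<le> \<Phi> z0 + slope (\<Phi> z0) * (z - z0)"
proof -
  have slope_pos: "slope u > 0" if "u > 0" for u
    using f_pos[OF that] F_pos[OF that] k_pos by (simp add: slope_def)
  have inverse_slope: "- k / (f u * F u powr (1 - - k)) = - (1 / slope u)" for u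
    by (simp add: slope_def add.commute)
  have "antimono_on {a<..} (\<lambda>u. - k / (f u * F u powr (1 - - k)))"
    unfolding inverse_slope
  proof (rule monotone_onI)
    fix u v assume "u \<in> {a<..}" "v \<in> {a<..}" "u \<le> v"
    then show "- (1 / slope u) \<ge> - (1 / slope v)"
      using slope_antimono[of u v] slope_pos[of u] slope_pos[of v] a
      by (auto intro!: divide_left_mono)
  qed
  then have "Gk (\<Phi> z0) - - (1 / slope (\<Phi> z0)) * (\<Phi> z - \<Phi> z0) \<le> Gk (\<Phi> z)"
    using F_powr_above_tangent[OF a(1), of "- k" "\<Phi> z0" "\<Phi> z"] \<Phi>_ge[OF z(1)] \<Phi>_ge[OF z(2)] a
    unfolding inverse_slope by simp
  then have "1 / slope (\<Phi> z0) * (\<Phi> z - \<Phi> z0) \<le> z - z0" by (simp add: Gk_\<Phi> z)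
  then show ?thesis using slope_pos[of "\<Phi> z0"] \<Phi>_ge[OF z(2)] tau_pos by (simp add: field_simps)
qed

lemma f_\<Phi>_le:
  assumes "Gk \<tau> \<le> z" "\<Phi> z \<le> v" shows "f (\<Phi> z) \<le> f v * F v powr k * z"
proof -
  have z: "z > 0" using assms(1) Gk_pos[OF tau_pos] by linarith
  have "F (\<Phi> z) powr k * Gk (\<Phi> z) = 1"
    using F_pos[of "\<Phi> z"] \<Phi>_ge[OF assms(1)] tau_pos by (simp add: powr_minus)
  then have "F (\<Phi> z) powr k * z = 1" by (simp only: Gk_\<Phi>[OF assms(1)])
  then have "f (\<Phi> z) = f (\<Phi> z) * F (\<Phi> z) powr k * z" by (simp only: mult.assoc mult_1_right)
  also have "\<dots> \<le> f v * F v powr k * z"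
    using fF_mono \<Phi>_ge[OF assms(1)] assms(2) a z by (intro mult_right_mono) (auto simp: mono_on_def)
  finally show ?thesis .
qed

definition rate :: real where "rate = 2 * k / (k - k')"

lemma rate_pos: "rate > 0"
  using k k_pos by (simp add: rate_def)

definition barrier :: "real \<Rightarrow> real" where "barrier t = F_inv (rate * t)"

end

locale small_data = concave_profile \<theta> f k k' a \<tau> for \<theta> f k k' a \<tau> +
  fixes \<mu> :: "real^'n \<Rightarrow> real" and T :: real
  assumes \<mu>_measurable[measurable]: "\<mu> \<in> borel_measurable borel"
    and heat_Gk_le: "\<And>t x. 0 < t \<Longrightarrow> t < T \<Longrightarrow>
      heat t (\<lambda>y. ennreal (Gk (max \<tau> (\<mu> y)))) x \<le> ennreal ((rate * t) powr (- k) / 2)"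
begin

definition w0 :: "real^'n \<Rightarrow> ennreal" where "w0 y = ennreal (Gk (max \<tau> (\<mu> y)))"

definition h :: "real \<Rightarrow> real^'n \<Rightarrow> real" where "h t x = enn2real (heat t w0 x)"

lemma h_nonneg: "0 \<le> h t x"
  by (simp add: h_def)

definition U :: "(real^'n) \<times> real \<Rightarrow> real" where "U z = \<Phi> (2 * h (snd z) (fst z))"

lemma w0_measurable[measurable]: "w0 \<in> borel_measurable borel"
  unfolding w0_def[abs_def] using Gk_measurable[OF \<mu>_measurable] by measurable

context
  fixes t :: real
  assumes t: "0 < t" "t < T"
begin

lemma heat_w0_eq: "heat t w0 x = ennreal (h t x)"
proof -
  have "heat t w0 x < top"
    unfolding w0_def[abs_def] by (rule le_less_trans[OF heat_Gk_le[OF t]]) simp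
  then show ?thesis by (simp add: h_def)
qed

lemma h_ge: "Gk \<tau> \<le> h t x"
proof -
  have "ennreal (Gk \<tau>) = heat t (\<lambda>_. ennreal (Gk \<tau>)) x" by (rule heat_const[OF t(1), symmetric])
  also have "\<dots> \<le> heat t w0 x"
    unfolding w0_def[abs_def] by (intro heat_mono ennreal_leI Gk_mono tau_pos) simp
  finally show ?thesis by (simp add: heat_w0_eq h_nonneg)
qed

lemma h_pos: "0 < h t x"
  using h_ge[of x] Gk_pos[OF tau_pos] by linarith

lemma two_h_ge: "Gk \<tau> \<le> 2 * h t x"
  using h_ge[of x] h_pos[of x] by linarith

lemma two_h_le: "2 * h t x \<le> (rate * t) powr (- k)"
proof -
  have "ennreal (h t x) \<le> ennreal ((rate * t) powr (- k) / 2)"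
    using heat_Gk_le[OF t, of x] by (simp only: heat_w0_eq[symmetric] w0_def[abs_def])
  then show ?thesis by simp
qed

lemma barrier_eq: "barrier t = \<Phi> ((rate * t) powr (- k))"
  using t rate_pos k_pos by (simp add: barrier_def \<Phi>_def powr_powr)

lemma barrier_ge: "\<tau> \<le> barrier t" and F_barrier: "F (barrier t) = rate * t"
proof -
  have "Gk \<tau> \<le> (rate * t) powr (- k)" using order_trans[OF two_h_ge two_h_le] .
  then show "\<tau> \<le> barrier t" "F (barrier t) = rate * t"
    using \<Phi>_ge F_\<Phi> t rate_pos k_pos by (simp_all add: barrier_eq powr_powr)
qed

lemma U_ge: "\<tau> \<le> U (x, t)" and U_le_barrier: "U (x, t) \<le> barrier t"
  unfolding barrier_eq using \<Phi>_ge \<Phi>_mono two_h_ge two_h_le by (simp_all add: U_def)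

lemma heat_le_\<Phi>: "heat t (\<lambda>y. ennreal (\<mu> y)) x \<le> ennreal (\<Phi> (h t x))"
proof -
  define c where "c = slope (\<Phi> (h t x))"
  have \<Phi>_pos: "\<Phi> (h t x) > 0" using \<Phi>_ge[OF h_ge] tau_pos by (rule less_le_trans[rotated])
  have c: "c \<ge> 0" unfolding c_def by (rule slope_nonneg[OF \<Phi>_pos])
  have "1 * ennreal (\<mu> y) + ennreal (c * h t x) \<le> ennreal c * w0 y + ennreal (\<Phi> (h t x))" for y
  proof -
    let ?m = "max \<tau> (\<mu> y)"
    have "Gk \<tau> \<le> Gk ?m" by (rule Gk_mono[OF tau_pos]) simp
    then have "\<Phi> (Gk ?m) \<le> \<Phi> (h t x) + c * (Gk ?m - h t x)"
      unfolding c_def by (rule \<Phi>_below_tangent[OF _ h_ge])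
    moreover have "\<Phi> (Gk ?m) = ?m" using tau_pos by (intro \<Phi>_Gk) simp
    ultimately have "max 0 (\<mu> y) + c * h t x \<le> c * Gk ?m + \<Phi> (h t x)"
      using tau_pos by (simp add: right_diff_distrib max_def split: if_splits)
    then have "ennreal (max 0 (\<mu> y) + c * h t x) \<le> ennreal (c * Gk ?m + \<Phi> (h t x))"
      by (rule ennreal_leI)
    moreover have "ennreal (max 0 (\<mu> y)) = ennreal (\<mu> y)" by (simp add: max_def ennreal_neg)
    ultimately show ?thesis
      using c h_pos[of x] \<Phi>_pos by (simp add: ennreal_mult w0_def)
  qed
  then have "1 * heat t (\<lambda>y. ennreal (\<mu> y)) x + ennreal (c * h t x)
      \<le> ennreal c * heat t w0 x + ennreal (\<Phi> (h t x))"
    by (intro heat_affine_le t) auto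
  then have "ennreal (c * h t x) + heat t (\<lambda>y. ennreal (\<mu> y)) x
      \<le> ennreal (c * h t x) + ennreal (\<Phi> (h t x))"
    using c h_pos[of x] by (simp add: heat_w0_eq ennreal_mult add.commute)
  then show ?thesis unfolding ennreal_add_left_cancel_le by simp
qed

lemma f_U_le: "f (U (x, t)) \<le> 2 * (f (barrier t) * F (barrier t) powr k) * h t x"
  using f_\<Phi>_le[OF two_h_ge, of x "barrier t"] U_le_barrier[of x] by (simp add: U_def mult_ac)

end

lemma barrier_antimono:
  assumes "0 < s" "s \<le> t" "t < T" shows "barrier t \<le> barrier s"
proof -
  have "F (barrier s) \<le> F (barrier t)" using assms rate_pos by (simp add: F_barrier)
  then show ?thesis using assms tau_pos barrier_ge[of s] barrier_ge[of t]
    by (subst (asm) F_le_iff) auto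
qed

lemma fF_barrier_le:
  assumes "0 < s" "s \<le> t" "t < T"
  shows "f (barrier s) * F (barrier s) powr k
    \<le> f (barrier t) * F (barrier t) powr (k' + 1) * (rate * s) powr (k - k' - 1)"
proof -
  have "F (barrier s) powr k = F (barrier s) powr (k' + 1) * (rate * s) powr (k - k' - 1)"
    using assms by (simp add: F_barrier powr_add[symmetric])
  moreover have "f (barrier s) * F (barrier s) powr (k' + 1)
      \<le> f (barrier t) * F (barrier t) powr (k' + 1)"
    using fF_antimono barrier_antimono[OF assms] barrier_ge[of t] assms a
    by (auto simp: monotone_on_def)
  ultimately show ?thesis by (simp add: mult.assoc[symmetric] mult_right_mono)
qed

lemma slope_barrier_eq:
  fixes t p :: real
  assumes t: "0 < t" "t < T"
  defines "p \<equiv> k - k'"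
  shows "slope (barrier t)
    = 2 * (f (barrier t) * F (barrier t) powr (k' + 1)) * rate powr (p - 1) * (t powr p / p)" (is "_
        = ?K * _ * _")
proof -
  have rate_powr: "rate powr (p - 1) * t powr p = F (barrier t) powr p / rate"
    using rate_pos t by (simp add: F_barrier powr_mult powr_diff)
  have "?K * rate powr (p - 1) * (t powr p / p) = ?K * (rate powr (p - 1) * t powr p) / p" by simp
  also have "\<dots> = ?K * F (barrier t) powr p / (rate * p)" unfolding rate_powr by simp
  also have "\<dots> = f (barrier t) * (F (barrier t) powr (k' + 1) * F (barrier t) powr p) / k"
    using k by (simp add: rate_def p_def)
  also have "F (barrier t) powr (k' + 1) * F (barrier t) powr p = F (barrier t) powr (k + 1)"
    by (simp add: powr_add[symmetric] add.commute p_def)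
  finally show ?thesis by (simp only: slope_def)
qed

lemma duhamel_U_le:
  assumes t: "0 < t" "t < T"
  shows "duhamel (\<lambda>w. ennreal (f (U w))) (x, t) \<le> ennreal (slope (barrier t) * h t x)"
proof -
  let ?p = "k - k'" and ?K = "2 * (f (barrier t) * F (barrier t) powr (k' + 1))"
  define A where "A s = ?K * (rate * s) powr (?p - 1)" for s
  have b_pos: "barrier t > 0" using barrier_ge[OF t] tau_pos by linarith
  have K: "?K \<ge> 0" using f_pos[OF b_pos] by simp
  have "ennreal (f (U (y, s))) \<le> ennreal (A s) * heat s w0 y" if s: "0 < s" "s < t" for s y
  proof -
    have sT: "s < T" using s t by simp
    have "f (U (y, s)) \<le> 2 * (f (barrier s) * F (barrier s) powr k) * h s y"
      by (rule f_U_le[OF s(1) sT])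
    also have "\<dots> \<le> A s * h s y"
      using fF_barrier_le[of s t] s t h_pos[OF s(1) sT, of y]
      by (intro mult_right_mono) (auto simp: A_def)
    finally show ?thesis
      using K by (simp add: heat_w0_eq[OF s(1) sT] ennreal_mult'[symmetric] A_def ennreal_leI)
  qed
  then have "duhamel (\<lambda>w. ennreal (f (U w))) (x, t)
      \<le> (\<integral>\<^sup>+s\<in>{0<..<t}. ennreal (A s) \<partial>lborel) * heat t w0 x"
    by (intro duhamel_le_heat) (auto simp: A_def[abs_def])
  also have "(\<integral>\<^sup>+s\<in>{0<..<t}. ennreal (A s) \<partial>lborel)
      \<le> (\<integral>\<^sup>+s. ennreal (?K * rate powr (?p - 1))
          * (ennreal (s powr (?p - 1)) * indicator {0..t} s) \<partial>lborel)"
    using K rate_pos by (intro nn_integral_mono)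
      (auto simp: A_def powr_mult ennreal_mult''[symmetric] indicator_def mult.assoc)
  also have "\<dots> = ennreal (?K * rate powr (?p - 1))
      * (\<integral>\<^sup>+s\<in>{0..t}. ennreal (s powr (?p - 1)) \<partial>lborel)"
    by (rule nn_integral_cmult) measurable
  also have "\<dots> = ennreal (?K * rate powr (?p - 1) * (t powr ?p / ?p))"
    using k t K by (subst nn_integral_powr_near_0) (auto simp: ennreal_mult'[symmetric])
  also have "?K * rate powr (?p - 1) * (t powr ?p / ?p) = slope (barrier t)"
    by (rule slope_barrier_eq[OF t, symmetric])
  finally show ?thesis
    using slope_nonneg[OF b_pos] by (simp add: heat_w0_eq[OF t] ennreal_mult' mult_right_mono)
qed

lemma supersolution:
  assumes z: "z \<in> QT T"
  shows "mild_map f \<mu> U z \<le> ennreal (U z)"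
proof -
  obtain x t where zxt: "z = (x, t)" and t: "0 < t" "t < T" using z by (cases z) (auto simp: QT_def)
  have "\<Phi> (h t x) \<le> U z + slope (U z) * (h t x - 2 * h t x)"
    unfolding U_def zxt fst_conv snd_conv by (rule \<Phi>_below_tangent[OF h_ge[OF t] two_h_ge[OF t]])
  moreover have "slope (barrier t) * h t x \<le> slope (U z) * h t x"
    using slope_antimono[of "U z" "barrier t"] U_le_barrier[OF t, of x] U_ge[OF t, of x]
      h_pos[OF t, of x] a
    by (intro mult_right_mono) (auto simp: zxt)
  ultimately have "\<Phi> (h t x) + slope (barrier t) * h t x \<le> U z" by (simp add: algebra_simps)
  moreover have "0 \<le> \<Phi> (h t x)" using \<Phi>_ge[OF h_ge[OF t], of x] tau_pos by simp
  moreover have "0 \<le> slope (barrier t) * h t x"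
    using barrier_ge[OF t] tau_pos h_pos[OF t, of x] by (intro mult_nonneg_nonneg slope_nonneg) auto
  ultimately have "ennreal (\<Phi> (h t x)) + ennreal (slope (barrier t) * h t x) \<le> ennreal (U z)"
    by (simp add: ennreal_plus[symmetric] ennreal_leI del: ennreal_plus)
  then show ?thesis
    using add_mono[OF heat_le_\<Phi>[OF t, of x] duhamel_U_le[OF t, of x]]
    by (simp add: zxt mild_map_def)
qed

lemma bounded_solution_exists: "\<exists>u. borel_solution f \<mu> T u \<and> Linf_loc_time T u"
proof -
  have U_pos: "0 \<le> U z" if "z \<in> QT T" for z
    using that U_ge[of "snd z" "fst z"] tau_pos
    by (cases z) (auto simp: QT_def intro: order_trans[rotated])
  obtain u where u: "borel_solution f \<mu> T u" and u_le: "\<And>z. z \<in> QT T \<Longrightarrow> u z \<le> U z"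
    using borel_solution_below_supersolution[OF \<mu>_measurable U_pos supersolution] by blast
  have "Linf_loc_time T u"
    unfolding Linf_loc_time_def
  proof (intro allI impI)
    fix b c :: real assume bc: "0 < b \<and> b \<le> c \<and> c < T"
    have "\<bar>u z\<bar> \<le> barrier b" if "snd z \<in> {b..c}" for z
    proof -
      obtain x t where z: "z = (x, t)" by (cases z)
      have t: "b \<le> t" "0 < t" "t < T" using that bc z by auto
      have "u z \<le> U (x, t)" using u_le[of z] t by (simp add: z QT_def)
      also have "\<dots> \<le> barrier t" by (rule U_le_barrier[OF t(2,3)])
      also have "\<dots> \<le> barrier b" using t bc by (intro barrier_antimono) auto
      finally show ?thesis using borel_solutionD(2)[OF u, of z] by simp
    qed
    then show "\<exists>C. AE z in lebesgue. snd z \<in> {b..c} \<longrightarrow> \<bar>u z\<bar> \<le> C"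
      by (intro exI[of _ "barrier b"] AE_I2) auto
  qed
  with u show ?thesis by blast
qed

end

context concave_profile
begin

lemma Gk_le_if_Gfun_le:
  assumes "\<epsilon> > 0" and small: "norm y < r \<Longrightarrow> Gfun f m \<le> \<epsilon> * norm y powr (- \<theta>)"
    and bounded: "\<not> norm y < r \<Longrightarrow> m \<le> B"
  shows "Gk (max \<tau> m) \<le> \<epsilon> powr k * norm y powr (- (k * \<theta>)) + Gk (max \<tau> B)"
proof (cases "m \<le> max \<tau> B")
  case True
  then have "Gk (max \<tau> m) \<le> Gk (max \<tau> B)" using tau_pos by (intro Gk_mono) auto
  then show ?thesis by (simp add: add_increasing)
next
  case False
  then have m: "m > \<tau>" "m > 0" using tau_pos by auto
  have "norm y < r" using False bounded by (cases "norm y < r") auto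
  with m have "1 / F m \<le> \<epsilon> * norm y powr (- \<theta>)" using small by (simp add: Gfun_def)
  then have "(1 / F m) powr k \<le> (\<epsilon> * norm y powr (- \<theta>)) powr k"
    using F_pos[OF m(2)] k_pos by (intro powr_mono2) auto
  also have "\<dots> = \<epsilon> powr k * norm y powr (- (k * \<theta>))" by (simp add: powr_mult powr_powr mult.commute)
  also have "(1 / F m) powr k = Gk (max \<tau> m)"
    using m F_pos[OF m(2)] by (simp add: powr_divide powr_minus_divide max_absorb2)
  finally show ?thesis by (simp add: add_increasing2)
qed

lemma heat_Gk_le_if_small:
  fixes \<mu> :: "real^'n \<Rightarrow> real" and x :: "real^'n"
  assumes C: "C > 0" "heat t (\<lambda>y. ennreal (norm y powr (- (k * \<theta>)))) x \<le> ennreal (C * t powr (- k))"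
  defines "\<epsilon> \<equiv> (4 * C) powr (- 1 / k) / rate"
  assumes \<mu>: "\<mu> \<in> borel_measurable borel"
    and small: "AE y in lborel. norm y < r \<longrightarrow> Gfun f (\<mu> y) \<le> \<epsilon> * norm y powr (- \<theta>)"
    and bounded: "AE y in lborel. \<not> norm y < r \<longrightarrow> \<mu> y \<le> B"
    and t: "0 < t" "Gk (max \<tau> B) \<le> (rate * t) powr (- k) / 4"
  shows "heat t (\<lambda>y. ennreal (Gk (max \<tau> (\<mu> y)))) x \<le> ennreal ((rate * t) powr (- k) / 2)"
proof -
  let ?K = "Gk (max \<tau> B)" and ?p = "\<lambda>y::real^'n. ennreal (norm y powr (- (k * \<theta>)))"
  have \<epsilon>: "\<epsilon> > 0" using C(1) rate_pos by (simp add: \<epsilon>_def)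
  have "\<epsilon> powr k = (4 * C) powr (- 1) / rate powr k"
    using C(1) k_pos by (simp add: \<epsilon>_def powr_divide powr_powr)
  then have \<epsilon>_k: "\<epsilon> powr k * C = rate powr (- k) / 4" using C(1) by (simp add: powr_minus_divide)
  note [measurable] = Gk_measurable[OF \<mu>]
  have "AE y in lborel. 1 * ennreal (Gk (max \<tau> (\<mu> y))) + 0 \<le> ennreal (\<epsilon> powr k) * ?p y + ennreal ?K"
    using small bounded
  proof eventually_elim
    case (elim y)
    from Gk_le_if_Gfun_le[OF \<epsilon>, of y r "\<mu> y" B] elim
    have "Gk (max \<tau> (\<mu> y)) \<le> \<epsilon> powr k * norm y powr (- (k * \<theta>)) + ?K" by blast
    then show ?case by (simp
        add: ennreal_mult[symmetric] ennreal_plus[symmetric] ennreal_leI del: ennreal_plus)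
  qed
  then have "1 * heat t (\<lambda>y. ennreal (Gk (max \<tau> (\<mu> y)))) x + 0
      \<le> ennreal (\<epsilon> powr k) * heat t ?p x + ennreal ?K"
    by (intro heat_affine_le t) measurable
  also have "\<dots> \<le> ennreal (\<epsilon> powr k) * ennreal (C * t powr (- k))
      + ennreal ((rate * t) powr (- k) / 4)"
    by (intro add_mono mult_left_mono C(2) ennreal_leI t) simp
  also have "ennreal (\<epsilon> powr k) * ennreal (C * t powr (- k)) = ennreal ((rate * t) powr (- k) / 4)"
    using C(1) \<epsilon>_k by (simp add: ennreal_mult'[symmetric] mult.assoc[symmetric] powr_mult)
  also have "\<dots> + \<dots> = ennreal ((rate * t) powr (- k) / 2)"
    by (simp add: ennreal_plus[symmetric] del: ennreal_plus)
  finally show ?thesis by simp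
qed

lemma bounded_solution_if_small:
  fixes \<mu> :: "real^'n \<Rightarrow> real"
  assumes C: "C > 0" "\<And>t (x::real^'n). t > 0 \<Longrightarrow>
      heat t (\<lambda>y. ennreal (norm y powr (- (k * \<theta>)))) x \<le> ennreal (C * t powr (- k))"
    and \<mu>: "\<mu> \<in> borel_measurable borel"
    and small: "AE y in lborel. norm y < r \<longrightarrow>
        Gfun f (\<mu> y) \<le> (4 * C) powr (- 1 / k) / rate * norm y powr (- \<theta>)"
    and bounded: "AE y in lborel. \<not> norm y < r \<longrightarrow> \<mu> y \<le> B"
  shows "\<exists>T>0. \<exists>u. borel_solution f \<mu> T u \<and> Linf_loc_time T u"
proof -
  let ?K = "Gk (max \<tau> B)"
  have K: "?K > 0" using tau_pos by (intro Gk_pos) auto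
  define T where "T = (4 * ?K) powr (- 1 / k) / rate"
  have T: "T > 0" using K rate_pos by (simp add: T_def)
  have T_eq: "4 * ?K = (rate * T) powr (- k)" using K k_pos rate_pos by (simp add: T_def powr_powr)
  have K_le: "?K \<le> (rate * t) powr (- k) / 4" if "0 < t" "t < T" for t
  proof -
    have "(rate * T) powr (- k) \<le> (rate * t) powr (- k)"
      using that rate_pos k_pos by (intro powr_mono2') auto
    then show ?thesis using T_eq by simp
  qed
  interpret small_data \<theta> f k k' a \<tau> \<mu> T
    by unfold_locales (use \<mu> K_le heat_Gk_le_if_small[OF C(1) C(2) \<mu> small bounded] in auto)
  show ?thesis using T bounded_solution_exists by blast
qed

end

context semilinear_heat
begin

lemma concave_profile_exists:
  assumes "0 < k'" "q - 1 < k'" "k' < k" "k < q"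
  obtains a \<tau> where "concave_profile \<theta> f k k' a \<tau>"
proof -
  obtain a where a: "a > 0" "mono_on {a..} (\<lambda>u. f u * F u powr k)"
    using fF_powr_eventually_mono[OF assms(4)] by blast
  obtain a' where a': "a' > 0" "antimono_on {a'..} (\<lambda>u. f u * F u powr (k' + 1))"
    using fF_powr_eventually_antimono[of "k' + 1"] assms by auto
  have "concave_profile \<theta> f k k' (max a a') (max a a' + 1)"
  proof unfold_locales
    show "mono_on {max a a'..} (\<lambda>u. f u * F u powr k)" by (rule mono_on_subset[OF a(2)]) auto
    show "antimono_on {max a a'..} (\<lambda>u. f u * F u powr (k' + 1))"
      by (rule monotone_on_subset[OF a'(2)]) auto
  qed (use assms a a' in auto)
  then show ?thesis by (rule that)
qed

lemma locally_solvable_if_small: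
  assumes super: "supercritical \<theta> f CARD('n)"
  shows "\<exists>\<epsilon>>0. \<forall>\<mu> :: real^'n \<Rightarrow> real. nonneg_loc_integrable \<mu> \<and> in_B \<mu> \<and>
     (\<exists>r>0. AE x in lebesgue. x \<in> ball 0 r \<longrightarrow> Gfun f (\<mu> x) \<le> \<epsilon> * norm x powr (- \<theta>))
       \<longrightarrow> locally_solvable \<theta> f \<mu> \<and> (\<exists>T>0. \<exists>u. is_solution \<theta> f \<mu> T u \<and> Linf_loc_time T u)"
proof -
  have "q - 1 < min q (real CARD('n) / \<theta>)" using supercritical_q[OF super theta(1)] by simp
  then obtain k where k: "q - 1 < k" "k < min q (real CARD('n) / \<theta>)" using dense by blast
  then obtain k' where k': "q - 1 < k'" "k' < k" using dense by blast
  have k_pos: "0 < k'" "0 < k" using k' q_ge_1 by auto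
  have "k < q" "k * \<theta> < real CARD('n)" "0 < k * \<theta>" using k k_pos theta by (auto simp: field_simps)
  obtain a \<tau> where "concave_profile \<theta> f k k' a \<tau>"
    using concave_profile_exists[OF k_pos(1) k' \<open>k < q\<close>] .
  then interpret concave_profile \<theta> f k k' a \<tau> .
  obtain C where C: "C > 0" "\<And>t (x::real^'n). t > 0 \<Longrightarrow>
      heat t (\<lambda>y. ennreal (norm y powr (- (k * \<theta>)))) x \<le> ennreal (C * t powr (- (k * \<theta>) / \<theta>))"
    using heat_norm_powr_neg[OF \<open>0 < k * \<theta>\<close> \<open>k * \<theta> < real CARD('n)\<close>] by blast
  define \<epsilon> where "\<epsilon> = (4 * C) powr (- 1 / k) / rate"
  have "\<epsilon> > 0" using C(1) rate_pos by (simp add: \<epsilon>_def)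
  moreover have "locally_solvable \<theta> f \<mu> \<and> (\<exists>T>0. \<exists>u. is_solution \<theta> f \<mu> T u \<and> Linf_loc_time T u)"
    if \<mu>: "nonneg_loc_integrable \<mu>" "in_B \<mu>" and r: "r > 0"
      and small: "AE x in lebesgue. x \<in> ball 0 r \<longrightarrow> Gfun f (\<mu> x) \<le> \<epsilon> * norm x powr (- \<theta>)"
    for \<mu> :: "real^'n \<Rightarrow> real" and r
  proof -
    obtain \<mu>' where \<mu>': "\<mu>' \<in> borel_measurable borel" and eq: "AE x in lborel. \<mu> x = \<mu>' x"
      using nonneg_loc_integrable_borel[OF \<mu>(1)] by blast
    obtain B where B: "AE x in lborel. x \<notin> ball 0 r \<longrightarrow> \<bar>\<mu> x\<bar> \<le> B"
      using \<mu>(2) r unfolding in_B_def AE_completion_iff by blast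
    have small': "AE y in lborel. norm y < r \<longrightarrow> Gfun f (\<mu>' y) \<le> \<epsilon> * norm y powr (- \<theta>)"
      using small[unfolded AE_completion_iff] eq by eventually_elim auto
    have bounded': "AE y in lborel. \<not> norm y < r \<longrightarrow> \<mu>' y \<le> B"
      using B eq by eventually_elim auto
    have "\<exists>T>0. \<exists>u. borel_solution f \<mu>' T u \<and> Linf_loc_time T u"
      using C theta by (intro bounded_solution_if_small[OF _ _ \<mu>' small'[unfolded \<epsilon>_def]
          bounded']) simp_all
    then show ?thesis using is_solution_if_borel_solution[OF _ eq]
      unfolding locally_solvable_def by blast
  qed
  ultimately show ?thesis by blast
qed

end

section \<open>Nonexistence\<close>

lemma mult_powr_le_if_small:
  fixes a b c d t :: real
  assumes pos: "c > 0" "d > 0" and "a < b" and t: "0 < t" "t \<le> (d / c) powr (1 / (b - a))"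
  shows "c * t powr b \<le> d * t powr a"
proof -
  have "t powr (b - a) \<le> ((d / c) powr (1 / (b - a))) powr (b - a)"
    using t \<open>a < b\<close> by (intro powr_mono2) auto
  also have "\<dots> = d / c" using \<open>a < b\<close> pos by (simp add: powr_powr)
  finally have "c * t powr (b - a) \<le> d" using pos by (simp add: field_simps)
  then have "c * t powr (b - a) * t powr a \<le> d * t powr a" by (rule mult_right_mono) simp
  then show ?thesis by (simp add: mult.assoc powr_add[symmetric])
qed

lemma convex_mono_supporting_line:
  fixes g :: "real \<Rightarrow> real"
  assumes cvx: "convex_on UNIV g" and "mono g"
  obtains c where "c \<ge> 0" "\<And>u. g m + c * (u - m) \<le> g u"
proof -
  obtain c where line: "\<And>u. g m + c * (u - m) \<le> g u"
    using convex_le_Inf_differential[OF cvx, of m] by auto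
  moreover have "g (m - 1) \<le> g m" using \<open>mono g\<close> by (auto intro: monoD)
  then have "c \<ge> 0" using line[of "m - 1"] by simp
  ultimately show ?thesis using that by blast
qed

context admissible
begin

lemma F_decay_step:
  assumes w: "w > 0" and \<delta>: "\<delta> > 0"
  obtains \<eta> where "0 < \<eta>" "\<eta> < \<delta>" "F (w + \<eta> * (f w / 2)) + \<eta> / 4 \<le> F w"
proof -
  let ?v = "\<lambda>\<eta>. w + \<eta> * (f w / 2)"
  have fw: "f w > 0" by (rule f_pos[OF w])
  have "isCont f w" using f_cont_pos[of "{0<..}"] w by (simp add: continuous_on_eq_continuous_at)
  moreover have "(?v \<longlongrightarrow> ?v 0) (at_right 0)" by (intro tendsto_intros)
  ultimately have "((\<lambda>\<eta>. f (?v \<eta>)) \<longlongrightarrow> f w) (at_right 0)"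
    by (intro isCont_tendsto_compose[where g=f]) simp_all
  then have "\<forall>\<^sub>F \<eta> in at_right 0. f (?v \<eta>) < 2 * f w" using fw by (intro order_tendstoD) auto
  moreover have "\<forall>\<^sub>F \<eta> in at_right 0. \<eta> \<in> {0<..<\<delta>}" by (rule eventually_at_right_real[OF \<delta>])
  ultimately have "\<forall>\<^sub>F \<eta> in at_right 0. f (?v \<eta>) < 2 * f w \<and> \<eta> \<in> {0<..<\<delta>}"
    by (rule eventually_conj)
  then obtain \<eta> where \<eta>: "f (?v \<eta>) < 2 * f w" "0 < \<eta>" "\<eta> < \<delta>"
    using eventually_happens[of _ "at_right (0::real)"] by auto
  have v: "w \<le> ?v \<eta>" "0 < ?v \<eta>" using \<eta> fw w by (auto simp: add_pos_pos)
  have "\<eta> / 4 = (?v \<eta> - w) / (2 * f w)" using fw by simp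
  also have "\<dots> \<le> (?v \<eta> - w) / f (?v \<eta>)"
    using \<eta> v f_pos[OF v(2)] by (intro divide_left_mono) auto
  also have "\<dots> \<le> F w - F (?v \<eta>)" by (rule F_diff_ge[OF w v(1)])
  finally show ?thesis using that \<eta> by simp
qed

text \<open>From any time \<open>s < t\<close> the function \<open>F \<circ> W\<close> keeps decreasing at rate at least \<open>1/4\<close> for
  a while; so the supremum of the times up to which it has done so is \<open>t\<close>.\<close>

lemma growth_time_bound:
  assumes W_0: "W 0 > 0"
    and grow: "\<And>s s'. 0 \<le> s \<Longrightarrow> s \<le> s' \<Longrightarrow> s' \<le> t \<Longrightarrow> W s + (s' - s) * (f (W s) / 2) \<le> W s'"
  shows "t \<le> 4 * F (W 0)"
proof (cases "0 \<le> t")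
  case True
  have "0 \<le> s * (f (W 0) / 2)" if "0 \<le> s" for s
    using that f_pos[OF W_0] by simp
  then have W_pos: "W s > 0" if "0 \<le> s" "s \<le> t" for s
    using grow[OF order_refl that] that W_0 by fastforce
  have W_mono: "W s \<le> W s'" if "0 \<le> s" "s \<le> s'" "s' \<le> t" for s s'
    using grow[OF that] f_pos[OF W_pos[of s]] that
    by (smt (verit) half_gt_zero_iff mult_nonneg_nonneg)
  define A where "A = {s \<in> {0..t}. F (W s) + s / 4 \<le> F (W 0)}"
  have A: "0 \<in> A" "bdd_above A" using True by (auto simp: A_def)
  define S where "S = Sup A"
  have S: "0 \<le> S" "S \<le> t"
    unfolding S_def using A
    by (blast intro: cSup_upper) (rule cSup_least, use A(1) in \<open>auto simp: A_def\<close>)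
  have "s \<le> 4 * (F (W 0) - F (W S))" if "s \<in> A" for s
  proof -
    have "s \<le> S" unfolding S_def by (rule cSup_upper[OF that A(2)])
    then have "F (W S) \<le> F (W s)" using that S by (intro F_antimono W_pos W_mono) (auto simp: A_def)
    then show ?thesis using that by (simp add: A_def)
  qed
  then have "S \<le> 4 * (F (W 0) - F (W S))" unfolding S_def using A(1) by (intro cSup_least) auto
  then have S_decay: "F (W S) + S / 4 \<le> F (W 0)" by simp
  have "S = t"
  proof (rule ccontr)
    assume "S \<noteq> t"
    then have "t - S > 0" using S by simp
    then obtain \<eta> where \<eta>: "0 < \<eta>" "\<eta> < t - S" "F (W S + \<eta> * (f (W S) / 2)) + \<eta> / 4 \<le> F (W S)"
      using F_decay_step[OF W_pos[OF S]] by blast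
    have "F (W (S + \<eta>)) \<le> F (W S + \<eta> * (f (W S) / 2))"
      using grow[of S "S + \<eta>"] S \<eta> W_pos[OF S] f_pos[OF W_pos[OF S]]
      by (intro F_antimono) (auto simp: add_pos_pos)
    then have "S + \<eta> \<in> A" using S_decay S \<eta> by (simp add: A_def add_divide_distrib)
    then have "S + \<eta> \<le> S" unfolding S_def using A(2) by (rule cSup_upper)
    then show False using \<eta> by simp
  qed
  then show ?thesis using S_decay F_nonneg[OF W_pos[OF S]] by simp
qed (use F_nonneg[OF W_0] in simp)

definition excess :: "real \<Rightarrow> real \<Rightarrow> real" where "excess \<sigma> u = f (max \<sigma> u) - f \<sigma>"

lemma excess_mono: "\<sigma> > 0 \<Longrightarrow> u \<le> v \<Longrightarrow> excess \<sigma> u \<le> excess \<sigma> v"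
  by (auto simp: excess_def intro!: f_mono)

lemma excess_nonneg: "\<sigma> > 0 \<Longrightarrow> 0 \<le> excess \<sigma> u"
  using f_mono[of \<sigma> "max \<sigma> u"] by (simp add: excess_def)

lemma excess_le: "\<sigma> > 0 \<Longrightarrow> u \<ge> 0 \<Longrightarrow> excess \<sigma> u \<le> f u"
  using f_nonneg[of u] f_nonneg[of \<sigma>] by (auto simp: excess_def max_def)

lemma excess_convex:
  assumes \<sigma>: "\<sigma> > 0" and cvx: "convex_on {\<sigma>..} f" shows "convex_on UNIV (excess \<sigma>)"
proof (rule convex_onI)
  fix s u v :: real assume s: "0 < s" "s < 1"
  let ?u = "max \<sigma> u" and ?v = "max \<sigma> v"
  have "(1 - s) * \<sigma> + s * \<sigma> \<le> (1 - s) * ?u + s * ?v" "(1 - s) * u + s * v \<le> (1 - s) * ?u + s * ?v"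
    using s by (intro add_mono mult_left_mono; simp)+
  moreover have "(1 - s) * \<sigma> + s * \<sigma> = \<sigma>" by (simp add: algebra_simps)
  ultimately have "max \<sigma> ((1 - s) * u + s * v) \<le> (1 - s) * ?u + s * ?v" by simp
  then have "f (max \<sigma> ((1 - s) * u + s * v)) \<le> f ((1 - s) * ?u + s * ?v)"
    using \<sigma> by (intro f_mono) auto
  also have "\<dots> \<le> (1 - s) * f ?u + s * f ?v"
    using convex_onD[OF cvx, of s ?u ?v] s by simp
  finally show "excess \<sigma> ((1 - s) *\<^sub>R u + s *\<^sub>R v) \<le> (1 - s) * excess \<sigma> u + s * excess \<sigma> v"
    by (simp add: excess_def algebra_simps)
qed simp

lemma excess_supporting_line:
  assumes "\<sigma> > 0" "convex_on {\<sigma>..} f"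
  obtains c where "c \<ge> 0" "\<And>u. excess \<sigma> m + c * u \<le> excess \<sigma> u + c * m"
proof -
  have "mono (excess \<sigma>)" using excess_mono[OF assms(1)] by (rule monoI)
  then obtain c where "c \<ge> 0" "\<And>u. excess \<sigma> m + c * (u - m) \<le> excess \<sigma> u"
    using convex_mono_supporting_line[OF excess_convex[OF assms]] by blast
  then show ?thesis using that[of c] by (simp add: algebra_simps)
qed

end

locale solution_at_point = semilinear_heat \<theta> f for \<theta> f +
  fixes \<mu> :: "real^'n \<Rightarrow> real" and T :: real and u :: "(real^'n) \<times> real \<Rightarrow> real" and x :: "real^'n"
    and t :: real
  assumes \<mu>_measurable[measurable]: "\<mu> \<in> borel_measurable borel" and sol: "borel_solution f \<mu> T u"
    and t: "0 < t" "t < T"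
    and eq: "ennreal (u (x, t)) = mild_map f \<mu> u (x, t)"
begin

text \<open>\<open>V s\<close> and \<open>M s\<close> are the means, with respect to the kernel of time \<open>t - s\<close> centered at \<open>x\<close>, of
  \<open>f (u (_, s))\<close> and, for almost all \<open>s\<close>, of \<open>u (_, s)\<close>; \<open>W\<close> is the real version of \<open>M\<close>.\<close>

definition V :: "real \<Rightarrow> ennreal" where "V s = heat (t - s) (\<lambda>y. ennreal (f (u (y, s)))) x"

definition M :: "real \<Rightarrow> ennreal" where
  "M s = heat t (\<lambda>y. ennreal (\<mu> y)) x + (\<integral>\<^sup>+r\<in>{0<..<s}. V r \<partial>lborel)"

definition W :: "real \<Rightarrow> real" where "W s = enn2real (M s)"

lemmas u_measurable = borel_solutionD(1)[OF sol] and u_nonneg = borel_solutionD(2)[OF sol]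

lemma f_u_measurable: "(\<lambda>z. ennreal (f (u z))) \<in> borel_measurable borel"
  using f_comp_measurable[OF u_measurable u_nonneg] by measurable

lemma u_slice_measurable[measurable]: "(\<lambda>y. u (y, s)) \<in> borel_measurable borel"
proof -
  have [measurable]: "u \<in> borel_measurable (borel \<Otimes>\<^sub>M borel)"
    using u_measurable by (simp add: borel_prod)
  show ?thesis by measurable
qed

lemma V_measurable[measurable]: "V \<in> borel_measurable borel"
proof -
  have [measurable]: "(\<lambda>z. ennreal (f (u z))) \<in> borel_measurable (borel \<Otimes>\<^sub>M borel)"
    using f_u_measurable by (simp add: borel_prod)
  show ?thesis unfolding V_def[abs_def] by measurable
qed

lemma M_eq:
  assumes "s \<le> t" shows "M s = ennreal (W s)"
proof -
  have "M s \<le> M t" unfolding M_def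
    using assms by (intro add_left_mono nn_integral_mono) (auto simp: indicator_def)
  also have "M t = ennreal (u (x, t))" by (simp add: eq mild_map_def M_def duhamel_def V_def)
  also have "\<dots> < top" by simp
  finally show ?thesis by (simp add: W_def)
qed

lemma heat_\<mu>_eq: "heat t (\<lambda>y. ennreal (\<mu> y)) x = ennreal (W 0)"
  using M_eq[of 0] t by (simp add: M_def)

lemma W_nonneg: "0 \<le> W s"
  by (simp add: W_def)

lemma W_mono: "s \<le> s' \<Longrightarrow> s' \<le> t \<Longrightarrow> W s \<le> W s'"
proof -
  assume s: "s \<le> s'" "s' \<le> t"
  have "M s \<le> M s'" unfolding M_def
    using s by (intro add_left_mono nn_integral_mono) (auto simp: indicator_def)
  then show "W s \<le> W s'" using s by (simp add: M_eq W_nonneg)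
qed

lemma heat_u_eq: "AE s in lborel. 0 < s \<and> s < t \<longrightarrow> heat (t - s) (\<lambda>y. ennreal (u (y, s))) x = M s"
proof -
  from AE_lborel_slices[OF borel_solutionD(3)[OF sol]] show ?thesis
  proof (rule eventually_mono, intro impI)
    fix s
    assume slice: "AE y in lborel. (y, s) \<in> QT T \<longrightarrow> ennreal (u (y, s)) = mild_map f \<mu> u (y, s)"
      and s: "0 < s \<and> s < t"
    let ?D = "\<lambda>y. duhamel (\<lambda>w. ennreal (f (u w))) (y, s)"
    have "(\<lambda>w. duhamel (\<lambda>w. ennreal (f (u w))) w) \<in> borel_measurable (borel \<Otimes>\<^sub>M borel)"
      using duhamel_measurable[OF f_u_measurable] by (simp add: borel_prod)
    then have D_measurable[measurable]: "?D \<in> borel_measurable borel" by measurable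
    have "AE y in lborel. ennreal (u (y, s)) = heat s (\<lambda>y. ennreal (\<mu> y)) y + ?D y"
      using slice by (rule eventually_mono) (use s t in \<open>auto simp: QT_def mild_map_def\<close>)
    then have "heat (t - s) (\<lambda>y. ennreal (u (y, s))) x
        = heat (t - s) (\<lambda>y. heat s (\<lambda>y. ennreal (\<mu> y)) y + ?D y) x"
      by (rule heat_cong_AE)
    also have "\<dots> = heat (t - s) (heat s (\<lambda>y. ennreal (\<mu> y))) x + heat (t - s) ?D x"
      by (rule heat_add) measurable
    also have "heat (t - s) (heat s (\<lambda>y. ennreal (\<mu> y))) x = heat t (\<lambda>y. ennreal (\<mu> y)) x"
      using s by (subst heat_semigroup) auto
    also have "heat (t - s) ?D x = (\<integral>\<^sup>+r\<in>{0<..<s}. V r \<partial>lborel)"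
      unfolding V_def using s by (intro heat_duhamel f_u_measurable) auto
    finally show "heat (t - s) (\<lambda>y. ennreal (u (y, s))) x = M s" by (simp only: M_def)
  qed
qed

lemma excess_W_le_V:
  assumes \<sigma>: "\<sigma> > 0" and cvx: "convex_on {\<sigma>..} f"
  shows "AE s in lborel. 0 < s \<and> s < t \<longrightarrow> ennreal (excess \<sigma> (W s)) \<le> V s"
  using heat_u_eq
proof (rule eventually_mono, intro impI)
  fix s assume mean: "0 < s \<and> s < t \<longrightarrow> heat (t - s) (\<lambda>y. ennreal (u (y, s))) x = M s"
    and s: "0 < s \<and> s < t"
  obtain c where c: "c \<ge> 0" "\<And>v. excess \<sigma> (W s) + c * v \<le> excess \<sigma> v + c * W s"
    by (rule excess_supporting_line[OF \<sigma> cvx, of "W s"]) blast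
  have f_slice[measurable]: "(\<lambda>y. ennreal (f (u (y, s)))) \<in> borel_measurable borel"
    using f_comp_measurable[OF u_slice_measurable u_nonneg] by measurable
  have "ennreal c * ennreal (u (y, s)) + ennreal (excess \<sigma> (W s))
      \<le> 1 * ennreal (f (u (y, s))) + ennreal (c * W s)" for y
  proof -
    have "c * u (y, s) + excess \<sigma> (W s) \<le> f (u (y, s)) + c * W s"
      using c(2)[of "u (y, s)"] excess_le[OF \<sigma> u_nonneg, of "(y, s)"] by simp
    then have "ennreal (c * u (y, s) + excess \<sigma> (W s)) \<le> ennreal (f (u (y, s)) + c * W s)"
      by (rule ennreal_leI)
    then show ?thesis
      using c(1) u_nonneg W_nonneg excess_nonneg[OF \<sigma>] f_nonneg[OF u_nonneg]
      by (simp add: ennreal_mult)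
  qed
  then have "ennreal c * heat (t - s) (\<lambda>y. ennreal (u (y, s))) x + ennreal (excess \<sigma> (W s))
      \<le> 1 * V s + ennreal (c * W s)"
    unfolding V_def using s by (intro heat_affine_le) auto
  then have "ennreal (c * W s) + ennreal (excess \<sigma> (W s)) \<le> ennreal (c * W s) + V s"
    using mean s c(1) W_nonneg by (simp add: M_eq ennreal_mult add.commute)
  then show "ennreal (excess \<sigma> (W s)) \<le> V s" unfolding ennreal_add_left_cancel_le by simp
qed

lemma W_growth:
  assumes \<sigma>: "\<sigma> > 0" and cvx: "convex_on {\<sigma>..} f"
    and s: "0 \<le> s" "s \<le> s'" "s' \<le> t"
  shows "W s + (s' - s) * excess \<sigma> (W s) \<le> W s'"
proof -
  let ?g = "ennreal (excess \<sigma> (W s))"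
  have "M s + ennreal ((s' - s) * excess \<sigma> (W s)) \<le> M s'"
  proof -
    have "ennreal ((s' - s) * excess \<sigma> (W s)) = (\<integral>\<^sup>+r. ?g * indicator {s<..<s'} r \<partial>lborel)"
      using s excess_nonneg[OF \<sigma>]
      by (subst nn_integral_cmult_indicator) (simp_all add: ennreal_mult mult.commute)
    then have "(\<integral>\<^sup>+r\<in>{0<..<s}. V r \<partial>lborel) + ennreal ((s' - s) * excess \<sigma> (W s))
        = (\<integral>\<^sup>+r. V r * indicator {0<..<s} r + ?g * indicator {s<..<s'} r \<partial>lborel)"
      by (simp add: nn_integral_add)
    also have "\<dots> \<le> (\<integral>\<^sup>+r\<in>{0<..<s'}. V r \<partial>lborel)"
    proof (rule nn_integral_mono_AE, use excess_W_le_V[OF \<sigma> cvx] in eventually_elim)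
      case (elim r)
      have "?g \<le> V r" if "s < r" "r < s'"
        using elim that s excess_mono[OF \<sigma> W_mono[of s r]]
        by (auto intro: order_trans[OF ennreal_leI])
      then show ?case using s by (auto simp: indicator_def)
    qed
    finally show ?thesis unfolding M_def by (simp add: add.assoc add_left_mono)
  qed
  then have "ennreal (W s + (s' - s) * excess \<sigma> (W s)) \<le> ennreal (W s')"
    using s W_nonneg excess_nonneg[OF \<sigma>] by (simp add: M_eq)
  then show ?thesis using W_nonneg by simp
qed

lemma blow_up_time_bound:
  assumes \<sigma>: "\<sigma> > 0" and cvx: "convex_on {\<sigma>..} f" and W_0: "\<sigma> \<le> W 0" "2 * f \<sigma> \<le> f (W 0)"
  shows "t \<le> 4 * F (W 0)"
proof (rule growth_time_bound)
  show W_0_pos: "W 0 > 0" using W_0 \<sigma> by simp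
  fix s s' assume s: "0 \<le> s" "s \<le> s'" "s' \<le> t"
  have "W 0 \<le> W s" using W_mono[of 0 s] s by simp
  then have "f (W 0) \<le> f (W s)" "\<sigma> \<le> W s" using W_0 W_0_pos by (auto intro: f_mono)
  then have "f (W s) / 2 \<le> excess \<sigma> (W s)" using W_0(2) by (simp add: excess_def max_absorb2)
  then have "(s' - s) * (f (W s) / 2) \<le> (s' - s) * excess \<sigma> (W s)"
    using s by (intro mult_left_mono) auto
  then show "W s + (s' - s) * (f (W s) / 2) \<le> W s'" using W_growth[OF \<sigma> cvx s] by linarith
qed

end

context semilinear_heat
begin

definition early_means_large :: "real \<Rightarrow> (real^'n \<Rightarrow> real) \<Rightarrow> bool" where
  "early_means_large \<tau> \<mu> \<longleftrightarrow> (\<exists>t0>0. \<forall>t x w. 0 < t \<longrightarrow> t < t0 \<longrightarrow> norm x \<le> t powr (1 / \<theta>) \<longrightarrow>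
     0 \<le> w \<longrightarrow> heat t (\<lambda>y. ennreal (\<mu> y)) x = ennreal w \<longrightarrow> \<tau> \<le> w \<and> 4 * F w < t)"

lemma AE_QT_early_point:
  assumes P: "AE z in lborel. z \<in> QT T \<longrightarrow> P z" and t0: "0 < t0" "t0 \<le> T"
  obtains t and x :: "real^'n" where "0 < t" "t < t0" "norm x \<le> t powr (1/\<theta>)" "P (x, t)"
proof (rule ccontr)
  assume no_point: "\<not> thesis"
  define S where "S = ball (0::real^'n) ((t0/2) powr (1/\<theta>)) \<times> {t0/2<..<t0}"
  have "open S" unfolding S_def by (intro open_Times) auto
  moreover have "(0, 3/4 * t0) \<in> S" using t0 by (simp add: S_def)
  then have "S \<noteq> {}" by blast
  moreover from P have "AE z in lborel. z \<notin> S"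
  proof (rule eventually_mono, intro notI)
    fix z assume Pz: "z \<in> QT T \<longrightarrow> P z" and "z \<in> S"
    then obtain x t where z: "z = (x, t)" and x: "norm x < (t0/2) powr (1/\<theta>)"
      and t: "t0/2 < t" "t < t0"
      by (auto simp: S_def)
    have "(t0/2) powr (1/\<theta>) \<le> t powr (1/\<theta>)" using t t0 theta by (intro powr_mono2) auto
    then show False using no_point that[of t x] Pz x t t0 by (auto simp: z QT_def)
  qed
  ultimately show False using not_AE_notin_open by blast
qed

lemma not_locally_solvable_if_early_means_large:
  fixes \<mu> :: "real^'n \<Rightarrow> real"
  assumes \<sigma>: "\<sigma> > 0" and cvx: "convex_on {\<sigma>..} f" and \<tau>: "\<sigma> \<le> \<tau>" "2 * f \<sigma> \<le> f \<tau>"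
    and \<mu>': "\<mu>' \<in> borel_measurable borel" "early_means_large \<tau> \<mu>'"
    and eq: "AE x in lborel. \<mu> x = \<mu>' x"
  shows "\<not> locally_solvable \<theta> f \<mu>"
proof
  assume "locally_solvable \<theta> f \<mu>"
  then obtain T u0 where T: "T > 0" and "is_solution \<theta> f \<mu> T u0"
    by (auto simp: locally_solvable_def)
  then obtain u where u: "borel_solution f \<mu>' T u" using borel_solution_if_is_solution eq by blast
  obtain t0 where t0: "t0 > 0"
    and mean: "\<And>t x w. 0 < t \<Longrightarrow> t < t0 \<Longrightarrow> norm x \<le> t powr (1/\<theta>) \<Longrightarrow> 0 \<le> w \<Longrightarrow>
      heat t (\<lambda>y. ennreal (\<mu>' y)) x = ennreal w \<Longrightarrow> \<tau> \<le> w \<and> 4 * F w < t"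
    using \<mu>'(2) unfolding early_means_large_def by blast
  have "0 < min T t0" "min T t0 \<le> T" using T t0 by auto
  then obtain t and x :: "real^'n" where time: "0 < t" "t < min T t0" and x: "norm x \<le> t powr (1/\<theta>)"
    and u_eq: "ennreal (u (x, t)) = mild_map f \<mu>' u (x, t)"
    by (rule AE_QT_early_point[OF borel_solutionD(3)[OF u]]) auto
  interpret solution_at_point \<theta> f \<mu>' T u x t
    by unfold_locales (use \<mu>' u time u_eq in auto)
  have W_0: "\<tau> \<le> W 0 \<and> 4 * F (W 0) < t"
    using time by (intro mean[OF _ _ x W_nonneg heat_\<mu>_eq]) auto
  then have "f \<tau> \<le> f (W 0)" using \<tau> \<sigma> by (intro f_mono) auto
  then have "t \<le> 4 * F (W 0)" using W_0 \<tau> by (intro blow_up_time_bound[OF \<sigma> cvx]) auto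
  then show False using W_0 by simp
qed

end

locale convex_profile = semilinear_heat \<theta> f for \<theta> f +
  fixes a \<tau> :: real
  assumes a: "0 < a" "a < \<tau>" and fF_mono: "mono_on {a..} (\<lambda>u. f u * F u powr (1 / 2))"
begin

definition descent :: "real \<Rightarrow> real" where "descent u = 1 / 2 / (f u * F u powr (1 / 2))"

text \<open>The convex function that equals \<open>\<surd>F\<close> on \<open>[\<tau>, \<infinity>)\<close> and is affine below \<open>\<tau>\<close>.\<close>

definition sqrt_F_ext :: "real \<Rightarrow> real" where
  "sqrt_F_ext u = F (max \<tau> u) powr (1 / 2) + descent \<tau> * (max \<tau> u - u)"

lemma tau_pos: "\<tau> > 0"
  using a by simp

lemma descent_pos: "u > 0 \<Longrightarrow> descent u > 0"
  using f_pos[of u] F_pos[of u] by (simp add: descent_def)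

lemma descent_antimono:
  assumes "a \<le> u" "u \<le> v" shows "descent v \<le> descent u"
proof -
  have pos: "0 < f w * F w powr (1 / 2)" if "a \<le> w" for w
    using f_pos[of w] F_pos[of w] that a by simp
  have "f u * F u powr (1 / 2) \<le> f v * F v powr (1 / 2)"
    using fF_mono assms by (auto simp: mono_on_def)
  then show ?thesis
    unfolding descent_def using assms by (intro divide_left_mono mult_pos_pos[OF pos pos]) auto
qed

lemma sqrt_F_ext_supporting_line:
  assumes m: "\<tau> \<le> m" shows "F m powr (1 / 2) + descent m * m \<le> descent m * u + sqrt_F_ext u"
proof -
  have "antimono_on {a<..} (\<lambda>u. 1 / 2 / (f u * F u powr (1 - 1 / 2)))"
    using descent_antimono by (auto simp: monotone_on_def descent_def)
  then have "F m powr (1 / 2) - descent m * (max \<tau> u - m) \<le> F (max \<tau> u) powr (1 / 2)"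
    using F_powr_above_tangent[OF a(1), of "1 / 2" m "max \<tau> u"] m a by (simp add: descent_def)
  moreover have "descent m * (max \<tau> u - u) \<le> descent \<tau> * (max \<tau> u - u)"
    using descent_antimono[of \<tau> m] m a by (intro mult_right_mono) auto
  ultimately show ?thesis by (simp add: sqrt_F_ext_def algebra_simps)
qed

lemma sqrt_F_le_heat:
  fixes x :: "real^'n"
  assumes t: "t > 0" and \<mu>[measurable]: "\<mu> \<in> borel_measurable borel"
    and b[measurable]: "b \<in> borel_measurable borel"
    and nonneg: "\<And>y. 0 \<le> \<mu> y" and le: "AE y in lborel. ennreal (sqrt_F_ext (\<mu> y)) \<le> b y"
    and w: "heat t (\<lambda>y. ennreal (\<mu> y)) x = ennreal w" "0 \<le> w"
  shows "ennreal (F (max \<tau> w) powr (1 / 2)) \<le> heat t b x"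
proof -
  let ?m = "max \<tau> w"
  let ?c = "descent ?m"
  have c: "?c > 0" using tau_pos by (intro descent_pos) simp
  have ext_nonneg: "0 \<le> sqrt_F_ext v" for v
    using descent_pos[OF tau_pos] by (simp add: sqrt_F_ext_def)
  have "AE y in lborel. ennreal ?c * ennreal (\<mu> y) + b y \<ge> ennreal (F ?m powr (1 / 2) + ?c * ?m)"
    using le
  proof eventually_elim
    case (elim y)
    have "ennreal (F ?m powr (1 / 2) + ?c * ?m) \<le> ennreal (?c * \<mu> y + sqrt_F_ext (\<mu> y))"
      by (intro ennreal_leI sqrt_F_ext_supporting_line) simp
    also have "\<dots> = ennreal ?c * ennreal (\<mu> y) + ennreal (sqrt_F_ext (\<mu> y))"
      using c nonneg ext_nonneg by (simp add: ennreal_mult)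
    finally show ?case using elim by (meson add_left_mono order_trans)
  qed
  then have "heat t (\<lambda>_. ennreal (F ?m powr (1 / 2) + ?c * ?m)) x
      \<le> heat t (\<lambda>y. ennreal ?c * ennreal (\<mu> y) + b y) x"
    by (rule heat_mono_AE)
  also have "\<dots> = ennreal ?c * ennreal w + heat t b x"
    by (subst heat_add) (simp_all add: heat_cmult w)
  also have "\<dots> \<le> ennreal (?c * ?m) + heat t b x"
    using c w(2) by (intro add_right_mono)
      (simp add: ennreal_mult'[symmetric] ennreal_leI mult_left_mono)
  finally have "ennreal (?c * ?m) + ennreal (F ?m powr (1 / 2)) \<le> ennreal (?c * ?m) + heat t b x"
    using c tau_pos by (simp add: heat_const[OF t] add.commute)
  then show ?thesis unfolding ennreal_add_left_cancel_le by simp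
qed

lemma sqrt_F_ext_le:
  assumes "m \<ge> 0" shows "sqrt_F_ext m \<le> F \<tau> powr (1 / 2) + descent \<tau> * \<tau>"
proof -
  have "F (max \<tau> m) powr (1 / 2) \<le> F \<tau> powr (1 / 2)"
    using F_antimono[OF tau_pos, of "max \<tau> m"] F_nonneg[of "max \<tau> m"] tau_pos
    by (intro powr_mono2) auto
  moreover have "descent \<tau> * (max \<tau> m - m) \<le> descent \<tau> * \<tau>"
    using assms descent_pos[OF tau_pos] tau_pos by (intro mult_left_mono) auto
  ultimately show ?thesis by (simp add: sqrt_F_ext_def)
qed

lemma sqrt_F_ext_le_if_Gfun_large:
  assumes m: "m \<ge> 0" and b: "b > 0" "1 / F \<tau> < b" "Gfun f 0 < b" and large: "b \<le> Gfun f m"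
  shows "sqrt_F_ext m \<le> b powr (- 1 / 2)"
proof -
  have m_pos: "m > 0" using m b(3) large by (cases "m = 0") auto
  then have G: "Gfun f m = 1 / F m" by (simp add: Gfun_def)
  have "1 / F \<tau> < 1 / F m" using b large by (simp add: G)
  then have "F m < F \<tau>" using F_pos[OF m_pos] F_pos[OF tau_pos] by (simp add: field_simps)
  then have "\<tau> \<le> m" using F_le_iff[OF tau_pos m_pos] by simp
  moreover have "F m powr (1 / 2) = (1 / F m) powr (- 1 / 2)"
    using F_pos[OF m_pos] by (simp add: powr_divide powr_minus_divide)
  moreover have "(1 / F m) powr (- 1 / 2) \<le> b powr (- 1 / 2)"
    using b large by (intro powr_mono2') (auto simp: G)
  ultimately show ?thesis by (simp add: sqrt_F_ext_def max_absorb2)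
qed

lemma sqrt_F_ext_le_near_origin:
  fixes y :: "'b::real_normed_vector"
  assumes \<gamma>: "\<gamma> > 0" and y: "y \<noteq> 0" "norm y < (\<gamma> / max (1 / F \<tau>) (Gfun f 0)) powr (1 / \<theta>)"
    and m: "m \<ge> 0" "\<gamma> * norm y powr (- \<theta>) \<le> Gfun f m"
  shows "sqrt_F_ext m \<le> \<gamma> powr (- 1 / 2) * norm y powr (\<theta> / 2)"
proof -
  define G0 where "G0 = max (1 / F \<tau>) (Gfun f 0)"
  have G0: "G0 > 0" using F_pos[OF tau_pos] by (simp add: G0_def less_max_iff_disj)
  have "norm y powr \<theta> < ((\<gamma> / G0) powr (1 / \<theta>)) powr \<theta>"
    unfolding G0_def using y theta by (intro powr_less_mono2) auto
  also have "\<dots> = \<gamma> / G0" using \<gamma> G0 theta by (simp add: powr_powr)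
  finally have "G0 < \<gamma> * norm y powr (- \<theta>)" using y G0 by (simp add: powr_minus field_simps)
  then have "sqrt_F_ext m \<le> (\<gamma> * norm y powr (- \<theta>)) powr (- 1 / 2)"
    using m y \<gamma> by (intro sqrt_F_ext_le_if_Gfun_large) (auto simp: G0_def)
  also have "\<dots> = \<gamma> powr (- 1 / 2) * norm y powr (\<theta> / 2)" by (simp add: powr_mult powr_powr)
  finally show ?thesis .
qed

text \<open>Any exponent strictly between \<open>\<theta> / 2\<close> and \<open>\<theta>\<close> would do in place of \<open>3 * \<theta> / 4\<close>: the mean of
  the second power is then finite, and of lower order than that of the first as the time tends
  to \<open>0\<close>.\<close>

lemma sqrt_F_ext_le_if_Gfun_ge:
  assumes \<gamma>: "\<gamma> > 0" and r: "r > 0"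
  obtains K where "K > 0" "\<And>(y::real^'n) m. y \<noteq> 0 \<Longrightarrow> m \<ge> 0 \<Longrightarrow>
    (norm y < r \<Longrightarrow> \<gamma> * norm y powr (- \<theta>) \<le> Gfun f m) \<Longrightarrow>
    sqrt_F_ext m \<le> \<gamma> powr (- 1 / 2) * norm y powr (\<theta> / 2) + K * norm y powr (3 * \<theta> / 4)"
proof -
  define r0 where "r0 = min r ((\<gamma> / max (1 / F \<tau>) (Gfun f 0)) powr (1 / \<theta>))"
  have "max (1 / F \<tau>) (Gfun f 0) > 0" using F_pos[OF tau_pos] by (simp add: less_max_iff_disj)
  then have r0: "r0 > 0" using r \<gamma> unfolding r0_def by simp
  define K where "K = (F \<tau> powr (1 / 2) + descent \<tau> * \<tau>) * r0 powr (- (3 * \<theta> / 4))"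
  have K: "K > 0" using F_pos[OF tau_pos] descent_pos[OF tau_pos] tau_pos r0
    by (simp add: K_def add_pos_pos)
  have far: "sqrt_F_ext m \<le> K * norm y powr (3 * \<theta> / 4)" if "r0 \<le> norm y" "m \<ge> 0"
    for y :: "real^'n" and m
  proof -
    have "sqrt_F_ext m \<le> K * r0 powr (3 * \<theta> / 4)"
      using sqrt_F_ext_le[OF that(2)] r0 by (simp add: K_def mult.assoc powr_add[symmetric])
    also have "\<dots> \<le> K * norm y powr (3 * \<theta> / 4)"
      using that r0 theta K by (intro mult_left_mono powr_mono2) auto
    finally show ?thesis .
  qed
  show ?thesis
  proof (rule that[OF K])
    fix y :: "real^'n" and m
    assume y: "y \<noteq> 0" and m: "m \<ge> 0" "norm y < r \<Longrightarrow> \<gamma> * norm y powr (- \<theta>) \<le> Gfun f m"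
    have near: "sqrt_F_ext m \<le> \<gamma> powr (- 1 / 2) * norm y powr (\<theta> / 2)" if "norm y < r0"
      using that y m \<gamma> by (intro sqrt_F_ext_le_near_origin) (simp_all add: r0_def)
    have "sqrt_F_ext m \<le> \<gamma> powr (- 1 / 2) * norm y powr (\<theta> / 2) \<or>
        sqrt_F_ext m \<le> K * norm y powr (3 * \<theta> / 4)"
      using near far[OF _ m(1), of y] by (meson not_le)
    moreover have "0 \<le> \<gamma> powr (- 1 / 2) * norm y powr (\<theta> / 2)" "0 \<le> K * norm y powr (3 * \<theta> / 4)"
      using K by auto
    ultimately show "sqrt_F_ext m
        \<le> \<gamma> powr (- 1 / 2) * norm y powr (\<theta> / 2) + K * norm y powr (3 * \<theta> / 4)" by linarith
  qed
qed

lemma sqrt_F_mean_le: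
  fixes \<mu> :: "real^'n \<Rightarrow> real"
  assumes t: "t > 0" and \<mu>: "\<mu> \<in> borel_measurable borel" "\<And>y. 0 \<le> \<mu> y"
    and le: "AE y in lborel. sqrt_F_ext (\<mu> y) \<le> c * norm y powr \<alpha> + d * norm y powr \<beta>"
    and nonneg: "0 \<le> c" "0 \<le> d" "0 \<le> A" "0 \<le> B"
    and heat: "heat t (\<lambda>y. ennreal (norm y powr \<alpha>)) x \<le> ennreal A"
        "heat t (\<lambda>y. ennreal (norm y powr \<beta>)) x \<le> ennreal B"
    and w: "heat t (\<lambda>y. ennreal (\<mu> y)) x = ennreal w" "0 \<le> w"
  shows "F (max \<tau> w) powr (1 / 2) \<le> c * A + d * B"
proof -
  let ?b = "\<lambda>y::real^'n. ennreal c * ennreal (norm y powr \<alpha>) + ennreal d * ennreal (norm y powr \<beta>)"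
  have "AE y in lborel. ennreal (sqrt_F_ext (\<mu> y)) \<le> ?b y"
    using le
    by eventually_elim (simp
        add: nonneg ennreal_mult[symmetric] ennreal_plus[symmetric] ennreal_leI del: ennreal_plus)
  then have "ennreal (F (max \<tau> w) powr (1 / 2)) \<le> heat t ?b x"
    by (intro sqrt_F_le_heat[OF t \<mu>(1) _ \<mu>(2) _ w]) measurable
  also have "\<dots> = ennreal c * heat t (\<lambda>y. ennreal (norm y powr \<alpha>)) x
      + ennreal d * heat t (\<lambda>y. ennreal (norm y powr \<beta>)) x"
    by (subst heat_add) (simp_all add: heat_cmult)
  also have "\<dots> \<le> ennreal c * ennreal A + ennreal d * ennreal B"
    by (intro add_mono mult_left_mono heat) auto
  also have "\<dots> = ennreal (c * A + d * B)" using nonneg by (simp add: ennreal_mult)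
  finally show ?thesis using nonneg by (simp del: ennreal_plus)
qed

lemma mean_large_if_sqrt_F_le:
  assumes le: "F (max \<tau> w) powr (1 / 2) \<le> 2 / 5 * t powr (1 / 2)" and t: "0 < t" "t < F \<tau>"
  shows "\<tau> \<le> w" "4 * F w < t"
proof -
  let ?m = "max \<tau> w"
  have "F ?m > 0" using tau_pos by (intro F_pos) simp
  moreover have "(F ?m powr (1 / 2)) powr 2 \<le> (2 / 5 * t powr (1 / 2)) powr 2"
    using le by (intro powr_mono2) auto
  ultimately have F_le: "F ?m \<le> 4 / 25 * t" unfolding powr_mult powr_powr
    using t by (simp add: power2_eq_square)
  then have "F ?m < F \<tau>" using t by simp
  then show "\<tau> \<le> w" by (cases "\<tau> \<le> w") (simp_all add: max_def)
  then show "4 * F w < t" using F_le t by (simp add: max_absorb2)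
qed

lemma early_means_large_if_Gfun_ge:
  fixes \<mu> :: "real^'n \<Rightarrow> real"
  assumes C: "C > 0" "\<And>t (x::real^'n). t > 0 \<Longrightarrow> norm x \<le> t powr (1/\<theta>) \<Longrightarrow>
      heat t (\<lambda>y. ennreal (norm y powr (\<theta> / 2))) x \<le> ennreal (C * t powr (1 / 2))"
  defines "\<gamma> \<equiv> (5 * C) powr 2"
  assumes \<mu>: "\<mu> \<in> borel_measurable borel" "\<And>y. 0 \<le> \<mu> y" and r: "r > 0"
    and large: "AE y in lborel. norm y < r \<longrightarrow> \<gamma> * norm y powr (- \<theta>) \<le> Gfun f (\<mu> y)"
  shows "early_means_large \<tau> \<mu>"
proof -
  let ?c = "\<gamma> powr (- 1 / 2)"
  have "?c = 1 / (5 * C)" unfolding \<gamma>_def powr_powr using C(1) by (simp add: powr_minus_divide)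
  then have \<gamma>: "\<gamma> > 0" "?c * C = 1 / 5" using C(1) by (auto simp: \<gamma>_def)
  obtain K where K: "K > 0" "\<And>(y::real^'n) m. y \<noteq> 0 \<Longrightarrow> m \<ge> 0 \<Longrightarrow>
      (norm y < r \<Longrightarrow> \<gamma> * norm y powr (- \<theta>) \<le> Gfun f m) \<Longrightarrow>
      sqrt_F_ext m \<le> ?c * norm y powr (\<theta> / 2) + K * norm y powr (3 * \<theta> / 4)"
    using sqrt_F_ext_le_if_Gfun_ge[OF \<gamma>(1) r, where 'n='n] by blast
  have ext_le: "AE y in lborel. sqrt_F_ext (\<mu> y)
      \<le> ?c * norm y powr (\<theta> / 2) + K * norm y powr (3 * \<theta> / 4)"
    using large AE_lborel_singleton[of "0::real^'n"] by eventually_elim (use K(2) \<mu>(2) in auto)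
  have "0 < 3 * \<theta> / 4" "3 * \<theta> / 4 < \<theta>" "3 * \<theta> / 4 / \<theta> = 3 / 4" using theta by auto
  then obtain D where D: "D > 0" "\<And>t (x::real^'n). t > 0 \<Longrightarrow> norm x \<le> t powr (1/\<theta>) \<Longrightarrow>
      heat t (\<lambda>y. ennreal (norm y powr (3 * \<theta> / 4))) x \<le> ennreal (D * t powr (3 / 4))"
    using heat_norm_powr[of "3 * \<theta> / 4", where 'n='n] by metis
  define t0 where "t0 = min (F \<tau>) ((1 / 5 / (K * D)) powr 4)"
  have "t0 > 0" using F_pos[OF tau_pos] K(1) D(1) by (simp add: t0_def)
  moreover have "\<tau> \<le> w \<and> 4 * F w < t"
    if t: "0 < t" "t < t0" and x: "norm x \<le> t powr (1/\<theta>)"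
      and w: "0 \<le> w" "heat t (\<lambda>y. ennreal (\<mu> y)) x = ennreal w"
    for t x w
  proof -
    have "F (max \<tau> w) powr (1 / 2) \<le> ?c * (C * t powr (1 / 2)) + K * (D * t powr (3 / 4))"
      using C(1) K(1) D(1)
      by (intro sqrt_F_mean_le[OF t(1) \<mu> ext_le _ _ _ _ C(2)[OF t(1) x] D(2)[OF t(1) x]
          w(2,1)]) auto
    moreover have "?c * (C * t powr (1 / 2)) = 1 / 5 * t powr (1 / 2)"
      by (simp only: mult.assoc[symmetric] \<gamma>(2))
    moreover have "K * (D * t powr (3 / 4)) \<le> 1 / 5 * t powr (1 / 2)"
      using mult_powr_le_if_small[of "K * D" "1 / 5" "1 / 2" "3 / 4" t] K(1) D(1) t
      by (simp add: t0_def mult.assoc)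
    ultimately have "F (max \<tau> w) powr (1 / 2) \<le> 2 / 5 * t powr (1 / 2)" by linarith
    then show ?thesis using t by (intro conjI mean_large_if_sqrt_F_le) (auto simp: t0_def)
  qed
  ultimately show ?thesis unfolding early_means_large_def by blast
qed

end

context semilinear_heat
begin

lemma not_locally_solvable_if_large:
  assumes "hyp_C f"
  shows "\<exists>\<gamma>>0. \<forall>\<mu> :: real^'n \<Rightarrow> real. nonneg_loc_integrable \<mu> \<and>
     (\<exists>r>0. AE x in lebesgue. x \<in> ball 0 r \<longrightarrow> Gfun f (\<mu> x) \<ge> \<gamma> * norm x powr (- \<theta>))
       \<longrightarrow> \<not> locally_solvable \<theta> f \<mu>"
proof -
  obtain \<tau>1 where \<tau>1: "\<tau>1 \<ge> 0" "convex_on {\<tau>1..} f" using assms by (auto simp: hyp_C_def)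
  define \<sigma> where "\<sigma> = \<tau>1 + 1"
  have \<sigma>: "\<sigma> > 0" and cvx: "convex_on {\<sigma>..} f"
    using \<tau>1 by (auto simp: \<sigma>_def intro: convex_on_subset)
  have "1/2 < q" using q_ge_1 by simp
  then obtain a where a: "a > 0" "mono_on {a..} (\<lambda>u. f u * F u powr (1/2))"
    using fF_powr_eventually_mono by blast
  obtain \<tau> where \<tau>: "\<tau> \<ge> max (a + 1) \<sigma>" "f \<tau> \<ge> 2 * f \<sigma>"
    using f_unbounded[of "max (a + 1) \<sigma>" "2 * f \<sigma>"] \<sigma> by (auto simp: less_max_iff_disj)
  interpret convex_profile \<theta> f a \<tau> by unfold_locales (use a \<tau> in auto)
  have "0 < \<theta> / 2" "\<theta> / 2 < \<theta>" "\<theta> / 2 / \<theta> = 1 / 2" using theta by auto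
  then obtain C where C: "C > 0" "\<And>t (x::real^'n). t > 0 \<Longrightarrow> norm x \<le> t powr (1/\<theta>) \<Longrightarrow>
      heat t (\<lambda>y. ennreal (norm y powr (\<theta> / 2))) x \<le> ennreal (C * t powr (1 / 2))"
    using heat_norm_powr[of "\<theta> / 2", where 'n='n] by metis
  define \<gamma> where "\<gamma> = (5 * C) powr 2"
  have "\<gamma> > 0" using C(1) by (simp add: \<gamma>_def)
  moreover have "\<not> locally_solvable \<theta> f \<mu>"
    if \<mu>: "nonneg_loc_integrable \<mu>" and r: "r > 0"
      and large: "AE x in lebesgue. x \<in> ball 0 r \<longrightarrow> Gfun f (\<mu> x) \<ge> \<gamma> * norm x powr (- \<theta>)"
    for \<mu> :: "real^'n \<Rightarrow> real" and r
  proof -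
    obtain \<mu>' where \<mu>': "\<mu>' \<in> borel_measurable borel" "\<And>x. 0 \<le> \<mu>' x"
      and eq: "AE x in lborel. \<mu> x = \<mu>' x"
      using nonneg_loc_integrable_borel[OF \<mu>] by blast
    have "AE y in lborel. norm y < r \<longrightarrow> \<gamma> * norm y powr (- \<theta>) \<le> Gfun f (\<mu>' y)"
      using large[unfolded AE_completion_iff] eq by eventually_elim auto
    then have "early_means_large \<tau> \<mu>'"
      unfolding \<gamma>_def by (intro early_means_large_if_Gfun_ge[OF C \<mu>' r]) simp
    then show ?thesis
      using \<tau> by (intro not_locally_solvable_if_early_means_large[OF \<sigma> cvx _ _ \<mu>'(1) _ eq]) auto
  qed
  ultimately show ?thesis by blast
qed

end

theorem theorem1p1:
  fixes \<theta> :: real and f :: "real \<Rightarrow> real"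
  assumes theta: "0 < \<theta>" "\<theta> \<le> 2"
    and f_nonneg: "\<forall>u\<ge>0. f u \<ge> 0"
    and M: "hyp_M f" and S: "hyp_S f" and L: "hyp_L f"
  shows
    "(hyp_C f \<longrightarrow>
        (\<exists>\<gamma>>0. \<forall>\<mu> :: real^'n \<Rightarrow> real.
           nonneg_loc_integrable \<mu> \<and>
           (\<exists>r>0. AE x in lebesgue. x \<in> ball 0 r \<longrightarrow>
                    Gfun f (\<mu> x) \<ge> \<gamma> * norm x powr (- \<theta>))
           \<longrightarrow> \<not> locally_solvable \<theta> f \<mu>))
     \<and>
     (supercritical \<theta> f CARD('n) \<longrightarrow>
        (\<exists>\<epsilon>>0. \<forall>\<mu> :: real^'n \<Rightarrow> real.
           nonneg_loc_integrable \<mu> \<and> in_B \<mu> \<and>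
           (\<exists>r>0. AE x in lebesgue. x \<in> ball 0 r \<longrightarrow>
                    Gfun f (\<mu> x) \<le> \<epsilon> * norm x powr (- \<theta>))
           \<longrightarrow> locally_solvable \<theta> f \<mu> \<and>
               (\<exists>T>0. \<exists>u. is_solution \<theta> f \<mu> T u \<and> Linf_loc_time T u)))"
proof -
  interpret semilinear_heat \<theta> f by standard (fact theta M S L)+
  show ?thesis
    by (intro conjI impI not_locally_solvable_if_large locally_solvable_if_small)
qed

end
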